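(* Let $X$ be a Banach space, $f:X\to\mathbb{R}\cup\{+\infty\}$ lower semicontinuous and $\bar x\in[f\le0]$. Suppose that either $X$ is Asplund or $f$ is convex. Let $\tau>0$, $q\in(0,1]$, and adopt the convention $0^0=1$. Consider the conditions: (i) there is a neighbourhood $U$ of $\bar x$ such that $\tau\, d(x,[f\le0])\le f_+^q(x)$ for all $x\in U$; (ii) there is a neighbourhood $U$ of $\bar x$ such that $q f^{q-1}(x)\, d(0,\partial f(x))\ge\tau$ for all $x\in U\cap[f>0]$; (iii) there is a neighbourhood $U$ of $\bar x$ such that $q^q(1-q)^{1-q} d(x,[f\le0])^{q-1} d(0,\partial f(x))^q\ge\tau$ for all $x\in U\cap[f>0]$. Then (ii) implies (i); (iii) implies (i); and (ii) implies (iii) with $(1-q)^{1-q}\tau$ in place of $\tau$ (i.e. if (ii) holds with $\tau$, then (iii) holds with the constant $(1-q)^{1-q}\tau$). If $q=1$, conditions (ii) and (iii) coincide.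
   Context: $[f\le0]=\{x: f(x)\le0\}$, $[f>0]=\{x:f(x)>0\}$, $f_+(x)=\max\{f(x),0\}$; for $f(x)\ge0$, $f^q(x):=[f(x)]^q$, $f_+^q(x)=[f_+(x)]^q$. $d(x,A)=\inf_{a\in A}\|x-a\|$, $d(x,\emptyset)=+\infty$. $\partial f(x)$ is the Fréchet subdifferential: $\{x^*\in X^*:\liminf_{y\to x}\frac{f(y)-f(x)-\langle x^*,y-x\rangle}{\|y-x\|}\ge0\}$ if $f(x)<+\infty$, $\emptyset$ otherwise (equal to the convex subdifferential for convex $f$); $d(0,\partial f(x))=\inf\{\|x^*\|:x^*\in\partial f(x)\}$ ($+\infty$ if empty). A Banach space is Asplund if every continuous convex function on an open convex subset is Fréchet differentiable on a dense subset. *)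

theory Defs
  imports "HOL-Analysis.Analysis"
begin

(* Extended-real valued functions f : X \<Rightarrow> \<real> \<union> {+\<infinity>} are modelled as
  'a \<Rightarrow> ereal with the side condition that -\<infinity> is never attained. *)

definition lsc :: "('a::topological_space \<Rightarrow> ereal) \<Rightarrow> bool" where
  "lsc f \<longleftrightarrow> (\<forall>x. f x \<le> Liminf (at x) f)"

definition ereal_convex :: "('a::real_vector \<Rightarrow> ereal) \<Rightarrow> bool" where
  "ereal_convex f \<longleftrightarrow>
     (\<forall>x y t. 0 < t \<and> t < 1 \<longrightarrow>
        f (t *\<^sub>R x + (1 - t) *\<^sub>R y) \<le> ereal t * f x + ereal (1 - t) * f y)"

definition asplund :: "'a::real_normed_vector itself \<Rightarrow> bool" where
  "asplund _ \<longleftrightarrow>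
     (\<forall>(g::'a \<Rightarrow> real) U. open U \<and> convex U \<and> continuous_on U g \<and> convex_on U g \<longrightarrow>
        (\<exists>D \<subseteq> U. U \<subseteq> closure D \<and> (\<forall>x\<in>D. g differentiable (at x))))"

definition frechet_subdiff :: "('a::real_normed_vector \<Rightarrow> ereal) \<Rightarrow> 'a \<Rightarrow> ('a \<Rightarrow>\<^sub>L real) set" where
  "frechet_subdiff f x =
     (if f x < \<infinity> then
        {xs. 0 \<le> Liminf (at x) (\<lambda>y. (f y - f x - ereal (blinfun_apply xs (y - x))) / ereal (norm (y - x)))}
      else {})"

(* d(0, \<partial>f(x)) = inf of norms, +\<infinity> if the subdifferential is empty. *)
definition dsub :: "('a::real_normed_vector \<Rightarrow> ereal) \<Rightarrow> 'a \<Rightarrow> ereal" where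
  "dsub f x = (INF xs \<in> frechet_subdiff f x. ereal (norm xs))"

(* d(x,A), equal to +\<infinity> for A empty. *)
definition edist :: "'a::real_normed_vector \<Rightarrow> 'a set \<Rightarrow> ereal" where
  "edist x A = (INF a \<in> A. ereal (norm (x - a)))"

(* Real power with convention 0^0 = 1 (for nonnegative base). *)
definition pow0 :: "real \<Rightarrow> real \<Rightarrow> real" where
  "pow0 a p = (if a = 0 then (if p = 0 then 1 else 0) else a powr p)"

definition epow :: "ereal \<Rightarrow> real \<Rightarrow> ereal" where
  "epow a p = (if a = \<infinity> then (if p > 0 then \<infinity> else if p = 0 then 1 else 0)
               else ereal (pow0 (real_of_ereal a) p))"

definition sublevel :: "('a \<Rightarrow> ereal) \<Rightarrow> 'a set" where
  "sublevel f = {x. f x \<le> 0}"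

definition cond_i :: "('a::real_normed_vector \<Rightarrow> ereal) \<Rightarrow> 'a \<Rightarrow> real \<Rightarrow> real \<Rightarrow> bool" where
  "cond_i f xb \<tau> q \<longleftrightarrow> (\<exists>U. open U \<and> xb \<in> U \<and>
     (\<forall>x\<in>U. ereal \<tau> * edist x (sublevel f) \<le> epow (max (f x) 0) q))"

(* Condition (ii). At points with f x = +\<infinity> one has \<partial>f(x) = {} and d(0,\<partial>f(x)) = +\<infinity>;
  reading q f^{q-1}(x) d(0,\<partial>f(x)) = +\<infinity> there, the condition holds automatically,
  so it is only imposed where f x is finite. *)
definition cond_ii :: "('a::real_normed_vector \<Rightarrow> ereal) \<Rightarrow> 'a \<Rightarrow> real \<Rightarrow> real \<Rightarrow> bool" where
  "cond_ii f xb \<tau> q \<longleftrightarrow> (\<exists>U. open U \<and> xb \<in> U \<and>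
     (\<forall>x\<in>U. 0 < f x \<and> f x < \<infinity> \<longrightarrow>
        ereal (q * pow0 (real_of_ereal (f x)) (q - 1)) * dsub f x \<ge> ereal \<tau>))"

definition cond_iii :: "('a::real_normed_vector \<Rightarrow> ereal) \<Rightarrow> 'a \<Rightarrow> real \<Rightarrow> real \<Rightarrow> bool" where
  "cond_iii f xb \<tau> q \<longleftrightarrow> (\<exists>U. open U \<and> xb \<in> U \<and>
     (\<forall>x\<in>U. 0 < f x \<longrightarrow>
        ereal (pow0 q q * pow0 (1 - q) (1 - q)) * epow (edist x (sublevel f)) (q - 1)
          * epow (dsub f x) q \<ge> ereal \<tau>))"

end

theory Submission
  imports Defs
begin

text \<open>
  Both error bound implications rest on Ekeland's principle. If \<open>\<tau> d(x\<^sub>0, [f \<le> 0]) > f\<^sup>q(x\<^sub>0)\<close>, then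
  Ekeland applied to \<open>f\<^sub>+\<^sup>q\<close> (for (ii)) or to \<open>f\<^sub>+\<close> with radius \<open>q d(x\<^sub>0, [f \<le> 0])\<close> (for (iii); a little less if \<open>q = 1\<close>)
  gives a point \<open>x\<close> outside \<open>[f \<le> 0]\<close> at which \<open>f + c \<parallel>\<cdot> - x\<parallel>\<close> has a local minimum with a constant \<open>c\<close>
  too small for (ii) or (iii), provided that there are Frechet subgradients of norm at most \<open>c + \<epsilon>\<close>
  at points near \<open>x\<close>.

  For convex \<open>f\<close> these come from the Hahn-Banach theorem. In an Asplund space they are found in a separable
  subspace \<open>Y\<close>: the dual of \<open>Y\<close> is separable, so \<open>Y\<close> carries a smooth substitute for the norm, and the
  Borwein-Preiss principle turns the local minimum into a Frechet subgradient of \<open>f\<close> restricted to \<open>Y\<close>.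
  By Hahn-Banach, having a Frechet subgradient of norm at most \<open>c\<close> is a condition on finite convex
  combinations of function values, and \<open>Y\<close> can be chosen so large that it reflects these conditions.
\<close>

section \<open>Sublinear functionals and the Hahn-Banach theorem\<close>

text \<open>Origin of the constants: slope \<sigma> of \<open>f^q\<close> at a point where
  \<open>f\<close> has value \<open>p\<close> corresponds to slope
  \<open>(\<sigma>/q) p^(1-q)\<close> of \<open>f\<close>, exactly the quantity bounded in (ii). For
  (iii), let \<open>d\<close> be the distance from the starting point \<open>x0\<close> to
  \<open>[f \<le> 0]\<close>. A point within \<open>\<alpha> d\<close> of \<open>x0\<close> still
  has distance at least \<open>(1-\<alpha>) d\<close> to that set, and the resulting bound carries
  the factor \<open>\<alpha>^q (1-\<alpha>)^(1-q)\<close>; it is largest at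
  \<open>\<alpha> = q\<close>, which explains both the radius and \<open>q^q (1-q)^(1-q)\<close>.
  Subgradients are found only near the local minimizer, so a strict margin has to survive a small
  move. This works because the value and the distance enter with the nonpositive exponent
  \<open>q-1\<close>: lower bounds suffice, and lower semicontinuity and continuity of the distance
  supply them. The main obstacle is the definition of Asplund spaces: it yields points of
  differentiability in the whole space, possibly far from the separable subspace whose dual is to be
  shown separable. Functionals on that subspace are represented throughout by functionals on the
  whole space, compared only on the subspace.\<close>

definition sublinear :: "('a::real_vector \<Rightarrow> real) \<Rightarrow> bool" where
  "sublinear p \<longleftrightarrow> (\<forall>x y. p (x + y) \<le> p x + p y) \<and> (\<forall>t x. 0 \<le> t \<longrightarrow> p (t *\<^sub>R x) = t * p x)"

lemma sublinearI:
  assumes "\<And>x y. p (x + y) \<le> p x + p y" "p 0 = 0" "\<And>t x. 0 < t \<Longrightarrow> p (t *\<^sub>R x) \<le> t * p x"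
  shows "sublinear p"
  unfolding sublinear_def
proof (intro conjI allI impI)
  fix t :: real and x assume t: "0 \<le> t"
  show "p (t *\<^sub>R x) = t * p x"
  proof (cases "t = 0")
    case False
    then have t: "t > 0" using t by simp
    have "p x = p ((1 / t) *\<^sub>R (t *\<^sub>R x))" using t by simp
    also have "\<dots> \<le> (1 / t) * p (t *\<^sub>R x)" using t by (intro assms) simp
    finally have "t * p x \<le> p (t *\<^sub>R x)" using t by (simp add: field_simps)
    then show ?thesis using assms(3)[OF t, of x] by simp
  qed (simp add: assms)
qed (simp add: assms)

lemma sublinear_add: "sublinear p \<Longrightarrow> p (x + y) \<le> p x + p y"
  and sublinear_scale: "sublinear p \<Longrightarrow> 0 \<le> t \<Longrightarrow> p (t *\<^sub>R x) = t * p x"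
  by (auto simp: sublinear_def)

lemma sublinear_zero: "sublinear p \<Longrightarrow> p 0 = 0"
  using sublinear_scale[of p 0 0] by simp

lemma sublinear_uminus: "sublinear p \<Longrightarrow> - p (- x) \<le> p x"
  using sublinear_add[of p x "- x"] sublinear_zero[of p] by simp

lemma sublinear_diff: "sublinear p \<Longrightarrow> p x - p y \<le> p (x - y)"
  using sublinear_add[of p "x - y" y] by simp

text \<open>\<open>Q\<close> is the infimal convolution of \<open>P\<close> with the cone generated
  by \<open>C\<close>. The domination hypothesis keeps the infimum finite, since it bounds every
  candidate below by \<open>- P (- u)\<close>. The last conclusion exposes near-optimal
  representations, from which slices are read off later.\<close>

lemma sublinear_inf:
  fixes P :: "'a::real_vector \<Rightarrow> real"
  assumes P: "sublinear P" and C: "convex C" "C \<noteq> {}"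
    and dom: "\<And>h a. (h, a) \<in> C \<Longrightarrow> - P (- h) \<le> a"
  obtains Q where "sublinear Q" "\<And>u. Q u \<le> P u" "\<And>h a. (h, a) \<in> C \<Longrightarrow> Q h \<le> a"
    "\<And>u r. Q u < r \<Longrightarrow> \<exists>t h a. 0 \<le> t \<and> (h, a) \<in> C \<and> P (u - t *\<^sub>R h) + t * a < r"
proof -
  define W where "W u = {P (u - t *\<^sub>R h) + t * a | t h a. 0 \<le> t \<and> (h, a) \<in> C}" for u
  define Q where "Q u = Inf (W u)" for u
  obtain h0 a0 where ha0: "(h0, a0) \<in> C" using C(2) by auto
  have Pu_in: "P u \<in> W u" for u
    unfolding W_def using ha0 by (intro CollectI exI[of _ 0] exI[of _ h0] exI[of _ a0]) simp
  have lb: "- P (- u) \<le> w" if w: "w \<in> W u" for u w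
  proof -
    from w obtain t h a where *: "w = P (u - t *\<^sub>R h) + t * a" "0 \<le> t" "(h, a) \<in> C"
      unfolding W_def by blast
    have "P (- (t *\<^sub>R h)) - P (- u) \<le> P (- (t *\<^sub>R h) - - u)" by (rule sublinear_diff[OF P])
    moreover have "P (- (t *\<^sub>R h)) = t * P (- h)"
      using sublinear_scale[OF P *(2), of "- h"] by simp
    moreover have "0 \<le> t * (a + P (- h))"
      using dom[OF *(3)] *(2) by (intro mult_nonneg_nonneg) auto
    ultimately show ?thesis using * by (simp add: algebra_simps)
  qed
  have bdd: "bdd_below (W u)" for u using lb by (meson bdd_below.I)
  have Q_le: "Q u \<le> P (u - t *\<^sub>R h) + t * a" if "0 \<le> t" "(h, a) \<in> C" for u t h a
    unfolding Q_def by (rule cInf_lower[OF _ bdd]) (use that in \<open>auto simp: W_def\<close>)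
  have Q_less: "\<exists>t h a. 0 \<le> t \<and> (h, a) \<in> C \<and> P (u - t *\<^sub>R h) + t * a < r" if "Q u < r" for u r
  proof -
    have "\<exists>w\<in>W u. w < r"
      using that cInf_less_iff[OF _ bdd, of u r] Pu_in[of u] unfolding Q_def by blast
    then show ?thesis unfolding W_def by blast
  qed
  have Q_P: "Q u \<le> P u" for u
    unfolding Q_def by (rule cInf_lower[OF Pu_in bdd])
  have "sublinear Q"
  proof (rule sublinearI)
    fix u v
    show "Q (u + v) \<le> Q u + Q v"
    proof (rule field_le_epsilon)
      fix e :: real assume e: "e > 0"
      obtain t h a where 1: "0 \<le> t" "(h, a) \<in> C" "P (u - t *\<^sub>R h) + t * a < Q u + e / 2"
        using Q_less[of u "Q u + e / 2"] e by auto
      obtain s g b where 2: "0 \<le> s" "(g, b) \<in> C" "P (v - s *\<^sub>R g) + s * b < Q v + e / 2"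
        using Q_less[of v "Q v + e / 2"] e by auto
      show "Q (u + v) \<le> Q u + Q v + e"
      proof (cases "t + s = 0")
        case True
        then have "t = 0" "s = 0" using 1 2 by auto
        then show ?thesis using 1 2 Q_P[of "u + v"] sublinear_add[OF P, of u v] by simp
      next
        case False
        then have ts: "t + s > 0" using 1 2 by simp
        \<comment> \<open>Normalising the weights turns the two cone elements into a single one:
          scaled by \<open>t + s\<close>, this point of \<open>C\<close> is their sum.\<close>
        let ?k = "(t / (t + s)) *\<^sub>R h + (s / (t + s)) *\<^sub>R g"
        let ?c = "(t / (t + s)) * a + (s / (t + s)) * b"
        have "(t / (t + s)) *\<^sub>R (h, a) + (s / (t + s)) *\<^sub>R (g, b) \<in> C"
          using 1 2 ts by (intro convexD[OF C(1)]) (auto simp: add_divide_distrib[symmetric])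
        then have in_C: "(?k, ?c) \<in> C" by simp
        have "Q (u + v) \<le> P (u + v - (t + s) *\<^sub>R ?k) + (t + s) * ?c"
          using ts by (intro Q_le in_C) simp
        also have "(t + s) *\<^sub>R ?k = t *\<^sub>R h + s *\<^sub>R g"
          using ts by (simp add: scaleR_right_distrib)
        also have "(t + s) * ?c = t * a + s * b"
          using ts by (simp add: distrib_left)
        also have "u + v - (t *\<^sub>R h + s *\<^sub>R g) = (u - t *\<^sub>R h) + (v - s *\<^sub>R g)" by simp
        also have "P \<dots> \<le> P (u - t *\<^sub>R h) + P (v - s *\<^sub>R g)" by (rule sublinear_add[OF P])
        finally show ?thesis using 1 2 by simp
      qed
    qed
  next
    have "0 \<le> Q 0"
      unfolding Q_def by (rule cInf_greatest) (use Pu_in lb[of _ 0] sublinear_zero[OF P] in auto)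
    then show "Q 0 = 0" using Q_P[of 0] sublinear_zero[OF P] by simp
  next
    fix c :: real and u assume c: "0 < c"
    show "Q (c *\<^sub>R u) \<le> c * Q u"
    proof (rule field_le_epsilon)
      fix e :: real assume e: "e > 0"
      obtain t h a where 1: "0 \<le> t" "(h, a) \<in> C" "P (u - t *\<^sub>R h) + t * a < Q u + e / c"
        using Q_less[of u "Q u + e / c"] e c by auto
      have "Q (c *\<^sub>R u) \<le> P (c *\<^sub>R u - (c * t) *\<^sub>R h) + (c * t) * a"
        using 1 c by (intro Q_le) auto
      also have "c *\<^sub>R u - (c * t) *\<^sub>R h = c *\<^sub>R (u - t *\<^sub>R h)" by (simp add: scaleR_diff_right)
      also have "P \<dots> = c * P (u - t *\<^sub>R h)" using c by (intro sublinear_scale[OF P]) simp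
      also have "\<dots> + (c * t) * a = c * (P (u - t *\<^sub>R h) + t * a)" by (simp add: algebra_simps)
      also have "\<dots> \<le> c * (Q u + e / c)" using 1 c by (intro mult_left_mono) auto
      finally show "Q (c *\<^sub>R u) \<le> c * Q u + e" using c by (simp add: algebra_simps)
    qed
  qed
  moreover have "Q h \<le> a" if "(h, a) \<in> C" for h a
    using Q_le[of 1 h a h] that sublinear_zero[OF P] by simp
  ultimately show thesis using that Q_P Q_less by blast
qed

text \<open>Zorn's lemma for the reversed pointwise order; the lower bound \<open>b\<close> on
  \<open>T\<close> passes to infima of chains. Taking \<open>T\<close> empty gives the Hahn-Banach
  theorem, taking \<open>T\<close> a subspace and \<open>b\<close> a support function gives the
  function to which the Asplund property is applied.\<close>

lemma minimal_sublinear: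
  fixes p :: "'a::real_vector \<Rightarrow> real"
  assumes p: "sublinear p" "\<And>y. y \<in> T \<Longrightarrow> b y \<le> p y"
  obtains P where "sublinear P" "\<And>u. P u \<le> p u" "\<And>y. y \<in> T \<Longrightarrow> b y \<le> P y"
    "\<And>Q. sublinear Q \<Longrightarrow> (\<And>u. Q u \<le> P u) \<Longrightarrow> (\<And>y. y \<in> T \<Longrightarrow> b y \<le> Q y) \<Longrightarrow> Q = P"
proof -
  define A where "A = {P. sublinear P \<and> P \<le> p \<and> (\<forall>y\<in>T. b y \<le> P y)}"
  have "\<exists>m\<in>A. \<forall>a\<in>A. a \<le> m \<longrightarrow> a = m"
  proof (rule predicate_Zorn)
    show "partial_order_on A (relation_of (\<lambda>f g. g \<le> f) A)"
      by (rule partial_order_on_relation_ofI) auto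
  next
    fix C assume C: "C \<in> Chains (relation_of (\<lambda>f g :: 'a \<Rightarrow> real. g \<le> f) A)"
    have CA: "C \<subseteq> A" using C by (auto simp: Chains_def relation_of_def)
    have chain: "f \<le> g \<or> g \<le> f" if "f \<in> C" "g \<in> C" for f g
      using C that by (auto simp: Chains_def relation_of_def)
    show "\<exists>u\<in>A. \<forall>a\<in>C. u \<le> a"
    proof (cases "C = {}")
      case True
      then show ?thesis using p by (intro bexI[of _ p]) (auto simp: A_def)
    next
      case False
      define P where "P x = (INF f\<in>C. f x)" for x
      \<comment> \<open>Sublinear functions below \<open>p\<close> are bounded below by
        \<open>- p (- x)\<close>, so the infimum over the chain is finite.\<close>
      have lb: "- p (- x) \<le> f x" if "f \<in> C" for f x
      proof -
        have "sublinear f" "f (- x) \<le> p (- x)" using that CA by (auto simp: A_def le_fun_def)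
        then show ?thesis using sublinear_uminus[of f x] by linarith
      qed
      have bdd: "bdd_below ((\<lambda>f. f x) ` C)" for x using lb by (auto intro!: bdd_belowI)
      have le: "P x \<le> f x" if "f \<in> C" for f x
        unfolding P_def by (rule cINF_lower[OF bdd that])
      have less: "\<exists>f\<in>C. f x < r" if "P x < r" for x r
        using that cINF_less_iff[OF False bdd] unfolding P_def by auto
      have "sublinear P"
      proof (rule sublinearI)
        fix x y
        show "P (x + y) \<le> P x + P y"
        proof (rule field_le_epsilon)
          fix e :: real assume e: "e > 0"
          obtain f where f: "f \<in> C" "f x < P x + e / 2" using less[of x "P x + e / 2"] e by auto
          obtain g where g: "g \<in> C" "g y < P y + e / 2" using less[of y "P y + e / 2"] e by auto
          \<comment> \<open>Near-infimal members for \<open>x\<close> and for \<open>y\<close> may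
            differ; in a chain the smaller one serves both points.\<close>
          define k where "k = (if f \<le> g then f else g)"
          have k: "k \<in> C" "k \<le> f" "k \<le> g" using f g chain[of f g] by (auto simp: k_def)
          have "P (x + y) \<le> k (x + y)" by (rule le[OF k(1)])
          also have "\<dots> \<le> k x + k y" using k CA by (intro sublinear_add) (auto simp: A_def)
          also have "\<dots> \<le> f x + g y" using k by (intro add_mono) (auto simp: le_fun_def)
          finally show "P (x + y) \<le> P x + P y + e" using f g by simp
        qed
      next
        have "f 0 = 0" if "f \<in> C" for f using that CA by (auto simp: A_def sublinear_zero)
        then have "(\<lambda>f. f 0) ` C = {0}" using False by (auto simp: image_iff)
        then show "P 0 = 0" unfolding P_def by simp
      next
        fix t :: real and x assume t: "0 < t"
        show "P (t *\<^sub>R x) \<le> t * P x"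
        proof (rule field_le_epsilon)
          fix e :: real assume e: "e > 0"
          obtain f where f: "f \<in> C" "f x < P x + e / t" using less[of x "P x + e / t"] e t by auto
          have "P (t *\<^sub>R x) \<le> f (t *\<^sub>R x)" by (rule le[OF f(1)])
          also have "\<dots> = t * f x" using f CA t by (intro sublinear_scale) (auto simp: A_def)
          also have "\<dots> \<le> t * (P x + e / t)" using f t by (intro mult_left_mono) auto
          finally show "P (t *\<^sub>R x) \<le> t * P x + e" using t by (simp add: algebra_simps)
        qed
      qed
      moreover have "P \<le> p"
      proof -
        obtain f where "f \<in> C" using False by auto
        then have "P x \<le> f x" "f x \<le> p x" for x using le CA by (auto simp: A_def le_fun_def)
        then show ?thesis by (meson le_funI order_trans)
      qed
      moreover have "b y \<le> P y" if "y \<in> T" for y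
        unfolding P_def by (rule cINF_greatest[OF False]) (use CA that in \<open>auto simp: A_def\<close>)
      ultimately have "P \<in> A" by (simp add: A_def)
      then show ?thesis using le by (auto simp: le_fun_def)
    qed
  qed
  then obtain P where P: "P \<in> A" "\<And>Q. Q \<in> A \<Longrightarrow> Q \<le> P \<Longrightarrow> Q = P" by blast
  show thesis
  proof (rule that[of P])
    fix Q assume Q: "sublinear Q" "\<And>u. Q u \<le> P u" "\<And>y. y \<in> T \<Longrightarrow> b y \<le> Q y"
    have "Q \<le> P" using Q(2) by (simp add: le_fun_def)
    moreover have "Q \<in> A" using Q P(1) \<open>Q \<le> P\<close> by (auto simp: A_def)
    ultimately show "Q = P" by (rule P(2)[rotated])
  qed (use P in \<open>auto simp: A_def le_fun_def\<close>)
qed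

text \<open>A minimal sublinear function is linear: pushing it down by the single pair
  \<open>(- v, - L v)\<close> cannot change it, which forces \<open>L (- v) \<le> - L v\<close> and
  hence additivity.\<close>

theorem Hahn_Banach_dominated:
  fixes P :: "'a::real_vector \<Rightarrow> real"
  assumes P: "sublinear P"
  obtains L where "linear L" "\<And>u. L u \<le> P u"
proof -
  obtain L where L: "sublinear L" "\<And>u. L u \<le> P u"
    and min: "\<And>Q. sublinear Q \<Longrightarrow> (\<And>u. Q u \<le> L u) \<Longrightarrow> Q = L"
    by (rule minimal_sublinear[OF P, of "{}" "\<lambda>_. 0"]) auto
  have add: "L (u + v) = L u + L v" for u v
  proof -
    obtain Q where Q: "sublinear Q" "\<And>u. Q u \<le> L u" "Q (- v) \<le> - L v"
      by (rule sublinear_inf[OF L(1), of "{(- v, - L v)}"]) auto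
    have "Q = L" by (rule min) (use Q in auto)
    then have "L (- v) \<le> - L v" using Q by simp
    then show ?thesis using sublinear_add[OF L(1), of u v] sublinear_diff[OF L(1), of u "- v"]
      sublinear_add[OF L(1), of "u + v" "- v"] by simp
  qed
  have neg: "L (- u) = - L u" for u
    using add[of u "- u"] sublinear_zero[OF L(1)] by simp
  have "L (t *\<^sub>R u) = t * L u" for t u
  proof (cases "t \<ge> 0")
    case False
    then have "L (- ((- t) *\<^sub>R u)) = - ((- t) * L u)"
      unfolding neg using sublinear_scale[OF L(1), of "- t" u] by simp
    then show ?thesis by simp
  qed (simp add: sublinear_scale[OF L(1)])
  then have "linear L" using add by (auto intro: linearI)
  then show thesis using that L by blast
qed

text \<open>\<open>C\<close> acts as the epigraph of a convex function. The infimal convolution lies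
  below both \<open>P\<close> and \<open>C\<close>, so every linear functional below it separates
  them.\<close>

theorem Hahn_Banach_sandwich:
  fixes P :: "'a::real_vector \<Rightarrow> real"
  assumes P: "sublinear P" and C: "convex C"
    and dom: "\<And>h a. (h, a) \<in> C \<Longrightarrow> - P (- h) \<le> a"
  obtains L where "linear L" "\<And>u. L u \<le> P u" "\<And>h a. (h, a) \<in> C \<Longrightarrow> L h \<le> a"
proof (cases "C = {}")
  case True
  then show thesis using Hahn_Banach_dominated[OF P] that by blast
next
  case False
  obtain Q where Q: "sublinear Q" "\<And>u. Q u \<le> P u" "\<And>h a. (h, a) \<in> C \<Longrightarrow> Q h \<le> a"
    by (rule sublinear_inf[OF P C False dom]) auto
  obtain L where "linear L" "\<And>u. L u \<le> Q u" using Hahn_Banach_dominated[OF Q(1)] by blast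
  then show thesis using that Q by (meson order_trans)
qed

section \<open>Bounded functionals with a prescribed norm bound\<close>

lemma sublinear_norm: "0 \<le> c \<Longrightarrow> sublinear (\<lambda>x. c * norm x)"
  by (rule sublinearI) (auto simp: distrib_left[symmetric] mult_left_mono norm_triangle_ineq)

lemma blinfun_of_linear_le:
  fixes L :: "'a::real_normed_vector \<Rightarrow> real"
  assumes "linear L" "0 \<le> c" "\<And>u. L u \<le> c * norm u"
  obtains z :: "'a \<Rightarrow>\<^sub>L real" where "norm z \<le> c" "\<And>u. blinfun_apply z u = L u"
proof -
  have abs: "\<bar>L u\<bar> \<le> c * norm u" for u
    using assms(3)[of u] assms(3)[of "- u"] linear_neg[OF assms(1), of u] by simp
  have bl: "bounded_linear L"
    using assms(1) abs by (intro bounded_linear_intro[of _ c]) (auto simp: linear_add linear_scale mult.commute)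
  show thesis
  proof (rule that[of "Blinfun L"])
    show ap: "blinfun_apply (Blinfun L) u = L u" for u
      using bl by (simp add: bounded_linear_Blinfun_apply)
    show "norm (Blinfun L) \<le> c"
      by (rule norm_blinfun_bound) (use assms abs ap in auto)
  qed
qed

text \<open>This is how all subgradients on the whole space arise: \<open>C\<close> collects pairs
  of an increment \<open>u - x\<close> and an upper bound for the slope in that direction.\<close>

corollary Hahn_Banach_blinfun:
  fixes C :: "('a::real_normed_vector \<times> real) set"
  assumes "convex C" "0 \<le> c" "\<And>h a. (h, a) \<in> C \<Longrightarrow> - (c * norm h) \<le> a"
  obtains z :: "'a \<Rightarrow>\<^sub>L real" where "norm z \<le> c" "\<And>h a. (h, a) \<in> C \<Longrightarrow> blinfun_apply z h \<le> a"
proof -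
  obtain L where L: "linear L" "\<And>u. L u \<le> c * norm u" "\<And>h a. (h, a) \<in> C \<Longrightarrow> L h \<le> a"
    by (rule Hahn_Banach_sandwich[OF sublinear_norm[OF assms(2)] assms(1)]) (use assms in auto)
  then show thesis using blinfun_of_linear_le[OF L(1) assms(2) L(2)] that by metis
qed

lemma norming_functional:
  fixes y :: "'a::real_normed_vector"
  obtains z :: "'a \<Rightarrow>\<^sub>L real" where "norm z \<le> 1" "blinfun_apply z y = norm y"
proof -
  obtain z :: "'a \<Rightarrow>\<^sub>L real" where z: "norm z \<le> 1"
    "\<And>h a. (h, a) \<in> {(- y, - norm y)} \<Longrightarrow> blinfun_apply z h \<le> a"
    by (rule Hahn_Banach_blinfun[of "{(- y, - norm y)}" 1]) auto
  have "blinfun_apply z y \<le> norm y"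
    using norm_blinfun[of z y] z(1) mult_right_mono[OF z(1), of "norm y"] by simp
  moreover have "norm y \<le> blinfun_apply z y"
    using z(2)[of "- y" "- norm y"] by (simp add: blinfun.minus_right)
  ultimately show thesis using that z by force
qed

section \<open>Variational principles\<close>

text \<open>A closed epigraph over \<open>A\<close> encodes lower semicontinuity of a function that
  is infinite off \<open>A\<close>; the set \<open>A\<close> itself may fail to be closed, so
  membership of the limit is part of the conclusion.\<close>

lemma closed_epigraph_limit:
  fixes F :: "'a::real_normed_vector \<Rightarrow> real"
  assumes "closed {(u, r). u \<in> A \<and> F u \<le> r}" "\<And>k. X k \<in> A" "\<And>k. F (X k) \<le> a k"
    "X \<longlonglongrightarrow> x" "a \<longlonglongrightarrow> l"
  shows "x \<in> A \<and> F x \<le> l"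
proof -
  have "(\<lambda>k. (X k, a k)) \<longlonglongrightarrow> (x, l)" by (intro tendsto_Pair assms)
  then have "(x, l) \<in> {(u, r). u \<in> A \<and> F u \<le> r}"
    by (rule closed_sequentially[OF assms(1), rotated]) (use assms in auto)
  then show ?thesis by simp
qed

lemma convergent_if_tail_bound:
  fixes X :: "nat \<Rightarrow> 'a::banach"
  assumes "\<And>j k. k \<le> j \<Longrightarrow> norm (X j - X k) \<le> r k" "r \<longlonglongrightarrow> 0"
  shows "convergent X"
proof -
  have "Cauchy X"
  proof (rule CauchyI')
    fix e :: real assume "e > 0"
    then have "eventually (\<lambda>k. r k < e) sequentially"
      using order_tendstoD(2)[OF assms(2)] by blast
    then obtain M where M: "\<And>k. k \<ge> M \<Longrightarrow> r k < e" by (auto simp: eventually_sequentially)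
    show "\<exists>M. \<forall>m\<ge>M. \<forall>n>m. dist (X m) (X n) < e"
    proof (intro exI[of _ M] allI impI)
      fix m n assume "m \<ge> M" "m < n"
      then show "dist (X m) (X n) < e"
        using assms(1)[of m n] M[of m] by (simp add: dist_norm norm_minus_commute)
    qed
  qed
  then show ?thesis by (simp add: Cauchy_convergent)
qed

lemma almost_minimizer:
  fixes F :: "'a \<Rightarrow> real"
  assumes "A \<noteq> {}" "\<And>u. u \<in> A \<Longrightarrow> m \<le> F u" "e > 0"
  obtains x where "x \<in> A" "\<And>u. u \<in> A \<Longrightarrow> F x \<le> F u + e"
proof -
  have bdd: "bdd_below (F ` A)" using assms(2) by (auto intro!: bdd_belowI)
  have "(INF u\<in>A. F u) < (INF u\<in>A. F u) + e" using assms by simp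
  then obtain x where x: "x \<in> A" "F x < (INF u\<in>A. F u) + e"
    using cINF_less_iff[OF assms(1) bdd, THEN iffD1] by blast
  show thesis
  proof (rule that[OF x(1)])
    fix u assume "u \<in> A"
    then show "F x \<le> F u + e" using cINF_lower[OF bdd, of u] x(2) by simp
  qed
qed

text \<open>\<open>S x\<close> is the set of points below \<open>x\<close> in Ekeland's order. Each
  new point nearly minimises \<open>F\<close> on the current set, with error \<open>(1/2)^k\<close>,
  so the next set lies in a ball of radius \<open>(1/2)^k / s\<close>; completeness supplies the
  common point.\<close>

theorem Ekeland:
  fixes F :: "'a::banach \<Rightarrow> real"
  assumes epi: "closed {(u, r). u \<in> A \<and> F u \<le> r}" and x0: "x0 \<in> A"
    and bdd: "\<And>u. u \<in> A \<Longrightarrow> m \<le> F u" and s: "s > 0"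
  obtains x where "x \<in> A" "F x + s * norm (x - x0) \<le> F x0"
    "\<And>u. u \<in> A \<Longrightarrow> F x \<le> F u + s * norm (u - x)"
proof -
  define S where "S x = {u \<in> A. F u + s * norm (u - x) \<le> F x}" for x
  have S_self: "x \<in> S x" if "x \<in> A" for x using that by (simp add: S_def)
  have S_trans: "v \<in> S w" if "v \<in> S u" "u \<in> S w" for u v w
  proof -
    have "s * norm (v - w) \<le> s * (norm (v - u) + norm (u - w))"
      using s norm_triangle_ineq[of "v - u" "u - w"] by simp
    then show ?thesis using that unfolding S_def by (auto simp: algebra_simps)
  qed
  have "\<exists>X. \<forall>k. (X k \<in> A \<and> (k = 0 \<longrightarrow> X k = x0)) \<and>
    (X (Suc k) \<in> S (X k) \<and> (\<forall>u\<in>S (X k). F (X (Suc k)) \<le> F u + (1/2) ^ k))"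
  proof (rule dependent_nat_choice)
    show "\<exists>x. x \<in> A \<and> (0 = (0::nat) \<longrightarrow> x = x0)" using x0 by auto
  next
    fix x and n :: nat assume x: "x \<in> A \<and> (n = 0 \<longrightarrow> x = x0)"
    obtain y where y: "y \<in> S x" "\<And>u. u \<in> S x \<Longrightarrow> F y \<le> F u + (1/2) ^ n"
      by (rule almost_minimizer[of "S x" m F "(1/2) ^ n"]) (use x S_self bdd in \<open>auto simp: S_def\<close>)
    then show "\<exists>y. (y \<in> A \<and> (Suc n = 0 \<longrightarrow> y = x0)) \<and>
        (y \<in> S x \<and> (\<forall>u\<in>S x. F y \<le> F u + (1/2) ^ n))"
      by (intro exI[of _ y]) (auto simp: S_def)
  qed
  then obtain X where XA: "\<And>k. X k \<in> A" and X0: "X 0 = x0"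
    and XS: "\<And>k. X (Suc k) \<in> S (X k)"
    and Xmin: "\<And>k u. u \<in> S (X k) \<Longrightarrow> F (X (Suc k)) \<le> F u + (1/2) ^ k"
    by blast
  have X_mono: "X j \<in> S (X k)" if "k \<le> j" for j k
    using that by (induction j rule: dec_induct) (use S_self XA XS S_trans in blast)+
  have small: "norm (u - X (Suc k)) \<le> (1/2) ^ k / s" if "u \<in> S (X (Suc k))" for u k
  proof -
    have "u \<in> S (X k)" using that XS S_trans by blast
    then have "s * norm (u - X (Suc k)) \<le> (1/2) ^ k" using Xmin[of u k] that by (simp add: S_def)
    then show ?thesis using s by (simp add: pos_le_divide_eq mult.commute)
  qed
  have lim0: "(\<lambda>k. (1/2) ^ k / s) \<longlonglongrightarrow> 0"
    by (intro tendsto_divide_zero LIMSEQ_power_zero) simp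
  have "convergent (\<lambda>k. X (Suc k))"
    by (rule convergent_if_tail_bound[OF _ lim0]) (auto intro!: small X_mono)
  then obtain x where "(\<lambda>k. X (Suc k)) \<longlonglongrightarrow> x" by (auto simp: convergent_def)
  then have lim: "X \<longlonglongrightarrow> x" by (simp add: filterlim_sequentially_Suc)
  \<comment> \<open>Membership in \<open>S (X k)\<close> is an upper bound for \<open>F\<close> that
    varies continuously, so a closed epigraph preserves it in the limit.\<close>
  have x_S: "x \<in> S (X k)" for k
  proof -
    have "x \<in> A \<and> F x \<le> F (X k) - s * norm (x - X k)"
    proof (rule closed_epigraph_limit[OF epi])
      show "(\<lambda>j. X (j + k)) \<longlonglongrightarrow> x" using lim by (rule LIMSEQ_ignore_initial_segment)
      then show "(\<lambda>j. F (X k) - s * norm (X (j + k) - X k)) \<longlonglongrightarrow> F (X k) - s * norm (x - X k)"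
        by (intro tendsto_intros)
      show "F (X (j + k)) \<le> F (X k) - s * norm (X (j + k) - X k)" for j
        using X_mono[of k "j + k"] by (auto simp: S_def)
    qed (rule XA)
    then show ?thesis by (simp add: S_def)
  qed
  show thesis
  proof (rule that[of x])
    show "x \<in> A" "F x + s * norm (x - x0) \<le> F x0" using x_S[of 0] by (auto simp: S_def X0)
    fix u assume u: "u \<in> A"
    show "F x \<le> F u + s * norm (u - x)"
    proof (rule ccontr)
      assume neg: "\<not> ?thesis"
      \<comment> \<open>A point violating the conclusion lies in all the shrinking sets, hence
        equals their only common point.\<close>
      then have "u \<in> S x" using u by (simp add: S_def)
      then have "norm (u - X (Suc k)) \<le> (1/2) ^ k / s" for k using S_trans x_S small by blast
      then have "(\<lambda>k. norm (X (Suc k) - u)) \<longlonglongrightarrow> 0"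
        by (intro tendsto_sandwich[OF _ _ tendsto_const lim0]) (auto simp: norm_minus_commute)
      then have "(\<lambda>k. X (Suc k)) \<longlonglongrightarrow> u"
        by (rule LIM_zero_cancel[OF tendsto_norm_zero_cancel])
      then have "u = x" using \<open>(\<lambda>k. X (Suc k)) \<longlonglongrightarrow> x\<close> LIMSEQ_unique by blast
      then show False using neg by simp
    qed
  qed
qed

text \<open>In contrast to Ekeland's principle, the perturbation is a series of translates of a
  gauge \<psi>, so it inherits one-sided differentiability from \<psi>. Coercivity away from 0
  replaces the triangle inequality in showing that the iterates converge.\<close>

theorem Borwein_Preiss:
  fixes F :: "'a::banach \<Rightarrow> real"
  assumes epi: "closed {(u, r). u \<in> A \<and> F u \<le> r}" and x0: "x0 \<in> A"
    and bdd: "\<And>u. u \<in> A \<Longrightarrow> m \<le> F u"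
    and psi0: "\<psi> 0 = 0" and psi_nonneg: "\<And>u. 0 \<le> \<psi> u"
    and lip: "\<And>u v. \<bar>\<psi> u - \<psi> v\<bar> \<le> norm (u - v)"
    and coercive: "\<And>r. 0 < r \<Longrightarrow> \<exists>\<kappa>>0. \<forall>u. r \<le> norm u \<longrightarrow> \<kappa> \<le> \<psi> u"
    and mu: "\<And>k. 0 < \<mu> k" "summable \<mu>"
  obtains X x where "X 0 = x0" "\<And>k. X k \<in> A" "x \<in> A" "F x + \<mu> 0 * \<psi> (x - x0) \<le> F x0"
    "\<And>u. summable (\<lambda>k. \<mu> k * \<psi> (u - X k))"
    "\<And>u. u \<in> A \<Longrightarrow> F x + (\<Sum>k. \<mu> k * \<psi> (x - X k)) \<le> F u + (\<Sum>k. \<mu> k * \<psi> (u - X k))"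
proof -
  have "\<forall>k. \<exists>\<kappa>>0. \<forall>u. (1/2) ^ k \<le> norm u \<longrightarrow> \<kappa> \<le> \<psi> u" by (intro allI coercive) simp
  then obtain \<kappa> where "\<forall>k. \<kappa> k > 0 \<and> (\<forall>u. (1/2) ^ k \<le> norm u \<longrightarrow> \<kappa> k \<le> \<psi> u)"
    unfolding choice_iff by blast
  then have \<kappa>: "\<And>k. \<kappa> k > 0" "\<And>k u. (1/2) ^ k \<le> norm u \<Longrightarrow> \<kappa> k \<le> \<psi> u" by auto
  \<comment> \<open>At distance at least \<open>(1/2)^k\<close> the new term costs
    \<open>\<mu> k * \<kappa> k\<close>, twice the permitted error; points that are not worse than
    \<open>X k\<close> must therefore be closer.\<close>
  define \<epsilon> where "\<epsilon> k = min (\<mu> k * \<kappa> k / 2) ((1/2) ^ k)" for k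
  have \<epsilon>_pos: "\<epsilon> k > 0" for k using mu(1)[of k] \<kappa>(1)[of k] by (simp add: \<epsilon>_def)
  have \<epsilon>_lim: "\<epsilon> \<longlonglongrightarrow> 0"
    by (rule tendsto_sandwich[OF _ _ tendsto_const LIMSEQ_power_zero[of "1/2"]])
      (use \<epsilon>_pos in \<open>auto simp: less_imp_le \<epsilon>_def\<close>)
  \<comment> \<open>A state is the current perturbed function together with the current point.
    Near-minimality starts at \<open>n = 1\<close> because \<open>x0\<close> is arbitrary.\<close>
  define St where "St n p \<longleftrightarrow> snd p \<in> A \<and> (n = 0 \<longrightarrow> p = (F, x0)) \<and> (\<forall>u\<in>A. m \<le> fst p u) \<and>
    (n \<noteq> 0 \<longrightarrow> (\<forall>u\<in>A. fst p (snd p) \<le> fst p u + \<epsilon> n))" for n and p :: "('a \<Rightarrow> real) \<times> 'a"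
  define Tr where "Tr n p p' \<longleftrightarrow> fst p' = (\<lambda>u. fst p u + \<mu> n * \<psi> (u - snd p)) \<and>
    fst p' (snd p') \<le> fst p' (snd p)" for n and p p' :: "('a \<Rightarrow> real) \<times> 'a"
  have "\<exists>p. \<forall>n. St n (p n) \<and> Tr n (p n) (p (Suc n))"
  proof (rule dependent_nat_choice)
    show "\<exists>p. St 0 p" using x0 bdd by (intro exI[of _ "(F, x0)"]) (simp add: St_def)
  next
    fix p n assume p: "St n p"
    define g where "g u = fst p u + \<mu> n * \<psi> (u - snd p)" for u
    have g_bdd: "m \<le> g u" if "u \<in> A" for u
    proof -
      have "0 \<le> \<mu> n * \<psi> (u - snd p)" using mu(1)[of n] psi_nonneg by simp
      moreover have "m \<le> fst p u" using p that by (simp add: St_def)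
      ultimately show ?thesis by (simp add: g_def)
    qed
    obtain y where y: "y \<in> A" "\<And>u. u \<in> A \<Longrightarrow> g y \<le> g u + \<epsilon> (Suc n)"
      using almost_minimizer[of A m g "\<epsilon> (Suc n)"] x0 g_bdd \<epsilon>_pos by blast
    \<comment> \<open>Falling back on the old point keeps near-minimality and also makes the values
      decrease.\<close>
    define z where "z = (if g y \<le> g (snd p) then y else snd p)"
    have "g z \<le> g y" "g z \<le> g (snd p)" "z \<in> A" using y p by (auto simp: z_def St_def)
    then have "St (Suc n) (g, z)" "Tr n p (g, z)"
      using g_bdd y by (auto simp: St_def Tr_def g_def[abs_def] intro: order_trans)
    then show "\<exists>p'. St (Suc n) p' \<and> Tr n p p'" by blast
  qed
  then obtain p where St: "\<And>n. St n (p n)" and Tr: "\<And>n. Tr n (p n) (p (Suc n))" by blast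
  define X where "X n = snd (p n)" for n
  define G where "G n u = (\<Sum>i<n. \<mu> i * \<psi> (u - X i))" for n u
  have X0: "X 0 = x0" using St[of 0] by (simp add: St_def X_def)
  have XA: "X k \<in> A" for k using St[of k] by (simp add: St_def X_def)
  have pG: "fst (p n) = (\<lambda>u. F u + G n u)" for n
  proof (induction n)
    case 0 then show ?case using St[of 0] by (simp add: St_def G_def)
  next
    case (Suc n)
    then show ?case using Tr[of n] by (simp add: Tr_def G_def X_def add.assoc)
  qed
  have term_nonneg: "0 \<le> \<mu> i * \<psi> (u - X i)" for i u
    using mu(1)[of i] psi_nonneg by simp
  have G_mono: "G k u \<le> G j u" if "k \<le> j" for j k u
    unfolding G_def using that term_nonneg by (intro sum_mono2) auto
  define val where "val k = F (X k) + G k (X k)" for k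
  have "val (Suc k) \<le> val k" for k
    using Tr[of k] by (simp add: Tr_def pG X_def[symmetric] val_def) (simp add: G_def psi0)
  then have val_anti: "val j \<le> val k" if "k \<le> j" for j k
    using that by (rule lift_Suc_antimono_le)
  have val_le: "val k \<le> F u + G k u + \<epsilon> k" if "u \<in> A" "k \<noteq> 0" for u k
    using St[of k] that by (simp add: St_def pG X_def[symmetric] val_def)
  have X_val: "F (X j) + G (Suc k) (X j) \<le> val k" if "k < j" for j k
    using val_anti[of k j] G_mono[of "Suc k" j "X j"] that by (simp add: val_def)
  have small: "norm (u - X k) \<le> (1/2) ^ k" if "u \<in> A" "F u + G (Suc k) u \<le> val k" "k \<noteq> 0" for u k
  proof (rule ccontr)
    assume "\<not> ?thesis"
    then have "\<kappa> k \<le> \<psi> (u - X k)" by (intro \<kappa>) simp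
    then have "\<mu> k * \<kappa> k \<le> \<mu> k * \<psi> (u - X k)" using mu(1)[of k] by simp
    moreover have "\<mu> k * \<psi> (u - X k) \<le> \<epsilon> k" using val_le[OF that(1,3)] that(2) by (simp add: G_def)
    moreover have "\<epsilon> k \<le> \<mu> k * \<kappa> k / 2" by (simp add: \<epsilon>_def)
    moreover have "\<mu> k * \<kappa> k > 0" using mu(1)[of k] \<kappa>(1)[of k] by simp
    ultimately show False by simp
  qed
  have "convergent (\<lambda>k. X (Suc k))"
  proof (rule convergent_if_tail_bound)
    show "(\<lambda>k. (1/2 :: real) ^ k) \<longlonglongrightarrow> 0" by (rule LIMSEQ_power_zero) simp
    show "norm (X (Suc j) - X (Suc k)) \<le> (1/2) ^ k" if "k \<le> j" for j k
    proof (cases "j = k")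
      case False
      then have "norm (X (Suc j) - X (Suc k)) \<le> (1/2) ^ Suc k"
        using that by (intro small XA X_val) auto
      also have "\<dots> \<le> (1/2) ^ k" by simp
      finally show ?thesis .
    qed simp
  qed
  then obtain x where "(\<lambda>k. X (Suc k)) \<longlonglongrightarrow> x" by (auto simp: convergent_def)
  then have lim: "X \<longlonglongrightarrow> x" by (simp add: filterlim_sequentially_Suc)
  have psi_cont: "continuous_on UNIV \<psi>"
    by (rule lipschitz_on_continuous_on[of 1]) (use lip in \<open>auto intro!: lipschitz_onI simp: dist_norm\<close>)
  have G_cont: "continuous_on UNIV (G k)" for k
    unfolding G_def[abs_def]
    by (intro continuous_intros continuous_on_compose2[OF psi_cont]) auto
  have x_val: "x \<in> A \<and> F x \<le> val k - G (Suc k) x" for k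
  proof (rule closed_epigraph_limit[OF epi])
    show lim': "(\<lambda>j. X (j + Suc k)) \<longlonglongrightarrow> x" using lim by (rule LIMSEQ_ignore_initial_segment)
    show "(\<lambda>j. val k - G (Suc k) (X (j + Suc k))) \<longlonglongrightarrow> val k - G (Suc k) x"
      by (intro tendsto_intros continuous_on_tendsto_compose[OF G_cont lim']) auto
    show "F (X (j + Suc k)) \<le> val k - G (Suc k) (X (j + Suc k))" for j
      using X_val[of k "j + Suc k"] by simp
  qed (rule XA)
  have summ: "summable (\<lambda>k. \<mu> k * \<psi> (u - X k))" for u
  proof -
    have "Bseq X" using lim convergentI convergent_imp_Bseq by blast
    then obtain B where B: "\<And>k. norm (X k) \<le> B" by (auto simp: Bseq_def)
    show ?thesis
    proof (rule summable_comparison_test')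
      show "summable (\<lambda>k. \<mu> k * (norm u + B))" by (intro summable_mult2 mu)
      show "norm (\<mu> k * \<psi> (u - X k)) \<le> \<mu> k * (norm u + B)" if "k \<ge> 0" for k
      proof -
        have "\<psi> (u - X k) \<le> norm (u - X k)" using lip[of "u - X k" 0] psi0 by simp
        also have "\<dots> \<le> norm u + B" using norm_triangle_ineq4[of u "X k"] B[of k] by simp
        finally have "\<mu> k * \<psi> (u - X k) \<le> \<mu> k * (norm u + B)"
          using mu(1)[of k] by (intro mult_left_mono) auto
        then show ?thesis using term_nonneg[of k u] by simp
      qed
    qed
  qed
  show thesis
  proof (rule that[of X x])
    show "F x + \<mu> 0 * \<psi> (x - x0) \<le> F x0" using x_val[of 0] by (simp add: val_def G_def X0)
    fix u assume u: "u \<in> A"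
    have Glim: "(\<lambda>k. G k v) \<longlonglongrightarrow> (\<Sum>k. \<mu> k * \<psi> (v - X k))" for v
      unfolding G_def by (rule summable_LIMSEQ[OF summ])
    show "F x + (\<Sum>k. \<mu> k * \<psi> (x - X k)) \<le> F u + (\<Sum>k. \<mu> k * \<psi> (u - X k))"
    proof (rule LIMSEQ_le)
      show "(\<lambda>k. F x + G (Suc k) x) \<longlonglongrightarrow> F x + (\<Sum>k. \<mu> k * \<psi> (x - X k))"
        by (intro tendsto_intros LIMSEQ_Suc Glim)
      show "(\<lambda>k. F u + G k u + \<epsilon> k) \<longlonglongrightarrow> F u + (\<Sum>k. \<mu> k * \<psi> (u - X k))"
        using tendsto_add[OF tendsto_add[OF tendsto_const Glim] \<epsilon>_lim, of "F u" u] by simp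
      show "\<exists>N. \<forall>n\<ge>N. F x + G (Suc n) x \<le> F u + G n u + \<epsilon> n"
      proof (intro exI[of _ 1] allI impI)
        fix n :: nat assume "n \<ge> 1"
        then show "F x + G (Suc n) x \<le> F u + G n u + \<epsilon> n"
          using x_val[of n] val_le[OF u, of n] by simp
      qed
    qed
  qed (use X0 XA x_val summ in auto)
qed

section \<open>Separable subspaces of Asplund spaces\<close>

lemma abs_blinfun_le: "norm z \<le> 1 \<Longrightarrow> \<bar>blinfun_apply z y\<bar> \<le> norm y" for z :: "'a::real_normed_vector \<Rightarrow>\<^sub>L real"
  using norm_blinfun[of z y] mult_right_mono[of "norm z" 1 "norm y"] by simp

lemma SUP_functionals:
  fixes A :: "('a::real_normed_vector \<Rightarrow>\<^sub>L real) set"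
  assumes "A \<noteq> {}" "A \<subseteq> {a. norm a \<le> 1}"
  shows "a \<in> A \<Longrightarrow> blinfun_apply a y \<le> (SUP a\<in>A. blinfun_apply a y)"
    and "(SUP a\<in>A. blinfun_apply a y) \<le> norm y"
    and "r < (SUP a\<in>A. blinfun_apply a y) \<Longrightarrow> \<exists>a\<in>A. r < blinfun_apply a y"
proof -
  have le: "blinfun_apply a y \<le> norm y" if "a \<in> A" for a
    using abs_blinfun_le[of a y] assms(2) that by auto
  have bdd: "bdd_above ((\<lambda>a. blinfun_apply a y) ` A)"
    using le by (auto intro!: bdd_aboveI)
  show "a \<in> A \<Longrightarrow> blinfun_apply a y \<le> (SUP a\<in>A. blinfun_apply a y)"
    by (rule cSUP_upper[OF _ bdd])
  show "(SUP a\<in>A. blinfun_apply a y) \<le> norm y"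
    by (rule cSUP_least[OF assms(1) le])
  show "r < (SUP a\<in>A. blinfun_apply a y) \<Longrightarrow> \<exists>a\<in>A. r < blinfun_apply a y"
    using less_cSUP_iff[OF assms(1) bdd] by blast
qed

text \<open>With the graph of \<open>a\<close> as \<open>C\<close> the sandwich gives
  \<open>L \<le> a\<close> on \<open>Y\<close>; on a subspace, applying this to \<open>- y\<close>
  turns it into equality.\<close>

lemma Hahn_Banach_extension:
  fixes P :: "'a::real_vector \<Rightarrow> real"
  assumes P: "sublinear P" and Y: "subspace Y"
    and a: "\<And>x y. x \<in> Y \<Longrightarrow> y \<in> Y \<Longrightarrow> a (x + y) = a x + a y"
      "\<And>t x. x \<in> Y \<Longrightarrow> a (t *\<^sub>R x) = t * a x"
    and le: "\<And>y. y \<in> Y \<Longrightarrow> a y \<le> P y"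
  obtains L where "linear L" "\<And>u. L u \<le> P u" "\<And>y. y \<in> Y \<Longrightarrow> L y = a y"
proof -
  have neg: "a (- y) = - a y" if "y \<in> Y" for y using a(2)[OF that, of "-1"] by simp
  define C where "C = {(y, a y) | y. y \<in> Y}"
  have "convex C"
    unfolding convex_def C_def
    using Y a by (auto simp: subspace_add subspace_scale)
  moreover have "- P (- h) \<le> b" if "(h, b) \<in> C" for h b
    using that le[of "- h"] neg[of h] Y by (auto simp: C_def subspace_neg)
  ultimately obtain L where L: "linear L" "\<And>u. L u \<le> P u" "\<And>h b. (h, b) \<in> C \<Longrightarrow> L h \<le> b"
    using Hahn_Banach_sandwich[OF P] by metis
  have "L y = a y" if "y \<in> Y" for y
  proof -
    have "L y \<le> a y" "L (- y) \<le> a (- y)" using that Y by (auto intro!: L simp: C_def subspace_neg)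
    then show ?thesis using neg[OF that] linear_neg[OF L(1), of y] by simp
  qed
  then show thesis using that L by blast
qed

text \<open>
  If the unit ball \<open>K\<close> of the dual had no countable \<open>e\<close>-net with respect to \<open>Y\<close>, removing all countably
  coverable half-spaces from \<open>K\<close> would leave a set \<open>A\<close> none of whose slices by elements of \<open>Y\<close> is small.
  The support function \<open>p\<close> of \<open>A\<close> need not be interesting off \<open>Y\<close>, so it is replaced by a minimal sublinear
  \<open>P\<close> with \<open>P \<ge> p\<close> on \<open>Y\<close>; minimality transports the small slice that belongs to a point of
  differentiability of \<open>P\<close> back to a slice of \<open>A\<close> by an element of \<open>Y\<close>.
\<close>

lemma asplund_separable_dual_net:
  fixes D Y :: "'a::real_normed_vector set"
  assumes asp: "asplund TYPE('a)" and D: "countable D" and Y: "Y = closure D" "subspace Y"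
    and e: "e > 0"
  shows "\<exists>N. countable N \<and> (\<forall>z::'a \<Rightarrow>\<^sub>L real. norm z \<le> 1 \<longrightarrow>
    (\<exists>w\<in>N. \<forall>y\<in>Y. \<bar>blinfun_apply z y - blinfun_apply w y\<bar> \<le> e * norm y))"
proof (rule ccontr)
  assume neg: "\<not> ?thesis"
  define near where "near z w \<longleftrightarrow> (\<forall>y\<in>Y. \<bar>blinfun_apply z y - blinfun_apply w y\<bar> \<le> e * norm y)"
    for z w :: "'a \<Rightarrow>\<^sub>L real"
  \<comment> \<open>The coverable sets form a sigma-ideal: closed under subsets and countable
    unions. It plays the role of the countable sets in a Cantor-Bendixson argument.\<close>
  define cov where "cov H \<longleftrightarrow> (\<exists>N. countable N \<and> (\<forall>z\<in>H. \<exists>w\<in>N. near z w))" for H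
  define K where "K = {z :: 'a \<Rightarrow>\<^sub>L real. norm z \<le> 1}"
  have not_cov: "\<not> cov K" using neg by (auto simp: cov_def K_def near_def)
  have cov_mono: "cov G" if "cov H" "G \<subseteq> H" for G H using that unfolding cov_def by blast
  have cov_Union: "cov (\<Union>\<H>)" if "countable \<H>" "\<And>H. H \<in> \<H> \<Longrightarrow> cov H" for \<H>
  proof -
    have "\<forall>H\<in>\<H>. \<exists>N. countable N \<and> (\<forall>z\<in>H. \<exists>w\<in>N. near z w)"
      using that(2) by (simp add: cov_def)
    then obtain N where N: "\<And>H. H \<in> \<H> \<Longrightarrow> countable (N H) \<and> (\<forall>z\<in>H. \<exists>w\<in>N H. near z w)"
      by metis
    show ?thesis unfolding cov_def
      by (rule exI[of _ "\<Union>H\<in>\<H>. N H"]) (use N that(1) in \<open>auto; blast\<close>)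
  qed
  \<comment> \<open>Directions from the countable set \<open>D\<close> and rational levels leave
    only countably many slices to remove, so the removed part stays coverable.\<close>
  define HS where "HS = (\<lambda>(y, r). {z \<in> K. r < blinfun_apply z y})"
  define \<H> where "\<H> = {H \<in> HS ` (D \<times> \<rat>). cov H}"
  have "countable \<H>"
    unfolding \<H>_def using D countable_rat by (intro countable_Collect countable_image countable_SIGMA)
  then have covW: "cov (\<Union>\<H>)" by (rule cov_Union) (simp add: \<H>_def)
  define A where "A = K - \<Union>\<H>"
  have A_ne: "A \<noteq> {}" using cov_mono[OF covW, of K] not_cov by (auto simp: A_def)
  have A_norm: "norm a \<le> 1" if "a \<in> A" for a using that by (simp add: A_def K_def)
  have A_sub: "A \<subseteq> {a. norm a \<le> 1}" by (auto simp: A_def K_def)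
  define p where "p y = (SUP a\<in>A. blinfun_apply a y)" for y
  note p_upper = SUP_functionals(1)[OF A_ne A_sub, folded p_def]
    and p_norm = SUP_functionals(2)[OF A_ne A_sub, folded p_def]
    and p_less = SUP_functionals(3)[OF A_ne A_sub, folded p_def]
  \<comment> \<open>A slice inside one \<open>near\<close>-ball contains, around any of its points
    \<open>a1\<close>, a slice with direction in \<open>D\<close> and rational level. That slice,
    taken in \<open>K\<close>, is covered by the removed part and one ball, so it had been removed,
    although it contains \<open>a1\<close>.\<close>
  have no_small_slice: "\<not> (\<forall>a\<in>A. p y - b < blinfun_apply a y \<longrightarrow> near a w)"
    if y: "y \<in> Y" and b: "b > 0" for y b w
  proof
    assume sl: "\<forall>a\<in>A. p y - b < blinfun_apply a y \<longrightarrow> near a w"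
    obtain a1 where a1: "a1 \<in> A" "p y - b < blinfun_apply a1 y" using p_less[of "p y - b" y] b by auto
    define g where "g = blinfun_apply a1 y - (p y - b)"
    have g: "g > 0" using a1 by (simp add: g_def)
    obtain y' where y': "y' \<in> D" "norm (y' - y) < g / 4"
      using y g unfolding Y closure_approachable dist_norm by (meson divide_pos_pos zero_less_numeral)
    obtain r where r: "r \<in> \<rat>" "blinfun_apply a1 y' - g / 4 < r" "r < blinfun_apply a1 y'"
      using Rats_dense_in_real[of "blinfun_apply a1 y' - g / 4" "blinfun_apply a1 y'"] g by auto
    have diff: "\<bar>blinfun_apply a y' - blinfun_apply a y\<bar> < g / 4" if "a \<in> A" for a
      using abs_blinfun_le[OF A_norm[OF that], of "y' - y"] y'(2) by (simp add: blinfun.diff_right)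
    have "HS (y', r) \<subseteq> \<Union>\<H> \<union> {z. near z w}"
    proof
      fix z assume z: "z \<in> HS (y', r)"
      show "z \<in> \<Union>\<H> \<union> {z. near z w}"
      proof (cases "z \<in> \<Union>\<H>")
        case False
        then have zA: "z \<in> A" using z by (auto simp: A_def HS_def)
        have "r < blinfun_apply z y'" using z by (simp add: HS_def)
        then have "p y - b < blinfun_apply z y"
          using diff[OF zA] diff[OF a1(1)] r(2) g g_def by linarith
        then show ?thesis using sl zA by simp
      qed simp
    qed
    moreover have "cov (\<Union>{\<Union>\<H>, {z. near z w}})"
      by (rule cov_Union) (use covW in \<open>auto simp: cov_def intro: exI[of _ "{w}"]\<close>)
    ultimately have "cov (HS (y', r))" by (auto intro: cov_mono)
    then have "HS (y', r) \<in> \<H>" using y' r by (auto simp: \<H>_def)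
    moreover have "a1 \<in> HS (y', r)" using a1 r by (simp add: HS_def A_def)
    ultimately show False using a1(1) by (auto simp: A_def)
  qed
  have norm_sub: "sublinear (norm :: 'a \<Rightarrow> real)" using sublinear_norm[of 1] by simp
  obtain P where P: "sublinear P" "\<And>u. P u \<le> norm u" "\<And>y. y \<in> Y \<Longrightarrow> p y \<le> P y"
    and P_min: "\<And>Q. sublinear Q \<Longrightarrow> (\<And>u. Q u \<le> P u) \<Longrightarrow> (\<And>y. y \<in> Y \<Longrightarrow> p y \<le> Q y) \<Longrightarrow> Q = P"
    using minimal_sublinear[OF norm_sub, of Y p] p_norm by blast
  have "\<bar>P u - P v\<bar> \<le> norm (u - v)" for u v
    using sublinear_diff[OF P(1), of u v] sublinear_diff[OF P(1), of v u] P(2)[of "u - v"] P(2)[of "v - u"]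
    by (simp add: norm_minus_commute)
  then have P_cont: "continuous_on UNIV P"
    by (intro lipschitz_on_continuous_on[of 1]) (auto intro!: lipschitz_onI simp: dist_norm)
  have "convex_on UNIV P"
  proof (rule convex_onI)
    fix t :: real and x y :: 'a assume t: "0 < t" "t < 1"
    show "P ((1 - t) *\<^sub>R x + t *\<^sub>R y) \<le> (1 - t) * P x + t * P y"
      using sublinear_add[OF P(1), of "(1 - t) *\<^sub>R x" "t *\<^sub>R y"] t by (simp add: sublinear_scale[OF P(1)])
  qed simp
  then obtain E where "UNIV \<subseteq> closure E" "\<forall>x\<in>E. P differentiable (at x)"
    using asp P_cont unfolding asplund_def by (metis convex_UNIV open_UNIV)
  moreover from this have "E \<noteq> {}" by auto
  ultimately obtain x where "P differentiable (at x)" by auto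
  then obtain P' where P': "(P has_derivative P') (at x)" by (auto simp: differentiable_def)
  then have P'_bl: "bounded_linear P'" by (rule has_derivative_bounded_linear)
  define w where "w = Blinfun P'"
  have w: "blinfun_apply w = P'" using P'_bl by (simp add: w_def bounded_linear_Blinfun_apply)
  obtain d where d: "d > 0"
    "\<And>y. norm (y - x) < d \<Longrightarrow> \<bar>P y - P x - P' (y - x)\<bar> \<le> e / 2 * norm (y - x)"
    using P' e unfolding has_derivative_at_alt by (metis half_gt_zero real_norm_def)
  \<comment> \<open>\<alpha> is the linearisation error at distance \<open>d / 2\<close>. The
    deficit of \<open>L\<close> at \<open>x\<close> is allowed to be equally large, and the two
    together amount to \<open>e * (d / 2)\<close>.\<close>
  define \<alpha> where "\<alpha> = e / 2 * (d / 2)"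
  have \<alpha>: "\<alpha> > 0" using e d by (simp add: \<alpha>_def)
  \<comment> \<open>Smulian's argument: functionals below \<open>P\<close> that almost attain
    \<open>P x\<close> are close to the derivative in norm.\<close>
  have one_sided: "L v - P' v \<le> e * norm v"
    if L: "linear L" "\<And>u. L u \<le> P u" "P x - \<alpha> < L x" for L v
  proof (cases "v = 0")
    case True
    then show ?thesis using linear_0[OF L(1)] linear_0[OF bounded_linear.linear[OF P'_bl]] by simp
  next
    case False
    define s where "s = d / 2 / norm v"
    have s: "s > 0" using False d by (simp add: s_def)
    have ns: "norm (s *\<^sub>R v) = d / 2" using False d by (simp add: s_def)
    have "s * L v = L (x + s *\<^sub>R v) - L x"
      using linear_add[OF L(1)] linear_scale[OF L(1)] by simp
    also have "\<dots> \<le> P (x + s *\<^sub>R v) - P x + \<alpha>" using L(2)[of "x + s *\<^sub>R v"] L(3) by simp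
    also have "\<dots> \<le> P' (s *\<^sub>R v) + 2 * \<alpha>"
    proof -
      have "\<bar>P (x + s *\<^sub>R v) - P x - P' (s *\<^sub>R v)\<bar> \<le> \<alpha>"
        using d(2)[of "x + s *\<^sub>R v"] d(1) unfolding add_diff_cancel_left' ns \<alpha>_def by linarith
      then show ?thesis by linarith
    qed
    also have "P' (s *\<^sub>R v) = s * P' v"
      by (simp add: linear_scale[OF bounded_linear.linear[OF P'_bl]])
    finally have "s * (L v - P' v) \<le> 2 * \<alpha>" by (simp add: algebra_simps)
    also have "2 * \<alpha> = s * (e * norm v)" using False by (simp add: \<alpha>_def s_def)
    finally show ?thesis using s by simp
  qed
  have near_w: "near a w"
    if a: "a \<in> A" and L: "linear L" "\<And>u. L u \<le> P u" "P x - \<alpha> < L x"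
      "\<And>y. y \<in> Y \<Longrightarrow> L y = blinfun_apply a y" for a L
    unfolding near_def
  proof
    fix y assume y: "y \<in> Y"
    have "L (- y) - P' (- y) \<le> e * norm (- y)" by (rule one_sided[OF L(1-3)])
    then have "- (L y - P' y) \<le> e * norm y"
      using linear_neg[OF L(1)] linear_neg[OF bounded_linear.linear[OF P'_bl]] by simp
    then show "\<bar>blinfun_apply a y - blinfun_apply w y\<bar> \<le> e * norm y"
      using one_sided[OF L(1-3), of y] L(4)[OF y] w by (simp add: abs_le_iff)
  qed
  \<comment> \<open>An element of \<open>A\<close> is bounded by \<open>P\<close> only on
    \<open>Y\<close>, so it is replaced by another extension of its restriction that is bounded by
    \<open>P\<close> everywhere.\<close>
  have ext: "\<exists>L. linear L \<and> (\<forall>u. L u \<le> P u) \<and> (\<forall>y\<in>Y. L y = blinfun_apply a y)" if "a \<in> A" for a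
  proof -
    have "blinfun_apply a y \<le> P y" if "y \<in> Y" for y
      using p_upper[OF \<open>a \<in> A\<close>, of y] P(3)[OF that] by simp
    then show ?thesis
      using Hahn_Banach_extension[OF P(1) Y(2), of "blinfun_apply a"]
      by (metis blinfun.add_right blinfun.scaleR_right real_scaleR_def)
  qed
  show False
  proof (cases "- P (- x) \<le> P x - \<alpha>")
    case True
    \<comment> \<open>Lowering \<open>P\<close> at \<open>x\<close> by \<alpha> contradicts
      minimality unless \<open>p \<le> Q\<close> fails at some \<open>y\<close> in \<open>Y\<close>.
      The representation of \<open>Q y\<close> then shows that functionals in a slice of
      \<open>A\<close> at \<open>y\<close> almost attain \<open>P x\<close>.\<close>
    obtain Q where Q: "sublinear Q" "\<And>u. Q u \<le> P u" "Q x \<le> P x - \<alpha>"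
      "\<And>u r. Q u < r \<Longrightarrow> \<exists>t. 0 \<le> t \<and> P (u - t *\<^sub>R x) + t * (P x - \<alpha>) < r"
      by (rule sublinear_inf[OF P(1), of "{(x, P x - \<alpha>)}"]) (use True in auto)
    have "Q \<noteq> P" using Q(3) \<alpha> by auto
    then obtain y where y: "y \<in> Y" "Q y < p y" using P_min[OF Q(1,2)] by (meson not_le)
    then obtain t where t: "0 \<le> t" "P (y - t *\<^sub>R x) + t * (P x - \<alpha>) < p y" using Q(4) by blast
    have "t \<noteq> 0" using t P(3)[OF y(1)] by auto
    then have t0: "t > 0" using t by simp
    define b where "b = p y - (P (y - t *\<^sub>R x) + t * (P x - \<alpha>))"
    have "near a w" if a: "a \<in> A" "p y - b < blinfun_apply a y" for a
    proof -
      obtain L where L: "linear L" "\<And>u. L u \<le> P u" "\<And>y. y \<in> Y \<Longrightarrow> L y = blinfun_apply a y"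
        using ext[OF a(1)] by blast
      have "L y - t * L x \<le> P (y - t *\<^sub>R x)"
        using L(2)[of "y - t *\<^sub>R x"] linear_diff[OF L(1)] linear_scale[OF L(1)] by simp
      moreover have "P (y - t *\<^sub>R x) + t * (P x - \<alpha>) < L y" using a(2) L(3)[OF y(1)] by (simp add: b_def)
      ultimately have "t * (P x - \<alpha>) < t * L x" by linarith
      then have "P x - \<alpha> < L x" using t0 by simp
      then show ?thesis using near_w[OF a(1)] L by blast
    qed
    moreover have "b > 0" using t by (simp add: b_def)
    ultimately show False using no_small_slice[OF y(1)] by blast
  next
    case False
    \<comment> \<open>Here every linear functional below \<open>P\<close> almost attains
      \<open>P x\<close>, so all of \<open>A\<close>, which is a slice in direction 0, is close to
      \<open>w\<close>.\<close>
    have "near a w" if a: "a \<in> A" for a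
    proof -
      obtain L where L: "linear L" "\<And>u. L u \<le> P u" "\<And>y. y \<in> Y \<Longrightarrow> L y = blinfun_apply a y"
        using ext[OF a] by blast
      have "P x - \<alpha> < L x" using L(2)[of "- x"] linear_neg[OF L(1), of x] False by simp
      then show ?thesis using near_w[OF a] L by blast
    qed
    then show False using no_small_slice[of 0 1] Y(2) subspace_0 by (metis zero_less_one)
  qed
qed

lemma asplund_separable_dual_seq:
  fixes D Y :: "'a::real_normed_vector set"
  assumes "asplund TYPE('a)" "countable D" "Y = closure D" "subspace Y"
  obtains \<xi> :: "nat \<Rightarrow> 'a \<Rightarrow>\<^sub>L real" where "\<xi> 0 = 0"
    "\<And>z e. norm z \<le> 1 \<Longrightarrow> 0 < e \<Longrightarrow>
      \<exists>n. \<forall>y\<in>Y. \<bar>blinfun_apply z y - blinfun_apply (\<xi> n) y\<bar> \<le> e * norm y"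
proof -
  have "\<forall>k. \<exists>N. countable N \<and> (\<forall>z::'a \<Rightarrow>\<^sub>L real. norm z \<le> 1 \<longrightarrow>
    (\<exists>w\<in>N. \<forall>y\<in>Y. \<bar>blinfun_apply z y - blinfun_apply w y\<bar> \<le> inverse (real (Suc k)) * norm y))"
    by (intro allI asplund_separable_dual_net[OF assms]) simp
  from choice[OF this] obtain N where N:
    "\<forall>k. countable (N k) \<and> (\<forall>z::'a \<Rightarrow>\<^sub>L real. norm z \<le> 1 \<longrightarrow>
    (\<exists>w\<in>N k. \<forall>y\<in>Y. \<bar>blinfun_apply z y - blinfun_apply w y\<bar> \<le> inverse (real (Suc k)) * norm y))" ..
  define M where "M = (\<Union>k. N k)"
  obtain w0 where "w0 \<in> N 0" using N[rule_format, of 0] by (metis norm_zero zero_le_one)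
  then have M: "countable M" "M \<noteq> {}" unfolding M_def using N by auto
  \<comment> \<open>Putting 0 first makes all finite maxima of the sequence nonnegative.\<close>
  define \<xi> where "\<xi> = case_nat 0 (from_nat_into M)"
  show thesis
  proof (rule that[of \<xi>])
    fix z :: "'a \<Rightarrow>\<^sub>L real" and e :: real assume z: "norm z \<le> 1" and e: "0 < e"
    obtain k where k: "inverse (real (Suc k)) < e" using reals_Archimedean[OF e] by blast
    obtain w where w: "w \<in> N k"
      "\<And>y. y \<in> Y \<Longrightarrow> \<bar>blinfun_apply z y - blinfun_apply w y\<bar> \<le> inverse (real (Suc k)) * norm y"
      using N z by blast
    have "w \<in> M" using w(1) by (auto simp: M_def)
    then obtain n where "from_nat_into M n = w" using M from_nat_into_surj by metis
    then have "\<xi> (Suc n) = w" by (simp add: \<xi>_def)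
    moreover have "inverse (real (Suc k)) * norm y \<le> e * norm y" for y :: 'a
      using k by (intro mult_right_mono) auto
    ultimately show "\<exists>n. \<forall>y\<in>Y. \<bar>blinfun_apply z y - blinfun_apply (\<xi> n) y\<bar> \<le> e * norm y"
      using w(2) by (meson order_trans)
  qed (simp add: \<xi>_def)
qed

section \<open>A smooth substitute for the norm\<close>

text \<open>Rounding the values of finitely many functionals to multiples of \<open>e\<close> leaves
  finitely many patterns on a bounded set; one representative of each pattern suffices.\<close>

lemma finite_net_functionals:
  fixes \<xi> :: "nat \<Rightarrow> 'a::real_normed_vector \<Rightarrow>\<^sub>L real"
  assumes B: "\<And>v. v \<in> B \<Longrightarrow> norm v \<le> 1" and e: "e > 0"
  obtains V where "finite V" "V \<subseteq> B"
    "\<And>v. v \<in> B \<Longrightarrow> \<exists>v'\<in>V. \<forall>i\<le>n. \<bar>blinfun_apply (\<xi> i) (v - v')\<bar> \<le> e"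
proof -
  define c where "c v = (\<lambda>i\<in>{..n}. \<lfloor>blinfun_apply (\<xi> i) v / e\<rfloor>)" for v
  define M where "M i = \<lceil>norm (\<xi> i) / e\<rceil> + 1" for i
  have "c v \<in> (\<Pi>\<^sub>E i\<in>{..n}. {- M i..M i})" if v: "v \<in> B" for v
  proof -
    have "\<lfloor>blinfun_apply (\<xi> i) v / e\<rfloor> \<in> {- M i..M i}" for i
    proof -
      have "\<bar>blinfun_apply (\<xi> i) v\<bar> \<le> norm (\<xi> i) * norm v" using norm_blinfun[of "\<xi> i" v] by simp
      also have "\<dots> \<le> norm (\<xi> i) * 1" using B[OF v] by (intro mult_left_mono) auto
      finally have "\<bar>blinfun_apply (\<xi> i) v / e\<bar> \<le> norm (\<xi> i) / e"
        using e by (simp add: divide_right_mono)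
      then show ?thesis unfolding M_def atLeastAtMost_iff by linarith
    qed
    then show ?thesis by (auto simp: c_def)
  qed
  then have "c ` B \<subseteq> (\<Pi>\<^sub>E i\<in>{..n}. {- M i..M i})" by blast
  moreover have "finite (\<Pi>\<^sub>E i\<in>{..n}. {- M i..M i})" by (intro finite_PiE) auto
  ultimately have fin: "finite (c ` B)" by (rule finite_subset)
  show thesis
  proof (rule that[of "inv_into B c ` c ` B"])
    show "finite (inv_into B c ` c ` B)" using fin by simp
    show "inv_into B c ` c ` B \<subseteq> B" by (auto intro: inv_into_into)
    fix v assume v: "v \<in> B"
    define v' where "v' = inv_into B c (c v)"
    have "c v' = c v" using v by (simp add: v'_def f_inv_into_f)
    have "\<bar>blinfun_apply (\<xi> i) (v - v')\<bar> \<le> e" if "i \<le> n" for i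
    proof -
      have "\<lfloor>blinfun_apply (\<xi> i) v' / e\<rfloor> = \<lfloor>blinfun_apply (\<xi> i) v / e\<rfloor>"
        using fun_cong[OF \<open>c v' = c v\<close>, of i] that by (simp add: c_def)
      then have "\<bar>blinfun_apply (\<xi> i) v / e - blinfun_apply (\<xi> i) v' / e\<bar> \<le> 1" by linarith
      then have "\<bar>(blinfun_apply (\<xi> i) v - blinfun_apply (\<xi> i) v') / e\<bar> \<le> 1"
        by (simp add: diff_divide_distrib)
      then show ?thesis using e by (simp add: blinfun.diff_right)
    qed
    then show "\<exists>v'\<in>inv_into B c ` c ` B. \<forall>i\<le>n. \<bar>blinfun_apply (\<xi> i) (v - v')\<bar> \<le> e"
      using v by (auto simp: v'_def)
  qed
qed

lemma convergent_if_square_bound: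
  fixes a :: "nat \<Rightarrow> real"
  assumes "c > 0" "\<And>j k. c * (a j - a k)\<^sup>2 \<le> \<delta> j + \<delta> k" "\<delta> \<longlonglongrightarrow> 0"
  shows "convergent a"
proof -
  have "Cauchy a"
  proof (rule CauchyI)
    fix e :: real assume e: "e > 0"
    have "c * e\<^sup>2 / 2 > 0" using e assms(1) by simp
    then have "eventually (\<lambda>k. \<delta> k < c * e\<^sup>2 / 2) sequentially"
      by (rule order_tendstoD(2)[OF assms(3)])
    then obtain M where M: "\<And>k. k \<ge> M \<Longrightarrow> \<delta> k < c * e\<^sup>2 / 2" by (auto simp: eventually_sequentially)
    show "\<exists>M. \<forall>m\<ge>M. \<forall>n\<ge>M. norm (a m - a n) < e"
    proof (intro exI[of _ M] allI impI)
      fix m n assume "m \<ge> M" "n \<ge> M"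
      then have "c * (a m - a n)\<^sup>2 < c * e\<^sup>2" using assms(2)[of m n] M[of m] M[of n] by linarith
      then have "(a m - a n)\<^sup>2 < e\<^sup>2" using assms(1) by simp
      then have "\<bar>a m - a n\<bar>\<^sup>2 < e\<^sup>2" by simp
      then show "norm (a m - a n) < e" using e by (simp only: real_norm_def power2_less_imp_less less_imp_le)
    qed
  qed
  then show ?thesis by (simp add: Cauchy_convergent)
qed

lemma tendsto_if_square_bound:
  fixes a :: "nat \<Rightarrow> real"
  assumes "c > 0" "\<And>k. c * (a k - l)\<^sup>2 \<le> \<delta> k" "\<delta> \<longlonglongrightarrow> 0"
  shows "a \<longlonglongrightarrow> l"
proof -
  have "(\<lambda>k. \<delta> k / c) \<longlonglongrightarrow> 0" by (intro tendsto_divide_zero assms)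
  then have "(\<lambda>k. (a k - l)\<^sup>2) \<longlonglongrightarrow> 0"
    by (rule tendsto_sandwich[OF _ _ tendsto_const, rotated 2])
      (use assms in \<open>auto simp: pos_le_divide_eq mult.commute\<close>)
  then have "(\<lambda>k. sqrt ((a k - l)\<^sup>2)) \<longlonglongrightarrow> sqrt 0" by (rule tendsto_real_sqrt)
  then have "(\<lambda>k. \<bar>a k - l\<bar>) \<longlonglongrightarrow> 0" by simp
  then show ?thesis by (rule LIM_zero_cancel[OF tendsto_rabs_zero_cancel])
qed

lemma functionals_converge_on_closure:
  fixes Z :: "nat \<Rightarrow> 'a::real_normed_vector \<Rightarrow>\<^sub>L real"
  assumes Z: "\<And>k. norm (Z k) \<le> 1" and conv: "\<And>y. y \<in> D \<Longrightarrow> convergent (\<lambda>k. blinfun_apply (Z k) y)"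
    and v: "v \<in> closure D"
  shows "convergent (\<lambda>k. blinfun_apply (Z k) v)"
proof -
  have "Cauchy (\<lambda>k. blinfun_apply (Z k) v)"
  proof (rule CauchyI)
    fix e :: real assume e: "e > 0"
    then obtain y where y: "y \<in> D" "norm (v - y) < e / 3"
      using v unfolding closure_approachable dist_norm
      by (metis divide_pos_pos norm_minus_commute zero_less_numeral)
    have "Cauchy (\<lambda>k. blinfun_apply (Z k) y)" using conv[OF y(1)] by (simp add: convergent_Cauchy)
    then obtain M where M: "\<And>m n. m \<ge> M \<Longrightarrow> n \<ge> M \<Longrightarrow>
        \<bar>blinfun_apply (Z m) y - blinfun_apply (Z n) y\<bar> < e / 3"
      using CauchyD[of _ "e / 3"] e by (metis divide_pos_pos real_norm_def zero_less_numeral)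
    have near: "\<bar>blinfun_apply (Z k) v - blinfun_apply (Z k) y\<bar> < e / 3" for k
      using abs_blinfun_le[OF Z, of k "v - y"] y by (simp add: blinfun.diff_right)
    have "\<bar>blinfun_apply (Z m) v - blinfun_apply (Z n) v\<bar> < e" if "m \<ge> M" "n \<ge> M" for m n
      using M[OF that] near[of m] near[of n] by linarith
    then show "\<exists>M. \<forall>m\<ge>M. \<forall>n\<ge>M. norm (blinfun_apply (Z m) v - blinfun_apply (Z n) v) < e"
      by (auto simp: real_norm_def)
  qed
  then show ?thesis by (simp add: Cauchy_convergent)
qed

lemma functionals_tendsto_on_closure:
  fixes Z :: "nat \<Rightarrow> 'a::real_normed_vector \<Rightarrow>\<^sub>L real"
  assumes Z: "\<And>k. norm (Z k) \<le> 1" and z: "norm z \<le> 1"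
    and lim: "\<And>y. y \<in> D \<Longrightarrow> (\<lambda>k. blinfun_apply (Z k) y) \<longlonglongrightarrow> blinfun_apply z y"
    and v: "v \<in> closure D"
  shows "(\<lambda>k. blinfun_apply (Z k) v) \<longlonglongrightarrow> blinfun_apply z v"
proof (rule LIMSEQ_I)
  fix e :: real assume e: "e > 0"
  then obtain y where y: "y \<in> D" "norm (v - y) < e / 3"
    using v unfolding closure_approachable dist_norm
    by (metis divide_pos_pos norm_minus_commute zero_less_numeral)
  obtain M where M: "\<And>n. n \<ge> M \<Longrightarrow> \<bar>blinfun_apply (Z n) y - blinfun_apply z y\<bar> < e / 3"
    using LIMSEQ_D[OF lim[OF y(1)], of "e / 3"] e by auto
  have near: "\<bar>blinfun_apply w v - blinfun_apply w y\<bar> < e / 3" if "norm w \<le> 1" for w :: "'a \<Rightarrow>\<^sub>L real"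
    using abs_blinfun_le[OF that, of "v - y"] y by (simp add: blinfun.diff_right)
  have "\<bar>blinfun_apply (Z n) v - blinfun_apply z v\<bar> < e" if "n \<ge> M" for n
    using M[OF that] near[OF Z[of n]] near[OF z] by linarith
  then show "\<exists>M. \<forall>n\<ge>M. norm (blinfun_apply (Z n) v - blinfun_apply z v) < e"
    by (auto simp: real_norm_def)
qed

text \<open>The sequence \<xi> is dense in the dual ball only with respect to the norm of
  restrictions to \<open>Y\<close>, which is how the separable dual of \<open>Y\<close> is expressed
  without a type for \<open>Y\<close>. The weight \<kappa> says how far the smoothed norm may
  deviate from the norm.\<close>

locale separable_dual =
  fixes D Y :: "'a::real_normed_vector set" and \<xi> :: "nat \<Rightarrow> 'a \<Rightarrow>\<^sub>L real" and \<kappa> :: real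
  assumes D: "countable D" "D \<noteq> {}" and Y: "Y = closure D" "subspace Y"
    and xi0: "\<xi> 0 = 0"
    and dense: "\<And>z e. norm z \<le> 1 \<Longrightarrow> 0 < e \<Longrightarrow>
      \<exists>n. \<forall>y\<in>Y. \<bar>blinfun_apply z y - blinfun_apply (\<xi> n) y\<bar> \<le> e * norm y"
    and kappa: "\<kappa> > 0"
begin

definition ball_Y :: "'a set" where "ball_Y = {y \<in> Y. norm y \<le> 1}"

text \<open>The support function of the convex hull of \<open>\<xi> 0, ..., \<xi> n\<close>.\<close>

definition sup_\<xi> :: "nat \<Rightarrow> 'a \<Rightarrow> real" where
  "sup_\<xi> n y = Max ((\<lambda>i. blinfun_apply (\<xi> i) y) ` {..n})"

definition dev :: "nat \<Rightarrow> ('a \<Rightarrow>\<^sub>L real) \<Rightarrow> real" where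
  "dev n z = (SUP y\<in>ball_Y. blinfun_apply z y - sup_\<xi> n y)"

definition pt :: "nat \<Rightarrow> 'a" where "pt = from_nat_into D"

text \<open>The denominator makes the evaluations at the possibly unbounded points of
  \<open>D\<close> uniformly bounded by \<open>norm z\<close>.\<close>

definition ev :: "nat \<Rightarrow> ('a \<Rightarrow>\<^sub>L real) \<Rightarrow> real" where
  "ev n z = blinfun_apply z (pt n) / (1 + norm (pt n))"

definition pen_term :: "nat \<Rightarrow> ('a \<Rightarrow>\<^sub>L real) \<Rightarrow> real" where
  "pen_term n z = (1/2) ^ n * ((dev n z)\<^sup>2 + (ev n z)\<^sup>2)"

definition pen :: "('a \<Rightarrow>\<^sub>L real) \<Rightarrow> real" where "pen z = (\<Sum>n. pen_term n z)"

text \<open>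
  The penalty \<open>pen\<close> plays the role of a locally uniformly rotund dual norm: \<open>ev\<close> forces near maximizers in
  \<open>sm\<close> to converge pointwise on \<open>Y\<close>, and \<open>dev\<close>, the distance to the convex hull of \<open>\<xi> 0, \<dots>, \<xi> n\<close>
  written in its dual form so that it is weak* lower semicontinuous, upgrades this to norm convergence.
\<close>

definition sm :: "'a \<Rightarrow> real" where
  "sm y = (SUP z\<in>{z. norm z \<le> 1}. blinfun_apply z y - \<kappa> * pen z)"

lemma zero_ball_Y: "0 \<in> ball_Y" using Y(2) by (simp add: ball_Y_def subspace_0)

lemma sup_\<xi>_nonneg: "0 \<le> sup_\<xi> n y"
  unfolding sup_\<xi>_def using xi0 by (intro Max_ge) (auto intro!: image_eqI[of _ _ 0])

lemma sup_\<xi>_ge: "i \<le> n \<Longrightarrow> blinfun_apply (\<xi> i) y \<le> sup_\<xi> n y"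
  unfolding sup_\<xi>_def by (intro Max_ge) auto

lemma sup_\<xi>_le: "(\<And>i. i \<le> n \<Longrightarrow> blinfun_apply (\<xi> i) y \<le> b) \<Longrightarrow> sup_\<xi> n y \<le> b"
  unfolding sup_\<xi>_def by (subst Max_le_iff) auto

lemma dev_term_le_norm: "y \<in> ball_Y \<Longrightarrow> blinfun_apply z y - sup_\<xi> n y \<le> norm z"
proof -
  assume y: "y \<in> ball_Y"
  have "blinfun_apply z y \<le> norm z * norm y" using norm_blinfun[of z y] by simp
  also have "\<dots> \<le> norm z * 1" using y by (intro mult_left_mono) (auto simp: ball_Y_def)
  finally show ?thesis using sup_\<xi>_nonneg[of n y] by simp
qed

lemma dev_upper: "y \<in> ball_Y \<Longrightarrow> blinfun_apply z y - sup_\<xi> n y \<le> dev n z"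
  unfolding dev_def by (rule cSUP_upper) (auto intro!: bdd_aboveI dev_term_le_norm)

lemma dev_least: "(\<And>y. y \<in> ball_Y \<Longrightarrow> blinfun_apply z y - sup_\<xi> n y \<le> b) \<Longrightarrow> dev n z \<le> b"
  unfolding dev_def using zero_ball_Y by (intro cSUP_least) auto

lemma dev_le_norm: "dev n z \<le> norm z"
  by (rule dev_least) (rule dev_term_le_norm)

lemma dev_nonneg: "0 \<le> dev n z"
  using dev_upper[OF zero_ball_Y, of z n] sup_\<xi>_le[of n 0 0] by (simp add: blinfun.zero_right)

lemma dev_midpoint: "dev n ((1/2) *\<^sub>R (z + w)) \<le> (dev n z + dev n w) / 2"
proof (rule dev_least)
  fix y assume "y \<in> ball_Y"
  from dev_upper[OF this, of z n] dev_upper[OF this, of w n]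
  show "blinfun_apply ((1/2) *\<^sub>R (z + w)) y - sup_\<xi> n y \<le> (dev n z + dev n w) / 2"
    by (simp add: blinfun.scaleR_left blinfun.add_left field_simps)
qed

lemma ev_midpoint: "ev n ((1/2) *\<^sub>R (z + w)) = (ev n z + ev n w) / 2"
  by (simp add: ev_def blinfun.scaleR_left blinfun.add_left add_divide_distrib algebra_simps)

lemma abs_ev_le: "\<bar>ev n z\<bar> \<le> norm z"
proof -
  have "\<bar>blinfun_apply z (pt n)\<bar> \<le> norm z * norm (pt n)" using norm_blinfun[of z "pt n"] by simp
  also have "\<dots> \<le> norm z * (1 + norm (pt n))" by (intro mult_left_mono) auto
  finally show ?thesis
    by (simp add: ev_def pos_divide_le_eq add_pos_nonneg)
qed

lemma pen_term_nonneg: "0 \<le> pen_term n z" by (simp add: pen_term_def)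

lemma pen_term_le: "pen_term n z \<le> (1/2) ^ n * (2 * (norm z)\<^sup>2)"
proof -
  have "(dev n z)\<^sup>2 \<le> (norm z)\<^sup>2" using dev_nonneg dev_le_norm by (intro power_mono)
  moreover have "(ev n z)\<^sup>2 \<le> (norm z)\<^sup>2" using abs_ev_le[of n z] by (simp add: abs_le_square_iff[symmetric])
  ultimately show ?thesis unfolding pen_term_def by (intro mult_left_mono) auto
qed

lemma summable_pen_bound: "summable (\<lambda>n. (1/2 :: real) ^ n * b)"
  by (intro summable_mult2 summable_geometric) simp

lemma summable_pen: "summable (\<lambda>n. pen_term n z)"
  by (rule summable_comparison_test'[OF summable_pen_bound[of "2 * (norm z)\<^sup>2"], of 0])
    (use pen_term_nonneg pen_term_le in auto)

lemma pen_nonneg: "0 \<le> pen z"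
  unfolding pen_def by (rule suminf_nonneg[OF summable_pen pen_term_nonneg])

lemma pen_le: "pen z \<le> 4 * (norm z)\<^sup>2"
proof -
  have "pen z \<le> (\<Sum>n. (1/2) ^ n * (2 * (norm z)\<^sup>2))"
    unfolding pen_def by (rule suminf_le[OF pen_term_le summable_pen summable_pen_bound])
  also have "\<dots> = (\<Sum>n. (1/2) ^ n) * (2 * (norm z)\<^sup>2)"
    by (rule suminf_mult2[symmetric]) (simp add: summable_geometric)
  also have "\<dots> = 4 * (norm z)\<^sup>2" by (simp add: suminf_geometric)
  finally show ?thesis .
qed

text \<open>The parallelogram identity applied termwise: \<open>dev\<close> is convex and
  nonnegative, \<open>ev\<close> is linear, so every term of the midpoint gap is nonnegative and a
  single one can be isolated.\<close>

lemma pen_gap: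
  "(1/2) ^ n * ((dev n z - dev n w)\<^sup>2 + (ev n z - ev n w)\<^sup>2) / 4
    \<le> (pen z + pen w) / 2 - pen ((1/2) *\<^sub>R (z + w))"
proof -
  define m where "m = (1/2) *\<^sub>R (z + w)"
  define h where "h k = (pen_term k z + pen_term k w) / 2 - pen_term k m" for k
  define g where "g k = (1/2) ^ k * ((dev k z - dev k w)\<^sup>2 + (ev k z - ev k w)\<^sup>2) / 4" for k
  have h_ge: "g k \<le> h k" for k
  proof -
    have "(dev k m)\<^sup>2 \<le> ((dev k z + dev k w) / 2)\<^sup>2"
      unfolding m_def using dev_midpoint dev_nonneg by (intro power_mono)
    then have "(dev k z - dev k w)\<^sup>2 / 4 \<le> ((dev k z)\<^sup>2 + (dev k w)\<^sup>2) / 2 - (dev k m)\<^sup>2"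
      by (simp add: power2_eq_square field_simps)
    moreover have "(ev k z - ev k w)\<^sup>2 / 4 = ((ev k z)\<^sup>2 + (ev k w)\<^sup>2) / 2 - (ev k m)\<^sup>2"
      unfolding m_def ev_midpoint by (simp add: power2_eq_square field_simps)
    moreover have "(A + B) / 4 \<le> (a + c + (b + d)) / 2 - (p + q)"
      if "A / 4 \<le> (a + b) / 2 - p" "B / 4 = (c + d) / 2 - q" for A B a b c d p q :: real
      using that by (simp add: field_simps)
    ultimately have "((dev k z - dev k w)\<^sup>2 + (ev k z - ev k w)\<^sup>2) / 4
      \<le> ((dev k z)\<^sup>2 + (ev k z)\<^sup>2 + ((dev k w)\<^sup>2 + (ev k w)\<^sup>2)) / 2 - ((dev k m)\<^sup>2 + (ev k m)\<^sup>2)"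
      by blast
    then have "(1/2) ^ k * (((dev k z - dev k w)\<^sup>2 + (ev k z - ev k w)\<^sup>2) / 4)
      \<le> (1/2) ^ k * (((dev k z)\<^sup>2 + (ev k z)\<^sup>2 + ((dev k w)\<^sup>2 + (ev k w)\<^sup>2)) / 2 - ((dev k m)\<^sup>2 + (ev k m)\<^sup>2))"
      by (intro mult_left_mono) auto
    then show ?thesis unfolding g_def h_def pen_term_def by (simp add: algebra_simps)
  qed
  have g_nonneg: "0 \<le> g k" for k by (simp add: g_def)
  have h_sums: "h sums ((pen z + pen w) / 2 - pen m)"
    unfolding h_def pen_def by (intro sums_diff sums_divide sums_add summable_sums summable_pen)
  have "sum h {n} \<le> suminf h"
    using h_ge g_nonneg by (intro sum_le_suminf sums_summable[OF h_sums]) (auto intro: order_trans)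
  then show ?thesis using h_ge[of n] sums_unique[OF h_sums] by (simp add: g_def m_def)
qed

section \<open>The smoothed norm: comparison with the norm and coercivity\<close>

lemma sm_bdd: "bdd_above ((\<lambda>z. blinfun_apply z y - \<kappa> * pen z) ` {z. norm z \<le> 1})"
proof (rule bdd_aboveI2)
  fix z :: "'a \<Rightarrow>\<^sub>L real" assume "z \<in> {z. norm z \<le> 1}"
  then show "blinfun_apply z y - \<kappa> * pen z \<le> norm y"
    using abs_blinfun_le[of z y] mult_nonneg_nonneg[OF less_imp_le[OF kappa] pen_nonneg, of z] by simp
qed

lemma sm_upper: "norm z \<le> 1 \<Longrightarrow> blinfun_apply z y - \<kappa> * pen z \<le> sm y"
  unfolding sm_def by (rule cSUP_upper[OF _ sm_bdd]) simp

lemma sm_less: "r < sm y \<Longrightarrow> \<exists>z. norm z \<le> 1 \<and> r < blinfun_apply z y - \<kappa> * pen z"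
proof -
  have "{z :: 'a \<Rightarrow>\<^sub>L real. norm z \<le> 1} \<noteq> {}" by (auto intro!: exI[of _ 0])
  then show "r < sm y \<Longrightarrow> ?thesis" unfolding sm_def using less_cSUP_iff[OF _ sm_bdd] by auto
qed

lemma sm_zero: "sm 0 = 0"
proof (rule antisym)
  show "sm 0 \<le> 0"
  proof (rule ccontr)
    assume "\<not> sm 0 \<le> 0"
    then obtain z where "0 < blinfun_apply z 0 - \<kappa> * pen z" using sm_less[of 0 0] by auto
    then show False using kappa pen_nonneg[of z] by (simp add: blinfun.zero_right mult_less_0_iff)
  qed
  show "0 \<le> sm 0" using sm_upper[of 0 0] pen_le[of 0] pen_nonneg[of 0] by simp
qed

lemma sm_nonneg: "0 \<le> sm y"
  using sm_upper[of 0 y] pen_le[of 0] pen_nonneg[of 0] by simp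

lemma sm_lipschitz: "\<bar>sm u - sm v\<bar> \<le> norm (u - v)"
proof -
  have "sm u \<le> sm v + norm (u - v)" for u v
  proof (rule ccontr)
    assume "\<not> ?thesis"
    then obtain z where z: "norm z \<le> 1" "sm v + norm (u - v) < blinfun_apply z u - \<kappa> * pen z"
      using sm_less by (meson not_le)
    then show False using sm_upper[OF z(1), of v] abs_blinfun_le[OF z(1), of "u - v"]
      by (simp add: blinfun.diff_right)
  qed
  from this[of u v] this[of v u] show ?thesis by (simp add: norm_minus_commute abs_le_iff)
qed

text \<open>Testing with \<open>t\<close> times a norming functional gains linearly in
  \<open>t\<close> and loses only quadratically. Small \<open>t\<close> gives coercivity for
  arbitrarily short vectors, \<open>t = 1\<close> the comparison with the norm.\<close>

lemma sm_ge: "0 \<le> t \<Longrightarrow> t \<le> 1 \<Longrightarrow> t * norm y - 4 * \<kappa> * t\<^sup>2 \<le> sm y"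
proof -
  assume t: "0 \<le> t" "t \<le> 1"
  obtain z :: "'a \<Rightarrow>\<^sub>L real" where z: "norm z \<le> 1" "blinfun_apply z y = norm y"
    by (rule norming_functional)
  have tz: "norm (t *\<^sub>R z) \<le> t" using t z(1) by (simp add: mult_left_le)
  have "pen (t *\<^sub>R z) \<le> 4 * (norm (t *\<^sub>R z))\<^sup>2" by (rule pen_le)
  also have "\<dots> \<le> 4 * t\<^sup>2" using tz by (intro mult_left_mono power_mono) auto
  finally have "\<kappa> * pen (t *\<^sub>R z) \<le> \<kappa> * (4 * t\<^sup>2)" using kappa by (intro mult_left_mono) auto
  moreover have "norm (t *\<^sub>R z) \<le> 1" using tz t(2) by linarith
  ultimately show ?thesis using sm_upper[of "t *\<^sub>R z" y] z(2) by (simp add: blinfun.scaleR_left)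
qed

lemma sm_ge_norm: "norm y - 4 * \<kappa> \<le> sm y"
  using sm_ge[of 1 y] by simp

lemma sm_coercive: "0 < r \<Longrightarrow> \<exists>b>0. \<forall>u. r \<le> norm u \<longrightarrow> b \<le> sm u"
proof -
  assume r: "0 < r"
  \<comment> \<open>With this \<open>t\<close> the penalty is at most half of the linear gain
    \<open>t * r\<close>.\<close>
  define t where "t = min 1 (r / (8 * \<kappa>))"
  have t: "0 < t" "t \<le> 1" using r kappa by (auto simp: t_def)
  have "t * \<kappa> * 8 \<le> r" using kappa by (simp add: t_def min_def field_simps)
  then have "4 * \<kappa> * t\<^sup>2 \<le> t * r / 2" using t
    by (simp add: power2_eq_square) (metis mult.assoc mult.commute mult_le_cancel_right_pos)
  then have "t * r / 2 \<le> sm u" if "r \<le> norm u" for u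
  proof -
    have "t * r \<le> t * norm u" using t that by (intro mult_left_mono) auto
    then show ?thesis using \<open>4 * \<kappa> * t\<^sup>2 \<le> t * r / 2\<close> sm_ge[of t u] t by linarith
  qed
  then show ?thesis using t r by (intro exI[of _ "t * r / 2"]) auto
qed

text \<open>The midpoint of two near-maximizers is again admissible, so the convexity gap of the
  penalty is at most the average of the two deficits.\<close>

lemma near_maximizers_close:
  assumes "norm z \<le> 1" "sm y - a \<le> blinfun_apply z y - \<kappa> * pen z"
    and "norm w \<le> 1" "sm y - b \<le> blinfun_apply w y - \<kappa> * pen w"
  shows "\<kappa> * ((1/2) ^ n / 2) * (dev n z - dev n w)\<^sup>2 \<le> a + b"
    and "\<kappa> * ((1/2) ^ n / 2) * (ev n z - ev n w)\<^sup>2 \<le> a + b"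
proof -
  define m where "m = (1/2) *\<^sub>R (z + w)"
  have "norm m \<le> 1" unfolding m_def using norm_triangle_ineq[of z w] assms by simp
  then have "blinfun_apply m y - \<kappa> * pen m \<le> sm y" by (rule sm_upper)
  moreover have "blinfun_apply m y = (blinfun_apply z y + blinfun_apply w y) / 2"
    by (simp add: m_def blinfun.scaleR_left blinfun.add_left)
  ultimately have "\<kappa> * ((pen z + pen w) / 2 - pen m) \<le> (a + b) / 2"
    using assms by (simp add: algebra_simps)
  moreover have "\<kappa> * ((1/2) ^ n * ((dev n z - dev n w)\<^sup>2 + (ev n z - ev n w)\<^sup>2) / 4)
      \<le> \<kappa> * ((pen z + pen w) / 2 - pen m)"
    unfolding m_def using kappa by (intro mult_left_mono pen_gap) auto
  ultimately have "\<kappa> * ((1/2) ^ n * ((dev n z - dev n w)\<^sup>2 + (ev n z - ev n w)\<^sup>2) / 4) \<le> (a + b) / 2"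
    by linarith
  moreover have "\<kappa> * (r * (A + B) / 4) \<le> (a + b) / 2 \<Longrightarrow> \<kappa> * (r / 2) * A + \<kappa> * (r / 2) * B \<le> a + b"
    for r A B :: real
    by (simp add: field_simps)
  ultimately have *: "\<kappa> * ((1/2) ^ n / 2) * (dev n z - dev n w)\<^sup>2
      + \<kappa> * ((1/2) ^ n / 2) * (ev n z - ev n w)\<^sup>2 \<le> a + b"
    by blast
  have "0 \<le> \<kappa> * ((1/2) ^ n / 2) * c\<^sup>2" for c :: real using kappa by simp
  from this[of "dev n z - dev n w"] this[of "ev n z - ev n w"] *
  show "\<kappa> * ((1/2) ^ n / 2) * (dev n z - dev n w)\<^sup>2 \<le> a + b"
    "\<kappa> * ((1/2) ^ n / 2) * (ev n z - ev n w)\<^sup>2 \<le> a + b" by linarith+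
qed

lemma D_pt: "y \<in> D \<Longrightarrow> \<exists>n. y = pt n"
  unfolding pt_def using D from_nat_into_surj by metis

lemma apply_pt: "blinfun_apply z (pt n) = (1 + norm (pt n)) * ev n z"
  by (simp add: ev_def add_pos_nonneg less_imp_neq[symmetric])

text \<open>Stands in for weak* compactness: the evaluations of a maximizing sequence are Cauchy on
  \<open>D\<close>, hence converge on \<open>Y\<close>, and the limit extends by
  Hahn-Banach.\<close>

lemma sm_attained:
  assumes y: "y \<in> Y"
  obtains z where "norm z \<le> 1" "sm y \<le> blinfun_apply z y - \<kappa> * pen z"
proof -
  define \<delta> where "\<delta> k = inverse (real (Suc k))" for k
  have \<delta>: "\<delta> \<longlonglongrightarrow> 0" unfolding \<delta>_def by (rule LIMSEQ_inverse_real_of_nat)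
  have "\<forall>k. \<exists>z. norm z \<le> 1 \<and> sm y - \<delta> k < blinfun_apply z y - \<kappa> * pen z"
    by (intro allI sm_less) (simp add: \<delta>_def)
  then obtain Z where "\<forall>k. norm (Z k) \<le> 1 \<and> sm y - \<delta> k < blinfun_apply (Z k) y - \<kappa> * pen (Z k)"
    unfolding choice_iff ..
  then have Z: "\<And>k. norm (Z k) \<le> 1" "\<And>k. sm y - \<delta> k \<le> blinfun_apply (Z k) y - \<kappa> * pen (Z k)"
    by (auto simp: less_imp_le)
  have c: "\<kappa> * ((1/2) ^ n / 2) > 0" for n using kappa by simp
  have dev_conv: "convergent (\<lambda>k. dev n (Z k))" for n
    by (rule convergent_if_square_bound[OF c near_maximizers_close(1) \<delta>]) (use Z in auto)
  have ev_conv: "convergent (\<lambda>k. ev n (Z k))" for n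
    by (rule convergent_if_square_bound[OF c near_maximizers_close(2) \<delta>]) (use Z in auto)
  have conv: "convergent (\<lambda>k. blinfun_apply (Z k) v)" if "v \<in> Y" for v
  proof (rule functionals_converge_on_closure)
    show "v \<in> closure D" using that Y by simp
    fix u assume "u \<in> D"
    then obtain n where "u = pt n" using D_pt by blast
    then show "convergent (\<lambda>k. blinfun_apply (Z k) u)"
      using ev_conv[of n] by (auto simp: apply_pt intro!: convergent_mult convergent_const)
  qed (rule Z)
  define \<zeta> where "\<zeta> v = lim (\<lambda>k. blinfun_apply (Z k) v)" for v
  have \<zeta>: "(\<lambda>k. blinfun_apply (Z k) v) \<longlonglongrightarrow> \<zeta> v" if "v \<in> Y" for v
    using conv[OF that] by (simp add: \<zeta>_def convergent_LIMSEQ_iff)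
  have "\<exists>L. linear L \<and> (\<forall>u. L u \<le> 1 * norm u) \<and> (\<forall>v\<in>Y. L v = \<zeta> v)"
  proof -
    have "\<zeta> (u + v) = \<zeta> u + \<zeta> v" if "u \<in> Y" "v \<in> Y" for u v
      using tendsto_add[OF \<zeta>[OF that(1)] \<zeta>[OF that(2)]] \<zeta>[OF subspace_add[OF Y(2) that]]
      by (intro LIMSEQ_unique) (auto simp: blinfun.add_right)
    moreover have "\<zeta> (t *\<^sub>R u) = t * \<zeta> u" if "u \<in> Y" for t u
      using tendsto_mult_left[OF \<zeta>[OF that], of t] \<zeta>[OF subspace_scale[OF Y(2) that, of t]]
      by (intro LIMSEQ_unique) (auto simp: blinfun.scaleR_right)
    moreover have "\<zeta> v \<le> 1 * norm v" if "v \<in> Y" for v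
      using abs_blinfun_le[OF Z(1), of _ v] by (intro LIMSEQ_le_const2[OF \<zeta>[OF that]]) (auto simp: abs_le_iff)
    ultimately show ?thesis
      using Hahn_Banach_extension[OF sublinear_norm[of 1] Y(2), of \<zeta>] by (metis zero_le_one)
  qed
  then obtain L where L: "linear L" "\<And>u. L u \<le> 1 * norm u" "\<And>v. v \<in> Y \<Longrightarrow> L v = \<zeta> v" by blast
  obtain z :: "'a \<Rightarrow>\<^sub>L real" where z: "norm z \<le> 1" "\<And>u. blinfun_apply z u = L u"
    using blinfun_of_linear_le[OF L(1) _ L(2)] by auto
  have zlim: "(\<lambda>k. blinfun_apply (Z k) v) \<longlonglongrightarrow> blinfun_apply z v" if "v \<in> Y" for v
    using \<zeta>[OF that] L(3)[OF that] z(2) by simp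
  have pt_Y: "pt n \<in> Y" for n
    using from_nat_into[OF D(2), of n] closure_subset[of D] by (auto simp: pt_def Y(1))
  have ev_lim: "(\<lambda>k. ev n (Z k)) \<longlonglongrightarrow> ev n z" for n
    unfolding ev_def
  proof (rule tendsto_divide[OF zlim[OF pt_Y] tendsto_const])
    show "1 + norm (pt n) \<noteq> 0" using norm_ge_zero[of "pt n"] by linarith
  qed
  have part: "(\<Sum>n<N. pen_term n z) \<le> (blinfun_apply z y - sm y) / \<kappa>" for N
  proof -
    define l where "l n = lim (\<lambda>k. dev n (Z k))" for n
    have l: "(\<lambda>k. dev n (Z k)) \<longlonglongrightarrow> l n" for n
      using dev_conv[of n] by (simp add: l_def convergent_LIMSEQ_iff)
    \<comment> \<open>As a supremum of pointwise expressions, \<open>dev\<close> can only drop in a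
      pointwise limit; this is the purpose of its dual form.\<close>
    have dev_l: "dev n z \<le> l n" for n
    proof (rule dev_least)
      fix v assume v: "v \<in> ball_Y"
      then have "v \<in> Y" by (simp add: ball_Y_def)
      show "blinfun_apply z v - sup_\<xi> n v \<le> l n"
        by (rule LIMSEQ_le[OF tendsto_diff[OF zlim[OF \<open>v \<in> Y\<close>] tendsto_const] l])
          (use dev_upper[OF v] in auto)
    qed
    have "(\<Sum>n<N. pen_term n z) \<le> (\<Sum>n<N. (1/2) ^ n * ((l n)\<^sup>2 + (ev n z)\<^sup>2))"
      unfolding pen_term_def using dev_l dev_nonneg by (intro sum_mono mult_left_mono add_right_mono power_mono) auto
    also have "\<dots> \<le> (blinfun_apply z y - sm y + 0) / \<kappa>"
    proof (rule LIMSEQ_le)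
      show "(\<lambda>k. \<Sum>n<N. (1/2) ^ n * ((dev n (Z k))\<^sup>2 + (ev n (Z k))\<^sup>2)) \<longlonglongrightarrow>
          (\<Sum>n<N. (1/2) ^ n * ((l n)\<^sup>2 + (ev n z)\<^sup>2))"
        by (intro tendsto_sum tendsto_mult tendsto_add tendsto_power tendsto_const l ev_lim)
      show "(\<lambda>k. (blinfun_apply (Z k) y - sm y + \<delta> k) / \<kappa>) \<longlonglongrightarrow> (blinfun_apply z y - sm y + 0) / \<kappa>"
        using kappa by (intro tendsto_intros zlim y \<delta>) auto
      have "(\<Sum>n<N. pen_term n (Z k)) \<le> (blinfun_apply (Z k) y - sm y + \<delta> k) / \<kappa>" for k
      proof -
        have "(\<Sum>n<N. pen_term n (Z k)) \<le> pen (Z k)"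
          unfolding pen_def by (intro sum_le_suminf summable_pen) (auto simp: pen_term_nonneg)
        moreover have "pen (Z k) * \<kappa> \<le> blinfun_apply (Z k) y - sm y + \<delta> k"
          using Z(2)[of k] by (simp add: mult.commute)
        ultimately show ?thesis using kappa by (simp add: pos_le_divide_eq) (meson mult_right_mono order_trans less_imp_le)
      qed
      then show "\<exists>M. \<forall>k\<ge>M. (\<Sum>n<N. (1/2) ^ n * ((dev n (Z k))\<^sup>2 + (ev n (Z k))\<^sup>2))
          \<le> (blinfun_apply (Z k) y - sm y + \<delta> k) / \<kappa>"
        by (auto simp: pen_term_def)
    qed
    finally show ?thesis by simp
  qed
  have "pen z \<le> (blinfun_apply z y - sm y) / \<kappa>"
    unfolding pen_def by (rule suminf_le_const[OF summable_pen part])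
  then have "sm y \<le> blinfun_apply z y - \<kappa> * pen z" using kappa by (simp add: pos_le_divide_eq mult.commute)
  then show thesis using that z by blast
qed

text \<open>A Kadec-type argument. The limit is close to some \<open>\<xi> n\<close>, so
  \<open>dev n\<close> is small there and, by convergence, along the sequence. All these functionals
  then nearly lie in the hull of finitely many \<open>\<xi> i\<close>, where a finite net controls
  the whole ball.\<close>

lemma near_maximizers_converge:
  assumes z: "norm z \<le> 1" "sm y \<le> blinfun_apply z y - \<kappa> * pen z"
    and Z: "\<And>k. norm (Z k) \<le> 1" "\<And>k. sm y - \<delta> k \<le> blinfun_apply (Z k) y - \<kappa> * pen (Z k)"
    and \<delta>: "\<delta> \<longlonglongrightarrow> 0" and e: "e > 0"
  shows "\<forall>\<^sub>F k in sequentially. \<forall>v\<in>ball_Y. \<bar>blinfun_apply (Z k) v - blinfun_apply z v\<bar> \<le> e"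
proof -
  \<comment> \<open>The final estimate adds \<open>5 * d\<close> for each of the two oscillations
    and \<open>d\<close> for the difference on the finite net.\<close>
  define d where "d = e / 11"
  have d: "d > 0" using e by (simp add: d_def)
  have c: "\<kappa> * ((1/2) ^ n / 2) > 0" for n using kappa by simp
  have bound: "\<kappa> * ((1/2) ^ n / 2) * (dev n (Z k) - dev n z)\<^sup>2 \<le> \<delta> k"
    "\<kappa> * ((1/2) ^ n / 2) * (ev n (Z k) - ev n z)\<^sup>2 \<le> \<delta> k" for n k
    using near_maximizers_close[OF Z(1)[of k] Z(2)[of k] z(1), where b = 0 and n = n] z(2) by auto
  have dev_lim: "(\<lambda>k. dev n (Z k)) \<longlonglongrightarrow> dev n z" for n
    by (rule tendsto_if_square_bound[OF c bound(1) \<delta>])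
  have ev_lim: "(\<lambda>k. ev n (Z k)) \<longlonglongrightarrow> ev n z" for n
    by (rule tendsto_if_square_bound[OF c bound(2) \<delta>])
  have lim: "(\<lambda>k. blinfun_apply (Z k) v) \<longlonglongrightarrow> blinfun_apply z v" if "v \<in> Y" for v
  proof (rule functionals_tendsto_on_closure[OF Z(1) z(1)])
    show "v \<in> closure D" using that Y by simp
    fix u assume "u \<in> D"
    then obtain n where "u = pt n" using D_pt by blast
    then show "(\<lambda>k. blinfun_apply (Z k) u) \<longlonglongrightarrow> blinfun_apply z u"
      using ev_lim[of n] by (auto simp: apply_pt intro!: tendsto_intros)
  qed
  obtain n where n: "\<And>y. y \<in> Y \<Longrightarrow> \<bar>blinfun_apply z y - blinfun_apply (\<xi> n) y\<bar> \<le> d * norm y"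
    using dense[OF z(1) d] by blast
  have dev_z: "dev n z \<le> d"
  proof (rule dev_least)
    fix v assume v: "v \<in> ball_Y"
    have "d * norm v \<le> d * 1" using v d by (intro mult_left_mono) (auto simp: ball_Y_def)
    then show "blinfun_apply z v - sup_\<xi> n v \<le> d"
      using n[of v] sup_\<xi>_ge[of n n v] v by (simp add: ball_Y_def abs_le_iff)
  qed
  obtain V where V: "finite V" "V \<subseteq> ball_Y"
    "\<And>v. v \<in> ball_Y \<Longrightarrow> \<exists>v'\<in>V. \<forall>i\<le>n. \<bar>blinfun_apply (\<xi> i) (v - v')\<bar> \<le> d"
    by (rule finite_net_functionals[of ball_Y d n \<xi>]) (use d in \<open>auto simp: ball_Y_def\<close>)
  \<comment> \<open>The difference of two points of the ball has norm at most 2. Half of it costs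
    \<open>2 * d\<close> for the deviation and \<open>d / 2\<close> for the support function, whence
    \<open>5 * d\<close>.\<close>
  have osc: "\<bar>blinfun_apply w (v - v')\<bar> \<le> 5 * d"
    if w: "dev n w \<le> 2 * d" and v: "v \<in> ball_Y" "v' \<in> ball_Y"
      and close: "\<And>i. i \<le> n \<Longrightarrow> \<bar>blinfun_apply (\<xi> i) (v - v')\<bar> \<le> d" for w v v'
  proof -
    have one: "blinfun_apply w u \<le> 5 * d"
      if u: "u \<in> Y" "norm u \<le> 2" "\<And>i. i \<le> n \<Longrightarrow> \<bar>blinfun_apply (\<xi> i) u\<bar> \<le> d" for u
    proof -
      have "(1/2) *\<^sub>R u \<in> ball_Y" using u(1,2) Y(2) by (simp add: ball_Y_def subspace_scale)
      then have "blinfun_apply w ((1/2) *\<^sub>R u) - sup_\<xi> n ((1/2) *\<^sub>R u) \<le> 2 * d"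
        using dev_upper[of "(1/2) *\<^sub>R u" w n] w by linarith
      moreover have "sup_\<xi> n ((1/2) *\<^sub>R u) \<le> d / 2"
        using u(3) by (intro sup_\<xi>_le) (auto simp: blinfun.scaleR_right abs_le_iff)
      ultimately show ?thesis by (simp add: blinfun.scaleR_right)
    qed
    have nn: "norm (v - v') \<le> 2" "norm (v' - v) \<le> 2"
      using norm_triangle_ineq4[of v v'] norm_triangle_ineq4[of v' v] v by (auto simp: ball_Y_def)
    have "v - v' \<in> Y" "v' - v \<in> Y" using v Y(2) by (auto simp: ball_Y_def subspace_diff)
    moreover have "\<bar>blinfun_apply (\<xi> i) (v' - v)\<bar> \<le> d" if "i \<le> n" for i
      using close[OF that] by (simp add: blinfun.diff_right abs_minus_commute)
    ultimately have "blinfun_apply w (v - v') \<le> 5 * d" "blinfun_apply w (v' - v) \<le> 5 * d"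
      using nn close by (blast intro: one)+
    then show ?thesis by (simp add: blinfun.diff_right abs_le_iff)
  qed
  have "\<forall>\<^sub>F k in sequentially. dev n (Z k) < 2 * d"
    using order_tendstoD(2)[OF dev_lim, of n "2 * d"] dev_z d by simp
  moreover have "\<forall>\<^sub>F k in sequentially. \<forall>v\<in>V. \<bar>blinfun_apply (Z k) v - blinfun_apply z v\<bar> < d"
  proof (rule eventually_ball_finite[OF V(1)], rule ballI)
    fix v assume "v \<in> V"
    then have "v \<in> Y" using V(2) by (auto simp: ball_Y_def)
    from tendstoD[OF lim[OF this] d]
    show "\<forall>\<^sub>F k in sequentially. \<bar>blinfun_apply (Z k) v - blinfun_apply z v\<bar> < d"
      by (simp add: dist_real_def)
  qed
  ultimately show ?thesis
  proof eventually_elim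
    case (elim k)
    show ?case
    proof
      fix v assume v: "v \<in> ball_Y"
      obtain v' where v': "v' \<in> V" "\<And>i. i \<le> n \<Longrightarrow> \<bar>blinfun_apply (\<xi> i) (v - v')\<bar> \<le> d"
        using V(3)[OF v] by blast
      have "v' \<in> ball_Y" using v' V by auto
      have "\<bar>blinfun_apply (Z k) (v - v')\<bar> \<le> 5 * d" "\<bar>blinfun_apply z (v - v')\<bar> \<le> 5 * d"
        using elim(1) dev_z d by (auto intro!: osc v v' \<open>v' \<in> ball_Y\<close>)
      moreover have "\<bar>blinfun_apply (Z k) v' - blinfun_apply z v'\<bar> < d" using elim(2) v' by blast
      ultimately show "\<bar>blinfun_apply (Z k) v - blinfun_apply z v\<bar> \<le> e"
        unfolding blinfun.diff_right d_def by linarith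
    qed
  qed
qed

text \<open>An upper estimate is the useful half of differentiability: at a minimum of
  \<open>F\<close> plus such perturbations it becomes a lower estimate for \<open>F\<close>. The
  slope is the maximizer at \<open>y\<close>, since maximizers for nearby points converge to it in
  norm on \<open>Y\<close>.\<close>

lemma sm_superdifferentiable:
  assumes y: "y \<in> Y"
  obtains z where "norm z \<le> 1"
    "\<And>e. 0 < e \<Longrightarrow> \<exists>d>0. \<forall>u\<in>Y. norm (u - y) < d \<longrightarrow>
      sm u \<le> sm y + blinfun_apply z (u - y) + e * norm (u - y)"
proof -
  obtain z where z: "norm z \<le> 1" "sm y \<le> blinfun_apply z y - \<kappa> * pen z"
    using sm_attained[OF y] by blast
  have close: "\<exists>d>0. \<forall>w. norm w \<le> 1 \<and> sm y - d \<le> blinfun_apply w y - \<kappa> * pen w \<longrightarrow>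
      (\<forall>v\<in>ball_Y. \<bar>blinfun_apply w v - blinfun_apply z v\<bar> \<le> e)" if e: "e > 0" for e
  proof (rule ccontr)
    assume neg: "\<not> ?thesis"
    have "\<forall>k. \<exists>w. norm w \<le> 1 \<and> sm y - inverse (real (Suc k)) \<le> blinfun_apply w y - \<kappa> * pen w \<and>
      \<not> (\<forall>v\<in>ball_Y. \<bar>blinfun_apply w v - blinfun_apply z v\<bar> \<le> e)"
    proof
      fix k :: nat
      have "inverse (real (Suc k)) > 0" by simp
      then show "\<exists>w. norm w \<le> 1 \<and> sm y - inverse (real (Suc k)) \<le> blinfun_apply w y - \<kappa> * pen w \<and>
        \<not> (\<forall>v\<in>ball_Y. \<bar>blinfun_apply w v - blinfun_apply z v\<bar> \<le> e)" using neg by blast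
    qed
    then obtain Z where Z: "\<forall>k. norm (Z k) \<le> 1 \<and>
      sm y - inverse (real (Suc k)) \<le> blinfun_apply (Z k) y - \<kappa> * pen (Z k) \<and>
      \<not> (\<forall>v\<in>ball_Y. \<bar>blinfun_apply (Z k) v - blinfun_apply z v\<bar> \<le> e)"
      unfolding choice_iff ..
    have "\<forall>\<^sub>F k in sequentially. \<forall>v\<in>ball_Y. \<bar>blinfun_apply (Z k) v - blinfun_apply z v\<bar> \<le> e"
      by (rule near_maximizers_converge[OF z _ _ LIMSEQ_inverse_real_of_nat e]) (use Z in auto)
    moreover have "\<forall>\<^sub>F k in sequentially. \<not> (\<forall>v\<in>ball_Y. \<bar>blinfun_apply (Z k) v - blinfun_apply z v\<bar> \<le> e)"
      using Z by auto
    ultimately have "\<forall>\<^sub>F k in sequentially. False" by eventually_elim blast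
    then show False by simp
  qed
  show thesis
  proof (rule that[OF z(1)])
    fix e :: real assume e: "0 < e"
    then have e2: "e / 2 > 0" by simp
    obtain d where d: "d > 0" "\<And>w v. norm w \<le> 1 \<Longrightarrow> sm y - d \<le> blinfun_apply w y - \<kappa> * pen w \<Longrightarrow>
      v \<in> ball_Y \<Longrightarrow> \<bar>blinfun_apply w v - blinfun_apply z v\<bar> \<le> e / 2"
      using close[OF e2] by blast
    \<comment> \<open>Passing from \<open>u\<close> to \<open>y\<close> changes the functional and
      \<open>sm\<close> by at most \<open>norm (u - y)\<close> each, and the choice of
      \<open>w\<close> loses a further \<open>e / 2\<close> times that norm; together this stays
      below \<open>d\<close>.\<close>
    define r where "r = d / (2 + e / 2)"
    have r: "r > 0" using d e by (simp add: r_def)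
    have "sm u \<le> sm y + blinfun_apply z (u - y) + e * norm (u - y)" if u: "u \<in> Y" "norm (u - y) < r" for u
    proof (cases "u = y")
      case True then show ?thesis by (simp add: blinfun.zero_right)
    next
      case False
      define h where "h = norm (u - y)"
      have h: "h > 0" using False by (simp add: h_def)
      obtain w where w: "norm w \<le> 1" "sm u - e / 2 * h < blinfun_apply w u - \<kappa> * pen w"
        using sm_less[of "sm u - e / 2 * h" u] h e by auto
      have wu: "blinfun_apply w u = blinfun_apply w y + blinfun_apply w (u - y)"
        by (simp add: blinfun.diff_right)
      have "(2 + e / 2) * h < d" using u(2) e unfolding h_def r_def by (simp add: pos_less_divide_eq mult.commute)
      then have "sm y - d \<le> blinfun_apply w y - \<kappa> * pen w"
        using w(2) wu abs_blinfun_le[OF w(1), of "u - y"] sm_lipschitz[of u y]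
        by (simp add: h_def abs_le_iff algebra_simps)
      then have "\<bar>blinfun_apply w ((1/h) *\<^sub>R (u - y)) - blinfun_apply z ((1/h) *\<^sub>R (u - y))\<bar> \<le> e / 2"
        using u y Y(2) h w(1) by (intro d) (auto simp: ball_Y_def h_def intro!: subspace_scale subspace_diff)
      then have "\<bar>(blinfun_apply w (u - y) - blinfun_apply z (u - y)) / h\<bar> \<le> e / 2"
        by (simp add: blinfun.scaleR_right diff_divide_distrib)
      then have "\<bar>blinfun_apply w (u - y) - blinfun_apply z (u - y)\<bar> \<le> e / 2 * h"
        using h by (simp add: pos_divide_le_eq)
      then have "blinfun_apply w (u - y) - blinfun_apply z (u - y) \<le> e / 2 * h" by linarith
      moreover have "blinfun_apply w y - \<kappa> * pen w \<le> sm y" by (rule sm_upper[OF w(1)])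
      ultimately show ?thesis using w(2) wu by (simp add: h_def[symmetric])
    qed
    then show "\<exists>d>0. \<forall>u\<in>Y. norm (u - y) < d \<longrightarrow>
      sm u \<le> sm y + blinfun_apply z (u - y) + e * norm (u - y)" using r by blast
  qed
qed

end

section \<open>Separable reduction\<close>

lemma countable_closure_under:
  fixes R :: "'a \<Rightarrow> 'a \<Rightarrow> 'a set"
  assumes R: "\<And>x y. countable (R x y)" and D0: "countable D0"
  obtains D where "countable D" "D0 \<subseteq> D" "\<And>x y. x \<in> D \<Longrightarrow> y \<in> D \<Longrightarrow> R x y \<subseteq> D"
proof -
  define T where "T = rec_nat D0 (\<lambda>_ S. S \<union> (\<Union>x\<in>S. \<Union>y\<in>S. R x y))"
  have T0: "T 0 = D0" and TS: "T (Suc n) = T n \<union> (\<Union>x\<in>T n. \<Union>y\<in>T n. R x y)" for n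
    by (simp_all add: T_def)
  have cnt: "countable (T n)" for n
    by (induction n) (auto simp: T0 TS D0 R)
  have mono: "T m \<subseteq> T n" if "m \<le> n" for m n
    using that by (rule lift_Suc_mono_le[rotated]) (auto simp: TS)
  show thesis
  proof (rule that[of "\<Union>n. T n"])
    show "countable (\<Union>n. T n)" using cnt by auto
    show "D0 \<subseteq> (\<Union>n. T n)" using T0 by auto
    fix x y assume "x \<in> (\<Union>n. T n)" "y \<in> (\<Union>n. T n)"
    then obtain m n where "x \<in> T m" "y \<in> T n" by auto
    then have "x \<in> T (max m n)" "y \<in> T (max m n)"
      using mono[of m "max m n"] mono[of n "max m n"] by auto
    then have "R x y \<subseteq> T (Suc (max m n))" by (auto simp: TS)
    then show "R x y \<subseteq> (\<Union>n. T n)" by blast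
  qed
qed

lemma subspace_closure_rational:
  fixes D :: "'a::real_normed_vector set"
  assumes "D \<noteq> {}" and add: "\<And>x y. x \<in> D \<Longrightarrow> y \<in> D \<Longrightarrow> x + y \<in> D"
    and scale: "\<And>q x. q \<in> \<rat> \<Longrightarrow> x \<in> D \<Longrightarrow> q *\<^sub>R x \<in> D"
  shows "subspace (closure D)"
proof -
  have sub: "D \<subseteq> closure D" by (rule closure_subset)
  have "(\<lambda>p. fst p + snd p) ` closure (D \<times> D) \<subseteq> closure D"
    using add sub by (intro image_closure_subset continuous_intros closed_closure) auto
  then have add': "x + y \<in> closure D" if "x \<in> closure D" "y \<in> closure D" for x y
    using that by (auto simp: closure_Times image_subset_iff)
  have "(\<lambda>p. fst p *\<^sub>R snd p) ` closure (\<rat> \<times> D) \<subseteq> closure D"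
    using scale sub by (intro image_closure_subset continuous_intros closed_closure) auto
  then have scale': "t *\<^sub>R x \<in> closure D" if "x \<in> closure D" for t x
    using that by (auto simp: closure_Times Rats_closure_real image_subset_iff)
  have "0 \<in> D"
    using assms(1) scale[of 0] by (metis Rats_0 ex_in_conv scaleR_zero_left)
  then show ?thesis using add' scale' sub by (intro subspaceI) auto
qed

text \<open>By Hahn-Banach, \<open>F x\<close> lies below all these values, with \<open>u i\<close>
  within radius \<open>\<delta> (n i)\<close> of \<open>x\<close>, precisely when a functional of
  norm at most \<open>c\<close> supports \<open>F\<close> at \<open>x\<close> up to the error
  \<open>1 / Suc n\<close> on each ball of radius \<open>\<delta> n\<close>. The existence of a
  subgradient thus becomes a statement about finitely many points at a time.\<close>

definition hull_value :: "('a::real_normed_vector \<Rightarrow> real) \<Rightarrow> real \<Rightarrow> 'a \<Rightarrow> nat \<Rightarrow> (nat \<Rightarrow> real) \<Rightarrow>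
    (nat \<Rightarrow> 'a) \<Rightarrow> (nat \<Rightarrow> nat) \<Rightarrow> real" where
  "hull_value F c x k l u n = (\<Sum>i<k. l i * (F (u i) + norm (u i - x) / Suc (n i)))
     + c * norm ((\<Sum>i<k. l i *\<^sub>R u i) - x)"

lemma hull_value_lipschitz:
  assumes "\<And>i. i < k \<Longrightarrow> 0 \<le> l i" "sum l {..<k} = 1" "0 \<le> c"
  shows "hull_value F c x k l u n \<le> hull_value F c y k l u n + (1 + c) * norm (x - y)"
proof -
  have "(\<Sum>i<k. l i * (F (u i) + norm (u i - x) / Suc (n i)))
      \<le> (\<Sum>i<k. l i * (F (u i) + norm (u i - y) / Suc (n i)) + l i * norm (x - y))"
  proof (rule sum_mono)
    fix i assume "i \<in> {..<k}"
    have "norm (u i - x) \<le> norm (u i - y) + norm (x - y)"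
      using norm_triangle_ineq4[of "u i - y" "x - y"] by simp
    then have "norm (u i - x) / Suc (n i) \<le> (norm (u i - y) + norm (x - y)) / Suc (n i)"
      by (intro divide_right_mono) auto
    also have "\<dots> = norm (u i - y) / Suc (n i) + norm (x - y) / Suc (n i)"
      by (rule add_divide_distrib)
    also have "\<dots> \<le> norm (u i - y) / Suc (n i) + norm (x - y) / 1"
      by (intro add_left_mono divide_left_mono) auto
    finally have "l i * (F (u i) + norm (u i - x) / Suc (n i))
        \<le> l i * (F (u i) + norm (u i - y) / Suc (n i) + norm (x - y))"
      using assms(1) \<open>i \<in> {..<k}\<close> by (intro mult_left_mono) auto
    then show "l i * (F (u i) + norm (u i - x) / Suc (n i))
        \<le> l i * (F (u i) + norm (u i - y) / Suc (n i)) + l i * norm (x - y)"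
      by (simp add: distrib_left)
  qed
  also have "\<dots> = (\<Sum>i<k. l i * (F (u i) + norm (u i - y) / Suc (n i))) + norm (x - y)"
    using assms(2) by (simp add: sum.distrib sum_distrib_right[symmetric])
  finally have 1: "(\<Sum>i<k. l i * (F (u i) + norm (u i - x) / Suc (n i)))
      \<le> (\<Sum>i<k. l i * (F (u i) + norm (u i - y) / Suc (n i))) + norm (x - y)" .
  have "norm ((\<Sum>i<k. l i *\<^sub>R u i) - x) \<le> norm ((\<Sum>i<k. l i *\<^sub>R u i) - y) + norm (x - y)"
    using norm_triangle_ineq4[of "(\<Sum>i<k. l i *\<^sub>R u i) - y" "x - y"] by simp
  then have "c * norm ((\<Sum>i<k. l i *\<^sub>R u i) - x) \<le> c * (norm ((\<Sum>i<k. l i *\<^sub>R u i) - y) + norm (x - y))"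
    using assms(3) by (rule mult_left_mono)
  with 1 show ?thesis by (simp add: hull_value_def algebra_simps)
qed

text \<open>
  The inequality \<open>hull_value F c x k l u n < s\<close> is stable under small changes of \<open>x\<close>, so countably many
  parameters suffice, and \<open>D\<close> only has to contain one witness \<open>u\<close> for each of them.
\<close>

theorem separable_reduction:
  fixes F :: "'a::real_normed_vector \<Rightarrow> real"
  assumes c: "0 \<le> c"
  obtains D where "countable D" "x0 \<in> D" "subspace (closure D)"
    "\<And>x r \<delta> k l u n. x \<in> closure D \<Longrightarrow>
      (\<And>k l u n. (\<And>i. i < k \<Longrightarrow> 0 \<le> l i \<and> u i \<in> A \<and> u i \<in> closure D \<and> norm (u i - x) < \<delta> (n i)) \<Longrightarrow>
         sum l {..<k} = 1 \<Longrightarrow> r \<le> hull_value F c x k l u n) \<Longrightarrow>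
      (\<And>i. i < k \<Longrightarrow> 0 \<le> l i \<and> u i \<in> A \<and> norm (u i - x) < \<delta> (n i)) \<Longrightarrow>
      sum l {..<k} = 1 \<Longrightarrow> r \<le> hull_value F c x k l u n"
proof -
  \<comment> \<open>The entries of \<open>ps\<close> pair a rational radius with the index of its
    error term, and \<open>s\<close> is a rational bound for the value; so each base point has only
    countably many requests.\<close>
  define good where "good x ps s p \<longleftrightarrow>
      (\<forall>i<length ps. 0 \<le> fst p i \<and> snd p i \<in> A \<and> norm (snd p i - x) < of_rat (fst (ps ! i))) \<and>
      sum (fst p) {..<length ps} = 1 \<and>
      hull_value F c x (length ps) (fst p) (snd p) (\<lambda>i. snd (ps ! i)) < of_rat s"
    for x :: 'a and ps :: "(rat \<times> nat) list" and s :: rat and p :: "(nat \<Rightarrow> real) \<times> (nat \<Rightarrow> 'a)"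
  define wit where "wit x ps s = snd (SOME p. good x ps s p) ` {..<length ps}" for x ps s
  define R where "R x y = {x + y} \<union> range (\<lambda>q::rat. of_rat q *\<^sub>R x) \<union> (\<Union>(ps, s)\<in>UNIV. wit x ps s)"
    for x y :: 'a
  have cR: "countable (R x y)" for x y
  proof -
    have "countable (wit x ps s)" for x ps s by (simp add: wit_def)
    then have "countable (\<Union>p\<in>UNIV. wit x (fst p) (snd p))" by (intro countable_UN) auto
    then show ?thesis unfolding R_def case_prod_beta by (intro countable_Un) auto
  qed
  obtain D where D: "countable D" "{x0} \<subseteq> D" "\<And>x y. x \<in> D \<Longrightarrow> y \<in> D \<Longrightarrow> R x y \<subseteq> D"
    by (rule countable_closure_under[where R = R and ?D0.0 = "{x0}", OF cR]) auto
  have sub: "subspace (closure D)"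
  proof (rule subspace_closure_rational)
    show "D \<noteq> {}" using D by auto
    show "x + y \<in> D" if "x \<in> D" "y \<in> D" for x y using D(3)[OF that] by (auto simp: R_def)
    show "q *\<^sub>R x \<in> D" if "q \<in> \<rat>" "x \<in> D" for q x
      using D(3)[OF that(2) that(2)] that(1) by (auto simp: R_def Rats_def)
  qed
  have wit_D: "wit x ps s \<subseteq> D" if "x \<in> D" for x ps s
    using D(3)[OF that that] by (auto simp: R_def)
  show thesis
  proof (rule that[of D])
    fix x :: 'a and r :: real and \<delta> :: "nat \<Rightarrow> real" and k :: nat and l :: "nat \<Rightarrow> real"
      and u :: "nat \<Rightarrow> 'a" and n :: "nat \<Rightarrow> nat"
    assume x: "x \<in> closure D"
      and hyp: "\<And>k l u n. (\<And>i. i < k \<Longrightarrow> 0 \<le> l i \<and> u i \<in> A \<and> u i \<in> closure D \<and> norm (u i - x) < \<delta> (n i)) \<Longrightarrow>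
         sum l {..<k} = 1 \<Longrightarrow> r \<le> hull_value F c x k l u n"
      and lu: "\<And>i. i < k \<Longrightarrow> 0 \<le> l i \<and> u i \<in> A \<and> norm (u i - x) < \<delta> (n i)"
      and l1: "sum l {..<k} = 1"
    show "r \<le> hull_value F c x k l u n"
    proof (rule ccontr)
      assume "\<not> ?thesis"
      then have less: "hull_value F c x k l u n < r" by simp
      obtain s where s: "hull_value F c x k l u n < of_rat s" "of_rat s < r"
        using of_rat_dense[OF less] by blast
      \<comment> \<open>The smallest slack among the finitely many strict inequalities; it bounds
        how far \<open>x\<close> may be moved into \<open>D\<close>.\<close>
      define g where "g = Min (insert (r - of_rat s) (insert (of_rat s - hull_value F c x k l u n)
        ((\<lambda>i. \<delta> (n i) - norm (u i - x)) ` {..<k})))"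
      have g_le: "g \<le> r - of_rat s" "g \<le> of_rat s - hull_value F c x k l u n"
        "\<And>i. i < k \<Longrightarrow> g \<le> \<delta> (n i) - norm (u i - x)"
        unfolding g_def by (rule Min_le; auto)+
      have "g > 0" unfolding g_def by (subst Min_gr_iff) (use s lu in auto)
      define \<theta> where "\<theta> = g / (3 * (1 + c))"
      have \<theta>: "\<theta> > 0" using \<open>g > 0\<close> c by (simp add: \<theta>_def)
      have \<theta>g: "(1 + c) * \<theta> = g / 3" using c by (simp add: \<theta>_def field_simps)
      have "1 * \<theta> \<le> (1 + c) * \<theta>" using c \<theta> by (intro mult_right_mono) auto
      then have \<theta>3: "3 * \<theta> \<le> g" using \<theta>g by simp
      obtain x' where x': "x' \<in> D" "norm (x - x') < \<theta>"
        using x \<theta> unfolding closure_approachable dist_norm by (metis norm_minus_commute)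
      \<comment> \<open>One \<theta> of room is spent on moving from \<open>x\<close> to
        \<open>x'\<close>, the other on returning with the witnesses chosen for
        \<open>x'\<close>.\<close>
      have "\<exists>q::rat. norm (u i - x) + \<theta> < of_rat q \<and> of_rat q < \<delta> (n i) - \<theta>" if "i < k" for i
      proof -
        have "norm (u i - x) + \<theta> < \<delta> (n i) - \<theta>" using g_le(3)[OF that] \<theta>3 \<theta> by linarith
        from of_rat_dense[OF this] show ?thesis by blast
      qed
      then obtain \<rho> :: "nat \<Rightarrow> rat" where \<rho>:
        "\<And>i. i < k \<Longrightarrow> norm (u i - x) + \<theta> < of_rat (\<rho> i) \<and> of_rat (\<rho> i) < \<delta> (n i) - \<theta>" by metis
      define ps where "ps = map (\<lambda>i. (\<rho> i, n i)) [0..<k]"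
      have ps: "length ps = k" "\<And>i. i < k \<Longrightarrow> ps ! i = (\<rho> i, n i)" by (auto simp: ps_def)
      have hv: "hull_value F c y k l' u' (\<lambda>i. snd (ps ! i)) = hull_value F c y k l' u' n" for y l' u'
        unfolding hull_value_def using ps by auto
      have move: "(1 + c) * norm (x' - x) < g / 3" "(1 + c) * norm (x - x') < g / 3"
        using x'(2) c \<theta>g mult_strict_left_mono[of "norm (x - x')" \<theta> "1 + c"]
        by (auto simp: norm_minus_commute)
      have "good x' ps s (l, u)"
        unfolding good_def ps(1) fst_conv snd_conv hv
      proof (intro conjI allI impI)
        fix i assume i: "i < k"
        show "0 \<le> l i" "u i \<in> A" using lu[OF i] by auto
        have "norm (u i - x') \<le> norm (u i - x) + norm (x - x')"
          using norm_triangle_ineq[of "u i - x" "x - x'"] by simp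
        then show "norm (u i - x') < of_rat (fst (ps ! i))"
          using \<rho>[OF i] x'(2) ps(2)[OF i] by simp
      next
        have "hull_value F c x' k l u n \<le> hull_value F c x k l u n + (1 + c) * norm (x' - x)"
          using lu l1 c by (intro hull_value_lipschitz) auto
        then show "hull_value F c x' k l u n < of_rat s" using move(1) g_le(2) \<open>g > 0\<close> by linarith
      qed (rule l1)
      define p where "p = (SOME p. good x' ps s p)"
      have p: "good x' ps s p" unfolding p_def using \<open>good x' ps s (l, u)\<close> by (rule someI)
      have pD: "snd p i \<in> D" if "i < k" for i
        using wit_D[OF x'(1), of ps s] that ps(1) by (auto simp: wit_def p_def)
      have "r \<le> hull_value F c x k (fst p) (snd p) n"
      proof (rule hyp)
        show "sum (fst p) {..<k} = 1" using p by (simp add: good_def ps)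
        fix i assume i: "i < k"
        have "norm (snd p i - x) \<le> norm (snd p i - x') + norm (x' - x)"
          using norm_triangle_ineq[of "snd p i - x'" "x' - x"] by simp
        moreover have "norm (snd p i - x') < of_rat (\<rho> i)" using p i by (simp add: good_def ps)
        ultimately have "norm (snd p i - x) < \<delta> (n i)"
          using \<rho>[OF i] x'(2) by (simp add: norm_minus_commute)
        then show "0 \<le> fst p i \<and> snd p i \<in> A \<and> snd p i \<in> closure D \<and> norm (snd p i - x) < \<delta> (n i)"
          using p i pD[OF i] closure_subset[of D] by (auto simp: good_def ps)
      qed
      also have "\<dots> \<le> hull_value F c x' k (fst p) (snd p) n + (1 + c) * norm (x - x')"
        using p c by (intro hull_value_lipschitz) (auto simp: good_def ps)
      also have "hull_value F c x' k (fst p) (snd p) n < of_rat s"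
        using p hv[of x' "fst p" "snd p"] by (simp add: good_def ps(1))
      finally show False using move(2) g_le(1) \<open>g > 0\<close> by linarith
    qed
  qed (use D sub in auto)
qed

text \<open>The Lipschitz constants bound the tail uniformly, and the finitely many remaining terms
  are treated on a common radius.\<close>

lemma superdifferentiable_suminf:
  fixes g :: "nat \<Rightarrow> 'a::real_normed_vector \<Rightarrow> real" and z :: "nat \<Rightarrow> 'a \<Rightarrow>\<^sub>L real"
  assumes mu: "summable \<mu>"
    and lip: "\<And>k u v. \<bar>g k u - g k v\<bar> \<le> \<mu> k * norm (u - v)"
    and z: "\<And>k. norm (z k) \<le> \<mu> k" and g: "\<And>u. summable (\<lambda>k. g k u)"
    and sup: "\<And>k e. 0 < e \<Longrightarrow> \<exists>d>0. \<forall>u\<in>Y. norm (u - x) < d \<longrightarrow>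
      g k u \<le> g k x + blinfun_apply (z k) (u - x) + e * norm (u - x)"
    and e: "0 < e"
  shows "\<exists>d>0. \<forall>u\<in>Y. norm (u - x) < d \<longrightarrow>
    (\<Sum>k. g k u) \<le> (\<Sum>k. g k x) + blinfun_apply (\<Sum>k. z k) (u - x) + e * norm (u - x)"
proof -
  obtain N where "norm (\<Sum>i. \<mu> (i + N)) < e / 4"
    using suminf_exist_split[OF _ mu, of "e / 4"] e by auto
  then have N: "(\<Sum>i. \<mu> (i + N)) < e / 4" by simp
  \<comment> \<open>Half of \<open>e\<close> is shared by the first \<open>N\<close> terms; the tail
    takes the other half, as its terms deviate by at most twice their Lipschitz constants.\<close>
  define \<eta> where "\<eta> = e / (2 * real (Suc N))"
  have \<eta>: "\<eta> > 0" using e by (simp add: \<eta>_def)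
  have "\<forall>k. \<exists>d>0. \<forall>u\<in>Y. norm (u - x) < d \<longrightarrow>
      g k u \<le> g k x + blinfun_apply (z k) (u - x) + \<eta> * norm (u - x)" using sup[OF \<eta>] by blast
  then obtain d where d: "\<forall>k. d k > 0 \<and> (\<forall>u\<in>Y. norm (u - x) < d k \<longrightarrow>
      g k u \<le> g k x + blinfun_apply (z k) (u - x) + \<eta> * norm (u - x))" unfolding choice_iff ..
  define r where "r = Min (insert 1 (d ` {..<N}))"
  have r: "r > 0" unfolding r_def by (subst Min_gr_iff) (use d in auto)
  have r_le: "r \<le> d k" if "k < N" for k unfolding r_def using that by (intro Min_le) auto
  have zs: "summable z"
    by (rule summable_comparison_test'[OF mu, of 0]) (rule z)
  show ?thesis
  proof (intro exI[of _ r] conjI ballI impI r)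
    fix u assume u: "u \<in> Y" "norm (u - x) < r"
    define h where "h = norm (u - x)"
    define t where "t k = g k u - g k x - blinfun_apply (z k) (u - x)" for k
    have zap: "(\<lambda>k. blinfun_apply (z k) (u - x)) sums blinfun_apply (\<Sum>k. z k) (u - x)"
      by (rule bounded_linear.sums[OF blinfun.bounded_linear_left summable_sums[OF zs]])
    have t_sums: "t sums ((\<Sum>k. g k u) - (\<Sum>k. g k x) - blinfun_apply (\<Sum>k. z k) (u - x))"
      unfolding t_def by (intro sums_diff summable_sums g zap)
    have t_le: "t k \<le> \<mu> k * (2 * h)" for k
    proof -
      have "\<bar>blinfun_apply (z k) (u - x)\<bar> \<le> norm (z k) * h" using norm_blinfun[of "z k" "u - x"] by (simp add: h_def)
      also have "\<dots> \<le> \<mu> k * h" using z[of k] by (intro mult_right_mono) (auto simp: h_def)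
      finally show ?thesis using lip[of k u x] by (simp add: t_def h_def abs_le_iff)
    qed
    have "suminf t = (\<Sum>k. t (k + N)) + (\<Sum>k<N. t k)"
      by (rule suminf_split_initial_segment[OF sums_summable[OF t_sums]])
    also have "(\<Sum>k. t (k + N)) \<le> (\<Sum>k. \<mu> (k + N) * (2 * h))"
      using mu sums_summable[OF t_sums]
      by (intro suminf_le t_le summable_mult2) (auto simp: summable_iff_shift)
    also have "\<dots> = (\<Sum>k. \<mu> (k + N)) * (2 * h)"
      using mu by (intro suminf_mult2[symmetric]) (auto simp: summable_iff_shift)
    also have "\<dots> \<le> e / 4 * (2 * h)" using N by (intro mult_right_mono) (auto simp: h_def)
    also have "(\<Sum>k<N. t k) \<le> (\<Sum>k<N. \<eta> * h)"
    proof (rule sum_mono)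
      fix k assume "k \<in> {..<N}"
      then have "norm (u - x) < d k" using u(2) r_le[of k] by simp
      then have "g k u \<le> g k x + blinfun_apply (z k) (u - x) + \<eta> * norm (u - x)" using d u(1) by blast
      then show "t k \<le> \<eta> * h" by (simp add: t_def h_def)
    qed
    also have "(\<Sum>k<N. \<eta> * h) \<le> e / 2 * h"
    proof -
      have "real N * \<eta> \<le> e / 2" using e by (simp add: \<eta>_def field_simps)
      then have "real N * \<eta> * h \<le> e / 2 * h" by (intro mult_right_mono) (auto simp: h_def)
      then show ?thesis by simp
    qed
    finally have "suminf t \<le> e * h" by simp
    then show "(\<Sum>k. g k u) \<le> (\<Sum>k. g k x) + blinfun_apply (\<Sum>k. z k) (u - x) + e * norm (u - x)"
      using sums_unique[OF t_sums] by (simp add: h_def)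
  qed
qed

section \<open>Subgradients near a local minimum\<close>

lemma weights_hull_le:
  fixes z :: "'a::real_normed_vector \<Rightarrow>\<^sub>L real"
  assumes z: "norm z \<le> c" and l: "\<And>i. i < k \<Longrightarrow> 0 \<le> l i" "sum l {..<k} = 1"
    and sub: "\<And>i. i < k \<Longrightarrow> r + blinfun_apply z (u i - x) \<le> F (u i) + norm (u i - x) / Suc (n i)"
  shows "r \<le> hull_value F c x k l u n"
proof -
  have comb: "(\<Sum>i<k. l i *\<^sub>R (u i - x)) = (\<Sum>i<k. l i *\<^sub>R u i) - x"
    using l(2) by (simp add: scaleR_diff_right sum_subtractf scaleR_sum_left[symmetric])
  have "r + blinfun_apply z ((\<Sum>i<k. l i *\<^sub>R u i) - x) = (\<Sum>i<k. l i * (r + blinfun_apply z (u i - x)))"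
    unfolding comb[symmetric] using l(2)
    by (simp add: blinfun.sum_right blinfun.scaleR_right distrib_left sum.distrib sum_distrib_right[symmetric])
  also have "\<dots> \<le> (\<Sum>i<k. l i * (F (u i) + norm (u i - x) / Suc (n i)))"
    using l(1) sub by (intro sum_mono mult_left_mono) auto
  finally have "r + blinfun_apply z ((\<Sum>i<k. l i *\<^sub>R u i) - x)
      \<le> (\<Sum>i<k. l i * (F (u i) + norm (u i - x) / Suc (n i)))" .
  moreover have "\<bar>blinfun_apply z v\<bar> \<le> c * norm v" for v
    using norm_blinfun[of z v] mult_right_mono[OF z, of "norm v"] by simp
  from this[of "(\<Sum>i<k. l i *\<^sub>R u i) - x"]
  have "- blinfun_apply z ((\<Sum>i<k. l i *\<^sub>R u i) - x) \<le> c * norm ((\<Sum>i<k. l i *\<^sub>R u i) - x)" by linarith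
  ultimately show ?thesis unfolding hull_value_def by linarith
qed

text \<open>The converse of \<open>weights_hull_le\<close>: on the convex hull of all
  increment-bound pairs the hypothesis is exactly the domination required by Hahn-Banach.\<close>

lemma functional_from_hull:
  fixes F :: "'a::real_normed_vector \<Rightarrow> real"
  assumes c: "0 \<le> c"
    and hull: "\<And>k l u n. (\<And>i. i < k \<Longrightarrow> 0 \<le> l i \<and> u i \<in> A \<and> norm (u i - x) < \<delta> (n i)) \<Longrightarrow>
      sum l {..<k} = 1 \<Longrightarrow> r \<le> hull_value F c x k l u n"
  obtains z :: "'a \<Rightarrow>\<^sub>L real" where "norm z \<le> c"
    "\<And>u n. u \<in> A \<Longrightarrow> norm (u - x) < \<delta> n \<Longrightarrow> r + blinfun_apply z (u - x) \<le> F u + norm (u - x) / Suc n"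
proof -
  define G where "G = {(u - x, F u - r + norm (u - x) / Suc n) | u n. u \<in> A \<and> norm (u - x) < \<delta> n}"
  have "- (c * norm h) \<le> a" if "(h, a) \<in> convex hull G" for h a
  proof -
    from that obtain k and l :: "nat \<Rightarrow> real" and g where
      lg: "\<forall>i\<in>{1..k}. 0 \<le> l i \<and> g i \<in> G" "sum l {1..k} = 1" "(\<Sum>i = 1..k. l i *\<^sub>R g i) = (h, a)"
      unfolding convex_hull_indexed by blast
    have "\<forall>i\<in>{1..k}. \<exists>u n. g i = (u - x, F u - r + norm (u - x) / Suc n) \<and> u \<in> A \<and> norm (u - x) < \<delta> n"
      using lg(1) unfolding G_def by blast
    then obtain u n where un: "\<And>i. i \<in> {1..k} \<Longrightarrow> g i = (u i - x, F (u i) - r + norm (u i - x) / Suc (n i))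
        \<and> u i \<in> A \<and> norm (u i - x) < \<delta> (n i)" by metis
    \<comment> \<open>The convex hull is indexed from 1 to \<open>k\<close>, whereas
      \<open>hull_value\<close> counts from 0.\<close>
    have shift: "sum f {1..k} = (\<Sum>i<k. f (Suc i))" for f :: "nat \<Rightarrow> 'b::comm_monoid_add"
      by (simp add: sum.atLeast1_atMost_eq)
    have l1: "(\<Sum>i<k. l (Suc i)) = 1" using lg(2) shift[of l] by simp
    have mem: "Suc i \<in> {1..k}" if "i < k" for i using that by auto
    have "r \<le> hull_value F c x k (\<lambda>i. l (Suc i)) (\<lambda>i. u (Suc i)) (\<lambda>i. n (Suc i))"
      by (rule hull[OF _ l1]) (use mem un lg(1) in blast)
    moreover have "h = (\<Sum>i<k. l (Suc i) *\<^sub>R u (Suc i)) - x"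
    proof -
      have "h = fst (\<Sum>i = 1..k. l i *\<^sub>R g i)" using lg(3) by simp
      also have "\<dots> = (\<Sum>i<k. l (Suc i) *\<^sub>R (u (Suc i) - x))"
        unfolding shift fst_sum using un mem by (intro sum.cong) auto
      also have "\<dots> = (\<Sum>i<k. l (Suc i) *\<^sub>R u (Suc i)) - (\<Sum>i<k. l (Suc i)) *\<^sub>R x"
        by (simp add: scaleR_diff_right sum_subtractf scaleR_sum_left)
      finally show ?thesis using l1 by simp
    qed
    moreover have "a = (\<Sum>i<k. l (Suc i) * (F (u (Suc i)) + norm (u (Suc i) - x) / Suc (n (Suc i)))) - r"
    proof -
      have "a = snd (\<Sum>i = 1..k. l i *\<^sub>R g i)" using lg(3) by simp
      also have "\<dots> = (\<Sum>i<k. l (Suc i) * (F (u (Suc i)) - r + norm (u (Suc i) - x) / Suc (n (Suc i))))"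
        unfolding shift snd_sum using un mem by (intro sum.cong) auto
      also have "\<dots> = (\<Sum>i<k. l (Suc i) * (F (u (Suc i)) + norm (u (Suc i) - x) / Suc (n (Suc i))) - l (Suc i) * r)"
        by (simp add: algebra_simps)
      also have "\<dots> = (\<Sum>i<k. l (Suc i) * (F (u (Suc i)) + norm (u (Suc i) - x) / Suc (n (Suc i)))) - r"
        using l1 by (simp add: sum_subtractf sum_distrib_right[symmetric])
      finally show ?thesis .
    qed
    ultimately show ?thesis unfolding hull_value_def by simp
  qed
  note dom = this
  obtain z :: "'a \<Rightarrow>\<^sub>L real" where z: "norm z \<le> c"
    "\<And>h a. (h, a) \<in> convex hull G \<Longrightarrow> blinfun_apply z h \<le> a"
    using Hahn_Banach_blinfun[OF convex_convex_hull c dom] by blast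
  show thesis
  proof (rule that[OF z(1)])
    fix u n assume "u \<in> A" "norm (u - x) < \<delta> n"
    then have "(u - x, F u - r + norm (u - x) / Suc n) \<in> G" unfolding G_def by blast
    then have "(u - x, F u - r + norm (u - x) / Suc n) \<in> convex hull G" by (rule hull_inc)
    from z(2)[OF this] show "r + blinfun_apply z (u - x) \<le> F u + norm (u - x) / Suc n" by linarith
  qed
qed

text \<open>The Borwein-Preiss principle on \<open>A \<inter> Y\<close> near \<open>xh\<close> with
  \<open>sm\<close> as gauge; the negative of the weighted sum of the slopes is the subgradient
  relative to \<open>Y\<close>.\<close>

lemma local_subgradient_in_subspace:
  fixes F :: "'a::banach \<Rightarrow> real"
  assumes asp: "asplund TYPE('a)" and D: "countable D" "subspace (closure D)" and xh: "xh \<in> A" "xh \<in> closure D"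
    and epi: "closed {(u, r). u \<in> A \<and> F u \<le> r}"
    and c: "0 \<le> c" and rho: "0 < \<rho>"
    and min: "\<And>u. u \<in> A \<Longrightarrow> norm (u - xh) \<le> \<rho> \<Longrightarrow> F xh \<le> F u + c * norm (u - xh)"
    and e: "0 < e"
  obtains x and z :: "'a \<Rightarrow>\<^sub>L real" where "x \<in> A" "x \<in> closure D" "norm (x - xh) < e" "norm z \<le> c + e"
    "\<And>\<eta>. 0 < \<eta> \<Longrightarrow> \<exists>d>0. \<forall>u\<in>A \<inter> closure D. norm (u - x) < d \<longrightarrow>
      F x + blinfun_apply z (u - x) - \<eta> * norm (u - x) \<le> F u"
proof -
  define Y where "Y = closure D"
  \<comment> \<open>The first weight exceeds the slope \<open>c\<close> by \<open>e / 2\<close>,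
    which ties the new minimizer to \<open>xh\<close>; the other weights sum to
    \<open>e / 2\<close>, so the subgradient has norm at most \<open>c + e\<close>.\<close>
  define \<mu> where "\<mu> k = (if k = 0 then c + e / 2 else e / 2 * (1/2) ^ k)" for k :: nat
  have mu_pos: "\<mu> k > 0" for k using c e by (simp add: \<mu>_def)
  have mu_sums: "\<mu> sums (c + e)"
  proof -
    have "(\<lambda>k. e / 2 * (1/2) ^ k) sums (e / 2 * (1 / (1 - 1/2)))"
      by (intro sums_mult geometric_sums) simp
    moreover have "(\<lambda>k. if k = 0 then c else 0) sums c" using sums_single[of 0 "\<lambda>_. c"] by simp
    ultimately have "(\<lambda>k. (if k = 0 then c else 0) + e / 2 * (1/2) ^ k) sums (c + e)"
      using sums_add by fastforce
    moreover have "\<mu> = (\<lambda>k. (if k = 0 then c else 0) + e / 2 * (1/2) ^ k)" by (auto simp: \<mu>_def)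
    ultimately show ?thesis by simp
  qed
  note mu_summable = sums_summable[OF mu_sums]
  define m where "m = min e \<rho> / 2"
  have m: "0 < m" "m < e" "m < \<rho>" using e rho by (auto simp: m_def)
  \<comment> \<open>Chosen so that the gap \<open>4 * \<kappa>\<close> between \<open>sm\<close> and
    the norm, weighted by \<open>\<mu> 0\<close>, equals \<open>e / 2 * m\<close>.\<close>
  define \<kappa> where "\<kappa> = e / 2 * m / (4 * \<mu> 0)"
  have \<kappa>: "\<kappa> > 0" using e m mu_pos by (simp add: \<kappa>_def)
  have D_ne: "D \<noteq> {}" using xh by auto
  obtain \<xi> :: "nat \<Rightarrow> 'a \<Rightarrow>\<^sub>L real" where \<xi>: "\<xi> 0 = 0"
    "\<And>z e. norm z \<le> 1 \<Longrightarrow> 0 < e \<Longrightarrow>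
      \<exists>n. \<forall>y\<in>Y. \<bar>blinfun_apply z y - blinfun_apply (\<xi> n) y\<bar> \<le> e * norm y"
    using asplund_separable_dual_seq[OF asp D(1) Y_def D(2)[folded Y_def]] by blast
  interpret separable_dual D Y \<xi> \<kappa>
    by unfold_locales (use D D_ne \<xi> \<kappa> in \<open>auto simp: Y_def\<close>)
  define B where "B = A \<inter> Y \<inter> cball xh \<rho>"
  have B_iff: "u \<in> B \<longleftrightarrow> u \<in> A \<and> u \<in> Y \<and> norm (u - xh) \<le> \<rho>" for u
    by (auto simp: B_def dist_norm norm_minus_commute)
  have "{(u, r). u \<in> B \<and> F u \<le> r} = {(u, r). u \<in> A \<and> F u \<le> r} \<inter> ((Y \<inter> cball xh \<rho>) \<times> UNIV)"
    by (auto simp: B_def)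
  then have epiB: "closed {(u, r). u \<in> B \<and> F u \<le> r}"
    using epi by (simp add: closed_Int closed_Times Y_def)
  have xhB: "xh \<in> B" using xh rho by (simp add: B_iff Y_def)
  have "F xh - c * \<rho> \<le> F u" if "u \<in> B" for u
    using min[of u] that mult_left_mono[OF _ c, of "norm (u - xh)" \<rho>] by (simp add: B_iff)
  note bddB = this
  obtain X x where X: "X 0 = xh" "\<And>k. X k \<in> B" and x: "x \<in> B" "F x + \<mu> 0 * sm (x - xh) \<le> F xh"
    and summ: "\<And>u. summable (\<lambda>k. \<mu> k * sm (u - X k))"
    and xmin: "\<And>u. u \<in> B \<Longrightarrow> F x + (\<Sum>k. \<mu> k * sm (x - X k)) \<le> F u + (\<Sum>k. \<mu> k * sm (u - X k))"
    using Borwein_Preiss[OF epiB xhB bddB sm_zero sm_nonneg sm_lipschitz sm_coercive mu_pos mu_summable] by blast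
  \<comment> \<open>The decrease at \<open>x\<close> has rate \<open>\<mu> 0 = c + e / 2\<close> up
    to the smoothing gap, but minimality of \<open>xh\<close> permits only rate \<open>c\<close>;
    the surplus bounds the distance by \<open>m < \<rho>\<close>, so \<open>x\<close> is interior to
    the ball.\<close>
  have x_close: "norm (x - xh) \<le> m"
  proof -
    have "F xh \<le> F x + c * norm (x - xh)" using x(1) by (intro min) (auto simp: B_iff)
    moreover have "\<mu> 0 * (norm (x - xh) - 4 * \<kappa>) \<le> \<mu> 0 * sm (x - xh)"
      using sm_ge_norm mu_pos[of 0] by (intro mult_left_mono) auto
    ultimately have "\<mu> 0 * (norm (x - xh) - 4 * \<kappa>) \<le> c * norm (x - xh)" using x(2) by linarith
    moreover have "\<mu> 0 * (4 * \<kappa>) = e / 2 * m" using mu_pos[of 0] by (simp add: \<kappa>_def)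
    ultimately have "e / 2 * norm (x - xh) \<le> e / 2 * m" by (simp add: \<mu>_def algebra_simps)
    then show ?thesis using e by simp
  qed
  have xY: "x \<in> Y" "\<And>k. X k \<in> Y" using x X by (auto simp: B_iff)
  have "\<forall>k. \<exists>z. norm z \<le> 1 \<and> (\<forall>e>0. \<exists>d>0. \<forall>u\<in>Y. norm (u - (x - X k)) < d \<longrightarrow>
      sm u \<le> sm (x - X k) + blinfun_apply z (u - (x - X k)) + e * norm (u - (x - X k)))"
  proof
    fix k
    have "x - X k \<in> Y" using xY Y(2) by (simp add: subspace_diff)
    from sm_superdifferentiable[OF this] obtain z where "norm z \<le> 1" "\<And>e. 0 < e \<Longrightarrow> \<exists>d>0. \<forall>u\<in>Y. norm (u - (x - X k)) < d \<longrightarrow>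
        sm u \<le> sm (x - X k) + blinfun_apply z (u - (x - X k)) + e * norm (u - (x - X k))"
      by metis
    then show "\<exists>z. norm z \<le> 1 \<and>
      (\<forall>e>0. \<exists>d>0. \<forall>u\<in>Y. norm (u - (x - X k)) < d \<longrightarrow>
        sm u \<le> sm (x - X k) + blinfun_apply z (u - (x - X k)) + e * norm (u - (x - X k)))" by blast
  qed
  then obtain z where z: "\<forall>k. norm (z k) \<le> 1 \<and> (\<forall>e>0. \<exists>d>0. \<forall>u\<in>Y. norm (u - (x - X k)) < d \<longrightarrow>
      sm u \<le> sm (x - X k) + blinfun_apply (z k) (u - (x - X k)) + e * norm (u - (x - X k)))"
    unfolding choice_iff ..
  define w where "w k = \<mu> k *\<^sub>R z k" for k
  have w_norm: "norm (w k) \<le> \<mu> k" for k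
    using z mu_pos[of k] by (simp add: w_def mult_left_le)
  have w_summable: "summable (\<lambda>k. norm (w k))"
    by (rule summable_comparison_test'[OF mu_summable, of 0]) (use w_norm in auto)
  have super: "\<exists>d>0. \<forall>u\<in>Y. norm (u - x) < d \<longrightarrow>
      (\<Sum>k. \<mu> k * sm (u - X k)) \<le> (\<Sum>k. \<mu> k * sm (x - X k)) + blinfun_apply (\<Sum>k. w k) (u - x) + \<eta> * norm (u - x)"
    if eta: "\<eta> > 0" for \<eta>
  proof (rule superdifferentiable_suminf[OF mu_summable _ w_norm summ _ eta])
    fix k u v
    have "\<mu> k * \<bar>sm (u - X k) - sm (v - X k)\<bar> \<le> \<mu> k * norm (u - v)"
      using sm_lipschitz[of "u - X k" "v - X k"] mu_pos[of k] by (intro mult_left_mono) auto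
    then show "\<bar>\<mu> k * sm (u - X k) - \<mu> k * sm (v - X k)\<bar> \<le> \<mu> k * norm (u - v)"
      using mu_pos[of k] by (simp add: right_diff_distrib[symmetric] abs_mult)
  next
    fix k and e' :: real assume "0 < e'"
    then have "e' / \<mu> k > 0" using mu_pos[of k] by simp
    then obtain d where d: "d > 0" "\<And>u. u \<in> Y \<Longrightarrow> norm (u - (x - X k)) < d \<Longrightarrow>
      sm u \<le> sm (x - X k) + blinfun_apply (z k) (u - (x - X k)) + e' / \<mu> k * norm (u - (x - X k))"
      using z by blast
    show "\<exists>d>0. \<forall>u\<in>Y. norm (u - x) < d \<longrightarrow>
      \<mu> k * sm (u - X k) \<le> \<mu> k * sm (x - X k) + blinfun_apply (w k) (u - x) + e' * norm (u - x)"
    proof (intro exI[of _ d] conjI ballI impI d(1))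
      fix u assume u: "u \<in> Y" "norm (u - x) < d"
      have "u - X k \<in> Y" using u(1) xY Y(2) by (simp add: subspace_diff)
      then have "sm (u - X k) \<le> sm (x - X k) + blinfun_apply (z k) (u - x) + e' / \<mu> k * norm (u - x)"
        using d(2)[of "u - X k"] u(2) by simp
      then have "\<mu> k * sm (u - X k) \<le> \<mu> k * (sm (x - X k) + blinfun_apply (z k) (u - x) + e' / \<mu> k * norm (u - x))"
        using mu_pos[of k] by (intro mult_left_mono) auto
      then show "\<mu> k * sm (u - X k) \<le> \<mu> k * sm (x - X k) + blinfun_apply (w k) (u - x) + e' * norm (u - x)"
        using mu_pos[of k] by (simp add: w_def blinfun.scaleR_left distrib_left)
    qed
  qed
  show thesis
  proof (rule that[of x "- (\<Sum>k. w k)"])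
    show "x \<in> A" "x \<in> closure D" using x(1) by (auto simp: B_iff Y_def)
    show "norm (x - xh) < e" using x_close m by simp
    have "norm (\<Sum>k. w k) \<le> (\<Sum>k. norm (w k))" by (rule summable_norm[OF w_summable])
    also have "\<dots> \<le> (\<Sum>k. \<mu> k)" by (rule suminf_le[OF w_norm w_summable mu_summable])
    finally show "norm (- (\<Sum>k. w k)) \<le> c + e" using sums_unique[OF mu_sums] by simp
    fix \<eta> :: real assume "0 < \<eta>"
    from super[OF this] obtain d where d: "d > 0" "\<And>u. u \<in> Y \<Longrightarrow> norm (u - x) < d \<Longrightarrow>
      (\<Sum>k. \<mu> k * sm (u - X k)) \<le> (\<Sum>k. \<mu> k * sm (x - X k)) + blinfun_apply (\<Sum>k. w k) (u - x) + \<eta> * norm (u - x)"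
      by blast
    show "\<exists>d>0. \<forall>u\<in>A \<inter> closure D. norm (u - x) < d \<longrightarrow>
      F x + blinfun_apply (- (\<Sum>k. w k)) (u - x) - \<eta> * norm (u - x) \<le> F u"
    proof (intro exI[of _ "min d (\<rho> - m)"] conjI ballI impI)
      show "min d (\<rho> - m) > 0" using d m by simp
      fix u assume u: "u \<in> A \<inter> closure D" "norm (u - x) < min d (\<rho> - m)"
      have "norm (u - xh) \<le> norm (u - x) + norm (x - xh)"
        using norm_triangle_ineq[of "u - x" "x - xh"] by simp
      then have "u \<in> B" using u x_close by (simp add: B_iff Y_def)
      from xmin[OF this] d(2)[of u] u
      show "F x + blinfun_apply (- (\<Sum>k. w k)) (u - x) - \<eta> * norm (u - x) \<le> F u"
        by (simp add: Y_def blinfun.minus_left)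
    qed
  qed
qed

text \<open>\<open>D\<close> has to be fixed before the point \<open>x\<close> and the radii
  \<delta> are known. The reduction is uniform in both, so the inequalities verified inside
  \<open>closure D\<close> extend to all of \<open>A\<close> with the same \<delta>.\<close>

theorem asplund_subgradient:
  fixes F :: "'a::banach \<Rightarrow> real"
  assumes asp: "asplund TYPE('a)" and xh: "xh \<in> A"
    and epi: "closed {(u, r). u \<in> A \<and> F u \<le> r}"
    and c: "0 \<le> c" and rho: "0 < \<rho>"
    and min: "\<And>u. u \<in> A \<Longrightarrow> norm (u - xh) \<le> \<rho> \<Longrightarrow> F xh \<le> F u + c * norm (u - xh)"
    and e: "0 < e"
  obtains x and z :: "'a \<Rightarrow>\<^sub>L real" where "x \<in> A" "norm (x - xh) < e" "norm z \<le> c + e"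
    "\<And>\<eta>. 0 < \<eta> \<Longrightarrow> \<exists>d>0. \<forall>u\<in>A. norm (u - x) < d \<longrightarrow>
      F x + blinfun_apply z (u - x) - \<eta> * norm (u - x) \<le> F u"
proof (rule separable_reduction[where c = "c + e" and ?x0.0 = xh and A = A and F = F])
  show ce: "0 \<le> c + e" using c e by simp
  fix D assume D: "countable D" "xh \<in> D" "subspace (closure D)"
    and red: "\<And>x r \<delta> k l u n. x \<in> closure D \<Longrightarrow>
      (\<And>k l u n. (\<And>i. i < k \<Longrightarrow> 0 \<le> l i \<and> u i \<in> A \<and> u i \<in> closure D \<and> norm (u i - x) < \<delta> (n i)) \<Longrightarrow>
         sum l {..<k} = 1 \<Longrightarrow> r \<le> hull_value F (c + e) x k l u n) \<Longrightarrow>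
      (\<And>i. i < k \<Longrightarrow> 0 \<le> l i \<and> u i \<in> A \<and> norm (u i - x) < \<delta> (n i)) \<Longrightarrow>
      sum l {..<k} = 1 \<Longrightarrow> r \<le> hull_value F (c + e) x k l u n"
  have xhD: "xh \<in> closure D" using D(2) closure_subset by blast
  obtain x and y :: "'a \<Rightarrow>\<^sub>L real" where x: "x \<in> A" "x \<in> closure D" "norm (x - xh) < e" and y: "norm y \<le> c + e"
    "\<And>\<eta>. 0 < \<eta> \<Longrightarrow> \<exists>d>0. \<forall>u\<in>A \<inter> closure D. norm (u - x) < d \<longrightarrow>
      F x + blinfun_apply y (u - x) - \<eta> * norm (u - x) \<le> F u"
    using local_subgradient_in_subspace[OF asp D(1,3) xh xhD epi c rho min e] by blast
  have "\<forall>n. \<exists>d>0. \<forall>u\<in>A \<inter> closure D. norm (u - x) < d \<longrightarrow>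
      F x + blinfun_apply y (u - x) - inverse (real (Suc n)) * norm (u - x) \<le> F u"
    by (intro allI y) simp
  then obtain \<delta> where \<delta>: "\<forall>n. \<delta> n > 0 \<and> (\<forall>u\<in>A \<inter> closure D. norm (u - x) < \<delta> n \<longrightarrow>
      F x + blinfun_apply y (u - x) - inverse (real (Suc n)) * norm (u - x) \<le> F u)"
    unfolding choice_iff ..
  have hull_Y: "F x \<le> hull_value F (c + e) x k l u n"
    if "\<And>i. i < k \<Longrightarrow> 0 \<le> l i \<and> u i \<in> A \<and> u i \<in> closure D \<and> norm (u i - x) < \<delta> (n i)" "sum l {..<k} = 1"
    for k l u n
  proof (rule weights_hull_le[OF y(1) _ that(2)])
    fix i assume i: "i < k"
    show "0 \<le> l i" using that(1)[OF i] by simp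
    have "F x + blinfun_apply y (u i - x) - inverse (real (Suc (n i))) * norm (u i - x) \<le> F (u i)"
      using \<delta> that(1)[OF i] by blast
    then show "F x + blinfun_apply y (u i - x) \<le> F (u i) + norm (u i - x) / real (Suc (n i))"
      by (simp add: divide_inverse mult.commute)
  qed
  have hull_X: "F x \<le> hull_value F (c + e) x k l u n"
    if "\<And>i. i < k \<Longrightarrow> 0 \<le> l i \<and> u i \<in> A \<and> norm (u i - x) < \<delta> (n i)" "sum l {..<k} = 1" for k l u n
  proof (rule red[where \<delta> = \<delta>, OF x(2) _ that])
    fix k :: nat and l :: "nat \<Rightarrow> real" and u and n :: "nat \<Rightarrow> nat"
    assume "\<And>i. i < k \<Longrightarrow> 0 \<le> l i \<and> u i \<in> A \<and> u i \<in> closure D \<and> norm (u i - x) < \<delta> (n i)"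
      "sum l {..<k} = 1"
    then show "F x \<le> hull_value F (c + e) x k l u n" by (rule hull_Y)
  qed
  obtain z :: "'a \<Rightarrow>\<^sub>L real" where z: "norm z \<le> c + e"
    "\<And>u n. u \<in> A \<Longrightarrow> norm (u - x) < \<delta> n \<Longrightarrow> F x + blinfun_apply z (u - x) \<le> F u + norm (u - x) / Suc n"
    using functional_from_hull[where \<delta> = \<delta>, OF ce hull_X] by blast
  show thesis
  proof (rule that[OF x(1,3) z(1)])
    fix \<eta> :: real assume "0 < \<eta>"
    then obtain n where n: "inverse (real (Suc n)) < \<eta>" using reals_Archimedean by blast
    show "\<exists>d>0. \<forall>u\<in>A. norm (u - x) < d \<longrightarrow> F x + blinfun_apply z (u - x) - \<eta> * norm (u - x) \<le> F u"
    proof (intro exI[of _ "\<delta> n"] conjI ballI impI)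
      show "\<delta> n > 0" using \<delta> by blast
      fix u assume "u \<in> A" "norm (u - x) < \<delta> n"
      moreover have "norm (u - x) / Suc n \<le> \<eta> * norm (u - x)"
        using n mult_right_mono[of "inverse (real (Suc n))" \<eta> "norm (u - x)"] by (simp add: divide_inverse mult.commute)
      ultimately show "F x + blinfun_apply z (u - x) - \<eta> * norm (u - x) \<le> F u" using z(2) by force
    qed
  qed
qed

section \<open>Extended-real-valued functions and their Frechet subdifferentials\<close>

lemma lsc_eventually:
  assumes "lsc f" "a < f x"
  shows "eventually (\<lambda>u. a < f u) (nhds x)"
proof -
  have "eventually (\<lambda>u. a < f u) (at x)"
    using assms unfolding lsc_def le_Liminf_iff by blast
  then show ?thesis using assms(2) by (auto simp: eventually_at_filter elim: eventually_mono)
qed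

text \<open>The tangent inequality of the concave power at \<open>p\<close>, cleared of
  \<open>p powr (q - 1)\<close>. It converts decrease rates of \<open>f^q\<close> into decrease
  rates of \<open>f\<close>.\<close>

lemma powr_tangent_le:
  fixes t p q :: real
  assumes "0 < t" "0 < p" "0 < q" "q \<le> 1"
  shows "q * (p - t) \<le> p powr (1 - q) * (p powr q - t powr q)"
proof -
  have "t powr q * p powr (1 - q) \<le> q * t + (1 - q) * p"
    using assms by (intro Youngs_inequality_0) auto
  moreover have "p powr (1 - q) * p powr q = p" using assms by (simp add: powr_add[symmetric])
  ultimately show ?thesis by (simp add: algebra_simps)
qed

locale lsc_function =
  fixes f :: "'a::banach \<Rightarrow> ereal"
  assumes noninf: "f x \<noteq> -\<infinity>" and lsc: "lsc f"
begin

definition dom :: "'a set" where "dom = {x. f x < \<infinity>}"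

text \<open>Off \<open>dom\<close> this takes the default value 0, so estimates for
  \<open>val\<close> always carry membership in \<open>dom\<close>.\<close>

definition val :: "'a \<Rightarrow> real" where "val x = real_of_ereal (f x)"

lemma f_val: "x \<in> dom \<Longrightarrow> f x = ereal (val x)"
  using noninf[of x] unfolding dom_def val_def by (cases "f x") auto

lemma f_top: "x \<notin> dom \<Longrightarrow> f x = \<infinity>"
  by (simp add: dom_def)

lemma epigraph_closed: "closed {(u, r). u \<in> dom \<and> val u \<le> r}"
proof -
  have iff: "u \<in> dom \<and> val u \<le> r \<longleftrightarrow> f u \<le> ereal r" for u r
  proof (cases "u \<in> dom")
    case True then show ?thesis using f_val[OF True] by simp
  next
    case False then show ?thesis using f_top[OF False] by simp
  qed
  show ?thesis
    unfolding iff closed_sequential_limits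
  proof (intro allI impI, elim conjE)
    fix X and l :: "'a \<times> real"
    assume X: "\<forall>n. X n \<in> {(u, r). f u \<le> ereal r}" "X \<longlonglongrightarrow> l"
    have "f (fst l) \<le> ereal (snd l)"
    proof (rule ccontr)
      assume "\<not> ?thesis"
      then have "ereal (snd l) < f (fst l)" by simp
      then obtain s where s: "ereal (snd l) < ereal s" "ereal s < f (fst l)"
        using ereal_dense2 by blast
      have "eventually (\<lambda>n. ereal s < f (fst (X n))) sequentially"
        using lsc_eventually[OF lsc s(2)] tendsto_fst[OF X(2)] by (auto simp: filterlim_iff)
      moreover have "eventually (\<lambda>n. snd (X n) < s) sequentially"
        using order_tendstoD(2)[OF tendsto_snd[OF X(2)]] s(1) by simp
      ultimately have "eventually (\<lambda>n. False) sequentially"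
      proof eventually_elim
        case (elim n)
        have "f (fst (X n)) \<le> ereal (snd (X n))" using X(1)[rule_format, of n] by (auto simp: case_prod_beta)
        with elim show False by (metis less_ereal.simps(1) not_less_iff_gr_or_eq order_less_le_trans order_less_trans)
      qed
      then show False by simp
    qed
    then show "l \<in> {(u, r). f u \<le> ereal r}" by (simp add: case_prod_beta)
  qed
qed

text \<open>For \<open>r \<ge> 0\<close> the constraint amounts to
  \<open>val u \<le> r powr (1/q)\<close>, which reduces closedness to the epigraph of
  \<open>val\<close>.\<close>

lemma epigraph_powr_closed:
  assumes q: "0 < q"
  shows "closed {(u, r). u \<in> dom \<and> max (val u) 0 powr q \<le> r}"
  unfolding closed_sequential_limits
proof (intro allI impI, elim conjE)
  fix X and l :: "'a \<times> real"
  assume X: "\<forall>n. X n \<in> {(u, r). u \<in> dom \<and> max (val u) 0 powr q \<le> r}" "X \<longlonglongrightarrow> l"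
  have Xn: "fst (X n) \<in> dom" "max (val (fst (X n))) 0 powr q \<le> snd (X n)" for n
    using X(1)[rule_format, of n] by (auto simp: case_prod_beta)
  have nonneg: "0 \<le> snd (X n)" for n using Xn(2)[of n] powr_ge_zero order_trans by blast
  have lim: "(\<lambda>n. snd (X n)) \<longlonglongrightarrow> snd l" by (rule tendsto_snd[OF X(2)])
  have l_nonneg: "0 \<le> snd l" by (rule LIMSEQ_le_const[OF lim]) (use nonneg in auto)
  have "fst l \<in> dom \<and> val (fst l) \<le> snd l powr (1/q)"
  proof (rule closed_epigraph_limit[OF epigraph_closed Xn(1)])
    show "(\<lambda>n. fst (X n)) \<longlonglongrightarrow> fst l" by (rule tendsto_fst[OF X(2)])
    show "(\<lambda>n. snd (X n) powr (1/q)) \<longlonglongrightarrow> snd l powr (1/q)"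
      using q nonneg by (intro tendsto_powr2 lim tendsto_const) auto
    show "val (fst (X n)) \<le> snd (X n) powr (1/q)" for n
    proof -
      have "val (fst (X n)) \<le> (max (val (fst (X n))) 0 powr q) powr (1/q)"
        using q by (simp add: powr_powr)
      also have "\<dots> \<le> snd (X n) powr (1/q)" using Xn(2) q by (intro powr_mono2) auto
      finally show ?thesis .
    qed
  qed
  moreover have "max (val (fst l)) 0 powr q \<le> snd l" if "val (fst l) \<le> snd l powr (1/q)"
  proof -
    have "max (val (fst l)) 0 powr q \<le> (snd l powr (1/q)) powr q"
      using that q by (intro powr_mono2) auto
    also have "\<dots> = snd l" using q l_nonneg by (simp add: powr_powr)
    finally show ?thesis .
  qed
  ultimately show "l \<in> {(u, r). u \<in> dom \<and> max (val u) 0 powr q \<le> r}" by (simp add: case_prod_beta)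
qed

lemma frechet_subdiffI:
  assumes x: "x \<in> dom"
    and sub: "\<And>\<eta>. 0 < \<eta> \<Longrightarrow> \<exists>d>0. \<forall>u\<in>dom. norm (u - x) < d \<longrightarrow>
      val x + blinfun_apply z (u - x) - \<eta> * norm (u - x) \<le> val u"
  shows "z \<in> frechet_subdiff f x"
proof -
  have "0 \<le> Liminf (at x) (\<lambda>y. (f y - f x - ereal (blinfun_apply z (y - x))) / ereal (norm (y - x)))"
    unfolding le_Liminf_iff
  proof (intro allI impI)
    fix b :: ereal assume "b < 0"
    then obtain s where s: "b < ereal s" "ereal s < 0" using ereal_dense2 by blast
    then obtain d where d: "d > 0" "\<And>u. u \<in> dom \<Longrightarrow> norm (u - x) < d \<Longrightarrow>
      val x + blinfun_apply z (u - x) - (- s) * norm (u - x) \<le> val u"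
      using sub[of "- s"] by auto
    have "b < (f u - f x - ereal (blinfun_apply z (u - x))) / ereal (norm (u - x))"
      if u: "u \<noteq> x" "norm (u - x) < d" for u
    proof (cases "u \<in> dom")
      case True
      have n: "norm (u - x) > 0" using u by simp
      have "s * norm (u - x) \<le> val u - val x - blinfun_apply z (u - x)" using d(2)[OF True u(2)] by simp
      then have "s \<le> (val u - val x - blinfun_apply z (u - x)) / norm (u - x)"
        using n by (simp add: pos_le_divide_eq)
      then have "ereal s \<le> (f u - f x - ereal (blinfun_apply z (u - x))) / ereal (norm (u - x))"
        using n f_val[OF True] f_val[OF x] by simp
      with s(1) show ?thesis by (rule less_le_trans)
    next
      case False
      then have "(f u - f x - ereal (blinfun_apply z (u - x))) / ereal (norm (u - x)) = \<infinity>"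
        using f_val[OF x] f_top u by simp
      moreover have "b < \<infinity>" using s(1) by (rule less_le_trans) simp
      ultimately show ?thesis by simp
    qed
    then show "eventually (\<lambda>u. b < (f u - f x - ereal (blinfun_apply z (u - x))) / ereal (norm (u - x))) (at x)"
      using d(1) unfolding eventually_at dist_norm by blast
  qed
  moreover have "f x < \<infinity>" using x by (simp add: dom_def)
  ultimately show ?thesis by (simp add: frechet_subdiff_def)
qed

lemma dsub_le:
  assumes "x \<in> dom" "norm z \<le> c"
    "\<And>\<eta>. 0 < \<eta> \<Longrightarrow> \<exists>d>0. \<forall>u\<in>dom. norm (u - x) < d \<longrightarrow>
      val x + blinfun_apply z (u - x) - \<eta> * norm (u - x) \<le> val u"
  shows "dsub f x \<le> ereal c"
proof -
  have "dsub f x \<le> ereal (norm z)"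
    unfolding dsub_def by (intro INF_lower frechet_subdiffI assms)
  then show ?thesis using assms(2) by (meson ereal_less_eq(3) order_trans)
qed

lemma dsub_nonneg: "0 \<le> dsub f x"
  unfolding dsub_def by (rule INF_greatest) simp

lemma convex_val:
  assumes "ereal_convex f" "u \<in> dom" "v \<in> dom" "0 \<le> t" "t \<le> 1"
  shows "t *\<^sub>R u + (1 - t) *\<^sub>R v \<in> dom \<and> val (t *\<^sub>R u + (1 - t) *\<^sub>R v) \<le> t * val u + (1 - t) * val v"
proof (cases "t = 0 \<or> t = 1")
  case True then show ?thesis using assms by auto
next
  case False
  then have "0 < t \<and> t < 1" using assms(4,5) by auto
  then have "f (t *\<^sub>R u + (1 - t) *\<^sub>R v) \<le> ereal t * f u + ereal (1 - t) * f v"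
    using assms(1) unfolding ereal_convex_def by blast
  also have "\<dots> = ereal (t * val u + (1 - t) * val v)" using f_val assms by simp
  finally have le: "f (t *\<^sub>R u + (1 - t) *\<^sub>R v) \<le> ereal (t * val u + (1 - t) * val v)" .
  then have "t *\<^sub>R u + (1 - t) *\<^sub>R v \<in> dom" by (auto simp: dom_def intro: order_le_less_trans)
  then show ?thesis using le f_val by simp
qed

text \<open>Convexity makes the local minimum of \<open>val u + c * norm (u - xh)\<close> global,
  and Hahn-Banach separates the translated epigraph from the cone of slope \<open>c\<close>.\<close>

lemma convex_subgradient:
  assumes cvx: "ereal_convex f" and xh: "xh \<in> dom" and c: "0 \<le> c" and rho: "0 < \<rho>"
    and min: "\<And>u. u \<in> dom \<Longrightarrow> norm (u - xh) \<le> \<rho> \<Longrightarrow> val xh \<le> val u + c * norm (u - xh)"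
  shows "dsub f xh \<le> ereal c"
proof -
  have global: "val xh \<le> val u + c * norm (u - xh)" if u: "u \<in> dom" for u
  proof -
    \<comment> \<open>The summand 1 keeps the quotient defined at \<open>u = xh\<close>.\<close>
    define t where "t = min 1 (\<rho> / (1 + norm (u - xh)))"
    have t: "0 < t" "t \<le> 1" using rho by (auto simp: t_def add_pos_nonneg)
    have "t * norm (u - xh) \<le> \<rho> / (1 + norm (u - xh)) * norm (u - xh)"
      by (intro mult_right_mono) (auto simp: t_def)
    also have "\<dots> \<le> \<rho>" using rho by (simp add: divide_le_eq add_pos_nonneg)
    finally have tn: "t * norm (u - xh) \<le> \<rho>" .
    define v where "v = t *\<^sub>R u + (1 - t) *\<^sub>R xh"
    have "v - xh = t *\<^sub>R (u - xh)" by (simp add: v_def algebra_simps)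
    then have vn: "norm (v - xh) = t * norm (u - xh)" using t by simp
    have v: "v \<in> dom" "val v \<le> t * val u + (1 - t) * val xh"
      using convex_val[OF cvx u xh] t unfolding v_def by auto
    have "val xh \<le> val v + c * norm (v - xh)" using v tn vn by (intro min) auto
    then have "t * val xh \<le> t * (val u + c * norm (u - xh))"
      using v(2) vn by (simp add: algebra_simps)
    then show ?thesis using t by simp
  qed
  define C where "C = {(h, a). xh + h \<in> dom \<and> val (xh + h) \<le> a + val xh}"
  have "convex C"
  proof (rule convexI)
    fix x y :: "'a \<times> real" and s t :: real
    assume xy: "x \<in> C" "y \<in> C" and st: "0 \<le> s" "0 \<le> t" "s + t = 1"
    have t: "t = 1 - s" using st by simp
    have eq: "xh + (s *\<^sub>R fst x + (1 - s) *\<^sub>R fst y) = s *\<^sub>R (xh + fst x) + (1 - s) *\<^sub>R (xh + fst y)"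
      by (simp add: algebra_simps)
    have "s * val (xh + fst x) + (1 - s) * val (xh + fst y)
        \<le> s * (snd x + val xh) + (1 - s) * (snd y + val xh)"
      using xy st by (intro add_mono mult_left_mono) (auto simp: C_def)
    then show "s *\<^sub>R x + t *\<^sub>R y \<in> C"
      using convex_val[OF cvx, of "xh + fst x" "xh + fst y" s] xy st
      by (simp add: C_def case_prod_beta t eq algebra_simps)
  qed
  moreover have "- (c * norm h) \<le> a" if "(h, a) \<in> C" for h a
    using global[of "xh + h"] that by (simp add: C_def)
  ultimately obtain z :: "'a \<Rightarrow>\<^sub>L real" where z: "norm z \<le> c" "\<And>h a. (h, a) \<in> C \<Longrightarrow> blinfun_apply z h \<le> a"
    using Hahn_Banach_blinfun[OF _ c, of C] by metis
  show ?thesis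
  proof (rule dsub_le[OF xh z(1)])
    fix \<eta> :: real assume \<eta>: "0 < \<eta>"
    have "val xh + blinfun_apply z (u - xh) - \<eta> * norm (u - xh) \<le> val u" if "u \<in> dom" for u
    proof -
      have "(u - xh, val u - val xh) \<in> C" using that by (simp add: C_def)
      then have "blinfun_apply z (u - xh) \<le> val u - val xh" by (rule z(2))
      moreover have "0 \<le> \<eta> * norm (u - xh)" using \<eta> by simp
      ultimately show ?thesis by linarith
    qed
    then show "\<exists>d>0. \<forall>u\<in>dom. norm (u - xh) < d \<longrightarrow>
      val xh + blinfun_apply z (u - xh) - \<eta> * norm (u - xh) \<le> val u"
      by (intro exI[of _ 1]) auto
  qed
qed

lemma subgradient_near_local_min:
  assumes acv: "asplund TYPE('a) \<or> ereal_convex f" and xh: "xh \<in> dom" and c: "0 \<le> c" and rho: "0 < \<rho>"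
    and min: "\<And>u. u \<in> dom \<Longrightarrow> norm (u - xh) \<le> \<rho> \<Longrightarrow> val xh \<le> val u + c * norm (u - xh)"
    and e: "0 < e"
  obtains x where "x \<in> dom" "norm (x - xh) < e" "dsub f x \<le> ereal (c + e)"
proof (cases "ereal_convex f")
  case True
  have "dsub f xh \<le> ereal c" by (rule convex_subgradient[OF True xh c rho min])
  also have "\<dots> \<le> ereal (c + e)" using e by simp
  finally show thesis using that[of xh] xh e by simp
next
  case False
  then have asp: "asplund TYPE('a)" using acv by simp
  obtain x and z :: "'a \<Rightarrow>\<^sub>L real" where "x \<in> dom" "norm (x - xh) < e" "norm z \<le> c + e"
    "\<And>\<eta>. 0 < \<eta> \<Longrightarrow> \<exists>d>0. \<forall>u\<in>dom. norm (u - x) < d \<longrightarrow>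
      val x + blinfun_apply z (u - x) - \<eta> * norm (u - x) \<le> val u"
    using asplund_subgradient[OF asp xh epigraph_closed c rho min e] by blast
  then show thesis using that dsub_le by blast
qed

end

section \<open>Error bounds\<close>

lemma pow0_pos: "0 < a \<Longrightarrow> pow0 a p = a powr p" by (simp add: pow0_def)

lemma eventually_at_right_less:
  fixes H :: "real \<Rightarrow> real"
  assumes "isCont H 0" "H 0 < b" "0 < m"
  obtains s where "0 < s" "s < m" "H s < b"
proof -
  have "eventually (\<lambda>s. H s < b) (at_right 0)"
    using order_tendstoD(2)[OF assms(1)[unfolded isCont_def] assms(2)] by (rule eventually_at_split[THEN iffD1, THEN conjunct2])
  moreover have "eventually (\<lambda>s. s \<in> {0<..<m}) (at_right 0)"
    using assms(3) by (rule eventually_at_right_real)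
  ultimately have "eventually (\<lambda>s. 0 < s \<and> s < m \<and> H s < b) (at_right 0)"
    by eventually_elim simp
  then obtain s where "0 < s \<and> s < m \<and> H s < b"
    using eventually_happens' trivial_limit_at_right_real by blast
  then show thesis using that by blast
qed

locale error_bound = lsc_function f for f :: "'a::banach \<Rightarrow> ereal" +
  fixes xb :: 'a and \<tau> q :: real
  assumes xb: "xb \<in> sublevel f" and acv: "asplund TYPE('a) \<or> ereal_convex f"
    and tau: "\<tau> > 0" and q: "0 < q" "q \<le> 1"
begin

abbreviation "S \<equiv> sublevel f"

abbreviation "dd x \<equiv> infdist x S"

lemma S_iff: "x \<in> S \<longleftrightarrow> x \<in> dom \<and> val x \<le> 0"
proof (cases "x \<in> dom")
  case True then show ?thesis using f_val[OF True] by (simp add: sublevel_def)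
next
  case False then show ?thesis using f_top[OF False] by (simp add: sublevel_def)
qed

lemma pos_iff: "0 < f x \<longleftrightarrow> x \<notin> S" by (auto simp: sublevel_def)

lemma closed_S: "closed S"
proof -
  have "S = (\<lambda>x. (x, 0 :: real)) -` {(u, r). u \<in> dom \<and> val u \<le> r}" using S_iff by auto
  moreover have "closed ((\<lambda>x :: 'a. (x, 0 :: real)) -` {(u, r). u \<in> dom \<and> val u \<le> r})"
    by (intro closed_vimage epigraph_closed continuous_intros)
  ultimately show ?thesis by simp
qed

lemma dd_pos: "x \<notin> S \<Longrightarrow> 0 < dd x"
  using infdist_pos_not_in_closed[OF closed_S] xb by blast

lemma edist_S: "edist x S = ereal (dd x)"
proof -
  have "ereal (Inf ((\<lambda>a. norm (x - a)) ` S)) = (INF a\<in>S. ereal (norm (x - a)))"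
  proof -
    have "bdd_below ((\<lambda>a. norm (x - a)) ` S)" by (auto intro!: bdd_belowI[of _ 0])
    moreover have "(\<lambda>a. norm (x - a)) ` S \<noteq> {}" using xb by blast
    ultimately show ?thesis by (simp add: ereal_Inf' image_comp)
  qed
  then show ?thesis using xb by (auto simp: edist_def infdist_def dist_norm)
qed

lemma cond_iI:
  assumes "open U" "xb \<in> U" "\<And>x. x \<in> U \<Longrightarrow> x \<in> dom \<Longrightarrow> 0 < val x \<Longrightarrow> \<tau> * dd x \<le> val x powr q"
  shows "cond_i f xb \<tau> q"
  unfolding cond_i_def
proof (intro exI[of _ U] conjI ballI assms(1,2))
  fix x assume x: "x \<in> U"
  show "ereal \<tau> * edist x S \<le> epow (max (f x) 0) q"
  proof (cases "x \<in> dom")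
    case False
    then show ?thesis using f_top q by (simp add: epow_def)
  next
    case True
    show ?thesis
    proof (cases "0 < val x")
      case pos: True
      then show ?thesis using assms(3)[OF x True pos] f_val[OF True]
        by (simp add: edist_S epow_def pow0_def max_def)
    next
      case False
      then have "x \<in> S" using S_iff True by simp
      then have "dd x = 0" by simp
      moreover have "max (f x) 0 = 0" using f_val[OF True] False by (simp add: max_def)
      ultimately show ?thesis using q by (simp add: edist_S epow_def pow0_def)
    qed
  qed
qed

lemma cond_iD:
  assumes "cond_i f xb \<tau> q"
  obtains U where "open U" "xb \<in> U" "\<And>x. x \<in> U \<Longrightarrow> x \<in> dom \<Longrightarrow> 0 < val x \<Longrightarrow> \<tau> * dd x \<le> val x powr q"
proof -
  obtain U where U: "open U" "xb \<in> U" "\<And>x. x \<in> U \<Longrightarrow> ereal \<tau> * edist x S \<le> epow (max (f x) 0) q"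
    using assms unfolding cond_i_def by blast
  have "\<tau> * dd x \<le> val x powr q" if "x \<in> U" "x \<in> dom" "0 < val x" for x
    using U(3)[OF that(1)] f_val[OF that(2)] that(3) by (simp add: edist_S epow_def pow0_def max_def)
  then show thesis using that U by blast
qed

text \<open>Phrased with an upper bound \<open>s\<close> for \<open>dsub\<close>, which is what the
  subgradient construction delivers.\<close>

lemma cond_iiD:
  assumes "cond_ii f xb \<tau> q"
  obtains U where "open U" "xb \<in> U"
    "\<And>x s. x \<in> U \<Longrightarrow> x \<in> dom \<Longrightarrow> 0 < val x \<Longrightarrow> dsub f x \<le> ereal s \<Longrightarrow> \<tau> \<le> q * val x powr (q - 1) * s"
proof -
  obtain U where U: "open U" "xb \<in> U" "\<And>x. x \<in> U \<Longrightarrow> 0 < f x \<and> f x < \<infinity> \<Longrightarrow>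
      ereal \<tau> \<le> ereal (q * pow0 (real_of_ereal (f x)) (q - 1)) * dsub f x"
    using assms unfolding cond_ii_def by blast
  have "\<tau> \<le> q * val x powr (q - 1) * s"
    if x: "x \<in> U" "x \<in> dom" "0 < val x" "dsub f x \<le> ereal s" for x s
  proof -
    have "ereal \<tau> \<le> ereal (q * val x powr (q - 1)) * dsub f x"
      using U(3)[OF x(1)] f_val[OF x(2)] x(3) by (simp add: pow0_def)
    also have "\<dots> \<le> ereal (q * val x powr (q - 1)) * ereal s"
      using q by (intro ereal_mult_left_mono x(4)) simp
    finally show ?thesis by simp
  qed
  then show thesis using that U by blast
qed

definition const :: real where "const = pow0 q q * pow0 (1 - q) (1 - q)"

lemma const_pos: "0 < const"
  using q by (auto simp: const_def pow0_def)

lemma cond_iiiD: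
  assumes "cond_iii f xb \<tau> q"
  obtains U where "open U" "xb \<in> U"
    "\<And>x s. x \<in> U \<Longrightarrow> x \<notin> S \<Longrightarrow> 0 < s \<Longrightarrow> dsub f x \<le> ereal s \<Longrightarrow>
      \<tau> \<le> const * dd x powr (q - 1) * s powr q"
proof -
  obtain U where U: "open U" "xb \<in> U" "\<And>x. x \<in> U \<Longrightarrow> 0 < f x \<Longrightarrow>
      ereal \<tau> \<le> ereal const * epow (edist x S) (q - 1) * epow (dsub f x) q"
    using assms unfolding cond_iii_def const_def by blast
  have "\<tau> \<le> const * dd x powr (q - 1) * s powr q"
    if x: "x \<in> U" "x \<notin> S" "0 < s" "dsub f x \<le> ereal s" for x s
  proof -
    obtain t where t: "dsub f x = ereal t" "0 \<le> t" "t \<le> s"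
      using dsub_nonneg[of x] x(4) by (cases "dsub f x") auto
    have "pow0 t q \<le> s powr q" using t x(3) q by (auto simp: pow0_def intro!: powr_mono2)
    moreover have "\<tau> \<le> const * dd x powr (q - 1) * pow0 t q"
      using U(3)[OF x(1)] x(2) dd_pos[OF x(2)] t by (simp add: pos_iff edist_S epow_def pow0_def)
    moreover have "0 \<le> const * dd x powr (q - 1)" using const_pos by simp
    ultimately show ?thesis by (meson mult_left_mono order_trans)
  qed
  then show thesis using that U by blast
qed

lemma not_in_S_if_close: "norm (x - x0) < dd x0 \<Longrightarrow> x \<notin> S"
  using infdist_le[of x S x0] by (auto simp: dist_norm norm_minus_commute)

text \<open>Since \<open>xb\<close> is in the sublevel set, \<open>dd x0\<close> is at most the
  distance from \<open>x0\<close> to \<open>xb\<close>; hence the halved radius in both error bound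
  proofs.\<close>

lemma close_to_xb:
  assumes "norm (x - x0) \<le> dd x0" "norm (x0 - xb) < r / 2"
  shows "norm (x - xb) < r"
proof -
  have "dd x0 \<le> norm (x0 - xb)" using infdist_le[OF xb, of x0] by (simp add: dist_norm)
  then show ?thesis using norm_triangle_ineq[of "x - x0" "x0 - xb"] assms by simp
qed

lemma val_lsc:
  assumes "xh \<in> dom" "a < val xh"
  obtains d where "0 < d" "\<And>u. u \<in> dom \<Longrightarrow> norm (u - xh) < d \<Longrightarrow> a < val u"
proof -
  have "eventually (\<lambda>u. ereal a < f u) (nhds xh)"
    using assms f_val by (intro lsc_eventually lsc) simp
  then obtain d where "0 < d" "\<And>u. norm (u - xh) < d \<Longrightarrow> ereal a < f u"
    unfolding eventually_nhds_metric dist_norm by blast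
  then show thesis using that f_val by (metis less_ereal.simps(1))
qed

theorem ii_imp_i:
  assumes "cond_ii f xb \<tau> q"
  shows "cond_i f xb \<tau> q"
proof -
  obtain U where U: "open U" "xb \<in> U"
    "\<And>x s. x \<in> U \<Longrightarrow> x \<in> dom \<Longrightarrow> 0 < val x \<Longrightarrow> dsub f x \<le> ereal s \<Longrightarrow> \<tau> \<le> q * val x powr (q - 1) * s"
    using cond_iiD[OF assms] by metis
  obtain r where r: "r > 0" "\<And>x. norm (x - xb) < r \<Longrightarrow> x \<in> U"
    using U(1,2) unfolding open_dist dist_norm by blast
  show ?thesis
  proof (rule cond_iI)
    show "open (ball xb (r / 2))" "xb \<in> ball xb (r / 2)" using r by auto
    fix x0 assume x0: "x0 \<in> ball xb (r / 2)" "x0 \<in> dom" "0 < val x0"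
    show "\<tau> * dd x0 \<le> val x0 powr q"
    proof (rule ccontr)
      assume neg: "\<not> ?thesis"
      define m where "m = val x0 powr q"
      have "x0 \<notin> S" using x0 S_iff by simp
      then have d0: "0 < dd x0" by (rule dd_pos)
      have m: "0 < m" using x0 by (simp add: m_def)
      have "m / dd x0 < \<tau>" using neg d0 by (simp add: m_def pos_divide_less_eq)
      \<comment> \<open>Room on both sides of \<sigma>: the lower inequality keeps the Ekeland point
        off the sublevel set, the upper one absorbs the later perturbation.\<close>
      then obtain \<sigma> where \<sigma>: "m / dd x0 < \<sigma>" "\<sigma> < \<tau>" using dense by blast
      then have \<sigma>0: "0 < \<sigma>" using m d0 by (meson divide_pos_pos less_trans)
      define G where "G u = max (val u) 0 powr q" for u
      have epi: "closed {(u, r). u \<in> dom \<and> G u \<le> r}"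
        unfolding G_def using q by (intro epigraph_powr_closed)
      have G0: "0 \<le> G u" for u by (simp add: G_def)
      obtain xh where xh: "xh \<in> dom" "G xh + \<sigma> * norm (xh - x0) \<le> G x0"
        "\<And>u. u \<in> dom \<Longrightarrow> G xh \<le> G u + \<sigma> * norm (u - xh)"
        using Ekeland[OF epi x0(2) G0 \<sigma>0] by blast
      have "G x0 = m" using x0 by (simp add: G_def m_def)
      then have "\<sigma> * norm (xh - x0) \<le> m" using xh(2) G0[of xh] by linarith
      also have "m < \<sigma> * dd x0" using \<sigma>(1) d0 by (simp add: pos_divide_less_eq)
      finally have close: "norm (xh - x0) < dd x0" using \<sigma>0 by simp
      define p where "p = val xh"
      have "xh \<notin> S" by (rule not_in_S_if_close[OF close])
      then have p: "0 < p" using S_iff xh(1) by (simp add: p_def)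
      have Gxh: "G xh = p powr q" using p by (simp add: G_def p_def)
      have "norm (xh - xb) < r"
        using close_to_xb[of xh x0 r] close x0(1) by (simp add: dist_norm norm_minus_commute)
      then obtain r' where r': "r' > 0" "\<And>x. norm (x - xh) < r' \<Longrightarrow> x \<in> U"
        using r(2) U(1) unfolding open_dist dist_norm by blast
      \<comment> \<open>The slope of \<open>f\<close> at value \<open>p\<close> corresponding to
        slope \<sigma> of \<open>f^q\<close>.\<close>
      define c where "c = \<sigma> / q * p powr (1 - q)"
      have c: "0 \<le> c" using \<sigma>0 q by (simp add: c_def)
      \<comment> \<open>Within this radius \<open>G\<close> stays at least half of its value at
        \<open>xh\<close>, so \<open>f\<close> stays positive there and equals its positive
        part.\<close>
      define \<rho> where "\<rho> = p powr q / (2 * \<sigma>)"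
      have \<rho>: "0 < \<rho>" using p \<sigma>0 by (simp add: \<rho>_def)
      have min: "val xh \<le> val u + c * norm (u - xh)" if u: "u \<in> dom" "norm (u - xh) \<le> \<rho>" for u
      proof -
        have "\<sigma> * norm (u - xh) \<le> \<sigma> * \<rho>" using u \<sigma>0 by simp
        also have "\<dots> < p powr q" using \<sigma>0 p by (simp add: \<rho>_def)
        finally have "0 < G u" using xh(3)[OF u(1)] Gxh by linarith
        then have vu: "0 < val u" by (auto simp: G_def max_def split: if_splits)
        have "q * (p - val u) \<le> p powr (1 - q) * (p powr q - val u powr q)"
          by (rule powr_tangent_le[OF vu p q])
        also have "\<dots> \<le> p powr (1 - q) * (\<sigma> * norm (u - xh))"
          using xh(3)[OF u(1)] Gxh vu by (intro mult_left_mono) (auto simp: G_def)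
        finally have "p - val u \<le> p powr (1 - q) * (\<sigma> * norm (u - xh)) / q"
          using q by (simp add: pos_le_divide_eq mult.commute)
        then show ?thesis by (simp add: c_def p_def mult_ac)
      qed
      \<comment> \<open>The bound of (ii) when the value drops by \<open>s\<close> and the slope
        grows by \<open>s\<close>. Only a drop matters because the exponent \<open>q - 1\<close> is
        nonpositive, and lower semicontinuity controls it.\<close>
      define H where "H s = q * (p - s) powr (q - 1) * (c + s)" for s
      have "isCont H 0" unfolding H_def using p by (intro continuous_intros) auto
      moreover have "H 0 < \<tau>"
      proof -
        have "p powr (q - 1) * p powr (1 - q) = 1" using p by (simp add: powr_add[symmetric])
        then have "H 0 = \<sigma>" using q by (simp add: H_def c_def)
        then show ?thesis using \<sigma> by simp
      qed
      ultimately obtain s where s: "0 < s" "s < p" "H s < \<tau>" using eventually_at_right_less p by blast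
      obtain d where d: "0 < d" "\<And>u. u \<in> dom \<Longrightarrow> norm (u - xh) < d \<Longrightarrow> p - s < val u"
        using val_lsc[OF xh(1), of "p - s"] s(1) unfolding p_def by auto
      define e where "e = min s (min d r')"
      have e: "0 < e" using s d r' by (simp add: e_def)
      obtain x where x: "x \<in> dom" "norm (x - xh) < e" "dsub f x \<le> ereal (c + e)"
        using subgradient_near_local_min[OF acv xh(1) c \<rho> min e] by blast
      have vx: "p - s < val x" using d(2)[OF x(1)] x(2) by (simp add: e_def)
      have "dsub f x \<le> ereal (c + s)" using x(3) by (rule order_trans) (simp add: e_def)
      then have "\<tau> \<le> q * val x powr (q - 1) * (c + s)"
        using x(2) vx s by (intro U(3) r' x(1)) (auto simp: e_def)
      also have "\<dots> \<le> H s"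
        unfolding H_def using q s c vx by (intro mult_right_mono mult_left_mono powr_mono2') auto
      finally show False using s by simp
    qed
  qed
qed

theorem iii_imp_i:
  assumes "cond_iii f xb \<tau> q"
  shows "cond_i f xb \<tau> q"
proof -
  obtain U where U: "open U" "xb \<in> U"
    "\<And>x s. x \<in> U \<Longrightarrow> x \<notin> S \<Longrightarrow> 0 < s \<Longrightarrow> dsub f x \<le> ereal s \<Longrightarrow>
      \<tau> \<le> const * dd x powr (q - 1) * s powr q"
    using cond_iiiD[OF assms] by metis
  obtain r where r: "r > 0" "\<And>x. norm (x - xb) < r \<Longrightarrow> x \<in> U"
    using U(1,2) unfolding open_dist dist_norm by blast
  show ?thesis
  proof (rule cond_iI)
    show "open (ball xb (r / 2))" "xb \<in> ball xb (r / 2)" using r by auto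
    fix x0 assume x0: "x0 \<in> ball xb (r / 2)" "x0 \<in> dom" "0 < val x0"
    show "\<tau> * dd x0 \<le> val x0 powr q"
    proof (rule ccontr)
      assume neg: "\<not> ?thesis"
      define m where "m = val x0"
      have "x0 \<notin> S" using x0 S_iff by simp
      then have d0: "0 < dd x0" by (rule dd_pos)
      have m: "0 < m" using x0 by (simp add: m_def)
      have mq: "m powr q < \<tau> * dd x0" using neg by (simp add: m_def)
      \<comment> \<open>\<alpha> is the fraction of the distance granted to Ekeland's principle. The
        optimal choice \<open>q\<close> makes the left side equal to \<open>m^q / dd x0\<close>; for
        \<open>q = 1\<close> it would leave no distance, so \<alpha> is taken slightly below
        1.\<close>
      have "\<exists>\<alpha>. 0 < \<alpha> \<and> \<alpha> < 1 \<and>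
        const * ((1 - \<alpha>) * dd x0) powr (q - 1) * (m / (\<alpha> * dd x0)) powr q < \<tau>"
      proof (cases "q = 1")
        case True
        have "m / (\<tau> * dd x0) < 1" using mq True m tau d0 by (simp add: pos_divide_less_eq)
        then obtain \<alpha> where \<alpha>: "m / (\<tau> * dd x0) < \<alpha>" "\<alpha> < 1" using dense by blast
        moreover have "0 < m / (\<tau> * dd x0)" using m tau d0 by simp
        ultimately have "0 < \<alpha>" by linarith
        moreover have "m / (\<alpha> * dd x0) < \<tau>"
          using \<alpha>(1) \<open>0 < \<alpha>\<close> tau d0 by (simp add: field_simps)
        moreover have "const = 1" unfolding const_def by (simp add: True pow0_def)
        ultimately show ?thesis using True \<alpha> d0 m by (intro exI[of _ \<alpha>]) simp
      next
        case False
        then have q1: "q < 1" using q by simp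
        have "((1 - q) * dd x0) powr (q - 1) = (1 - q) powr (q - 1) * (dd x0 powr q / dd x0)"
          using q1 d0 by (simp add: powr_mult powr_diff)
        moreover have "(m / (q * dd x0)) powr q = m powr q / (q powr q * dd x0 powr q)"
          using q m d0 by (simp add: powr_divide powr_mult)
        moreover have "const = q powr q * (1 - q) powr (1 - q)" using q q1 by (simp add: const_def pow0_def)
        ultimately have "const * ((1 - q) * dd x0) powr (q - 1) * (m / (q * dd x0)) powr q
            = (q powr q * ((1 - q) powr (1 - q) * (1 - q) powr (q - 1)) * (dd x0 powr q / dd x0))
              * (m powr q / (q powr q * dd x0 powr q))"
          by (simp only: mult_ac)
        also have "(1 - q) powr (1 - q) * (1 - q) powr (q - 1) = 1"
          using q1 by (simp add: powr_add[symmetric])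
        also have "(q powr q * 1 * (dd x0 powr q / dd x0)) * (m powr q / (q powr q * dd x0 powr q)) = m powr q / dd x0"
          using q d0 by simp
        also have "\<dots> < \<tau>" using mq d0 by (simp add: pos_divide_less_eq)
        finally show ?thesis using q q1 by blast
      qed
      then obtain \<alpha> where \<alpha>: "0 < \<alpha>" "\<alpha> < 1"
        "const * ((1 - \<alpha>) * dd x0) powr (q - 1) * (m / (\<alpha> * dd x0)) powr q < \<tau>" by blast
      define \<sigma> where "\<sigma> = m / (\<alpha> * dd x0)"
      have \<sigma>: "0 < \<sigma>" using m \<alpha> d0 by (simp add: \<sigma>_def)
      define G where "G u = max (val u) 0" for u
      have "{(u, r). u \<in> dom \<and> G u \<le> r} = {(u, r). u \<in> dom \<and> max (val u) 0 powr 1 \<le> r}"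
        by (auto simp: G_def)
      then have epi: "closed {(u, r). u \<in> dom \<and> G u \<le> r}" using epigraph_powr_closed[of 1] by simp
      have G0: "0 \<le> G u" for u by (simp add: G_def)
      obtain xh where xh: "xh \<in> dom" "G xh + \<sigma> * norm (xh - x0) \<le> G x0"
        "\<And>u. u \<in> dom \<Longrightarrow> G xh \<le> G u + \<sigma> * norm (u - xh)"
        using Ekeland[OF epi x0(2) G0 \<sigma>] by blast
      have "G x0 = m" using x0 by (simp add: G_def m_def)
      then have "\<sigma> * norm (xh - x0) \<le> m" using xh(2) G0[of xh] by linarith
      also have "m = \<sigma> * (\<alpha> * dd x0)" using \<alpha> d0 by (simp add: \<sigma>_def)
      finally have close: "norm (xh - x0) \<le> \<alpha> * dd x0" using \<sigma> by simp
      have "\<alpha> * dd x0 < 1 * dd x0" using \<alpha> d0 by (intro mult_strict_right_mono) auto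
      then have close': "norm (xh - x0) < dd x0" using close by simp
      define p where "p = val xh"
      have "xh \<notin> S" by (rule not_in_S_if_close[OF close'])
      then have p: "0 < p" using S_iff xh(1) by (simp add: p_def)
      have Gxh: "G xh = p" using p by (simp add: G_def p_def)
      have "norm (xh - xb) < r"
        using close_to_xb[of xh x0 r] close' x0(1) by (simp add: dist_norm norm_minus_commute)
      then obtain r' where r': "r' > 0" "\<And>x. norm (x - xh) < r' \<Longrightarrow> x \<in> U"
        using r(2) U(1) unfolding open_dist dist_norm by blast
      define \<rho> where "\<rho> = p / (2 * \<sigma>)"
      have \<rho>: "0 < \<rho>" using p \<sigma> by (simp add: \<rho>_def)
      have min: "val xh \<le> val u + \<sigma> * norm (u - xh)" if u: "u \<in> dom" "norm (u - xh) \<le> \<rho>" for u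
      proof -
        have "\<sigma> * norm (u - xh) \<le> \<sigma> * \<rho>" using u \<sigma> by simp
        also have "\<dots> < p" using \<sigma> p by (simp add: \<rho>_def)
        finally have "0 < G u" using xh(3)[OF u(1)] Gxh by linarith
        then have "G u = val u" by (auto simp: G_def max_def split: if_splits)
        then show ?thesis using xh(3)[OF u(1)] Gxh by (simp add: p_def)
      qed
      define b where "b = (1 - \<alpha>) * dd x0"
      have b: "0 < b" using \<alpha> d0 by (simp add: b_def)
      have dd_xh: "b \<le> dd xh"
        using infdist_triangle[of x0 S xh] close by (simp add: b_def dist_norm norm_minus_commute algebra_simps)
      \<comment> \<open>The bound of (iii) when the distance, at least \<open>b\<close> at
        \<open>xh\<close>, shrinks by \<open>s\<close> and the slope grows by
        \<open>s\<close>.\<close>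
      define H where "H s = const * (b - s) powr (q - 1) * (\<sigma> + s) powr q" for s
      have "isCont H 0" unfolding H_def using b \<sigma> by (intro continuous_intros) auto
      moreover have "H 0 < \<tau>" using \<alpha>(3) by (simp add: H_def b_def \<sigma>_def)
      ultimately obtain s where s: "0 < s" "s < b" "H s < \<tau>" using eventually_at_right_less b by blast
      obtain d where d: "0 < d" "\<And>u. u \<in> dom \<Longrightarrow> norm (u - xh) < d \<Longrightarrow> 0 < val u"
        using val_lsc[OF xh(1), of 0] p unfolding p_def by auto
      define e where "e = min s (min d r')"
      have e: "0 < e" using s d r' by (simp add: e_def)
      obtain x where x: "x \<in> dom" "norm (x - xh) < e" "dsub f x \<le> ereal (\<sigma> + e)"
        using subgradient_near_local_min[OF acv xh(1) less_imp_le[OF \<sigma>] \<rho> min e] by blast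
      have xS: "x \<notin> S" using d(2)[OF x(1)] x(2) S_iff by (simp add: e_def)
      have "dsub f x \<le> ereal (\<sigma> + s)" using x(3) by (rule order_trans) (simp add: e_def)
      then have "\<tau> \<le> const * dd x powr (q - 1) * (\<sigma> + s) powr q"
        using x(2) xS s \<sigma> by (intro U(3) r') (auto simp: e_def)
      also have "\<dots> \<le> H s"
      proof -
        have "norm (x - xh) < s" using x(2) by (simp add: e_def)
        then have "b - s \<le> dd x"
          using infdist_triangle[of xh S x] dd_xh by (simp add: dist_norm norm_minus_commute)
        then show ?thesis unfolding H_def using const_pos q s
          by (intro mult_right_mono mult_left_mono powr_mono2') auto
      qed
      finally show False using s by simp
    qed
  qed
qed

text \<open>The \<open>q\<close>-th power of (ii) contains \<open>f^(q(q-1))\<close>. The error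
  bound (i), already derived from (ii), trades this power for
  \<open>dd x powr (q - 1)\<close>.\<close>

theorem ii_imp_iii:
  assumes ii: "cond_ii f xb \<tau> q"
  shows "cond_iii f xb (pow0 (1 - q) (1 - q) * \<tau>) q"
proof -
  obtain U where U: "open U" "xb \<in> U"
    "\<And>x s. x \<in> U \<Longrightarrow> x \<in> dom \<Longrightarrow> 0 < val x \<Longrightarrow> dsub f x \<le> ereal s \<Longrightarrow> \<tau> \<le> q * val x powr (q - 1) * s"
    using cond_iiD[OF ii] by metis
  obtain V where V: "open V" "xb \<in> V"
    "\<And>x. x \<in> V \<Longrightarrow> x \<in> dom \<Longrightarrow> 0 < val x \<Longrightarrow> \<tau> * dd x \<le> val x powr q"
    using cond_iD[OF ii_imp_i[OF ii]] by metis
  show ?thesis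
    unfolding cond_iii_def const_def[symmetric]
  proof (intro exI[of _ "U \<inter> V"] conjI ballI impI)
    show "open (U \<inter> V)" "xb \<in> U \<inter> V" using U V by auto
    fix x assume x: "x \<in> U \<inter> V" "0 < f x"
    have xS: "x \<notin> S" using x(2) by (simp add: pos_iff)
    then have dx: "0 < dd x" by (rule dd_pos)
    have e1: "epow (edist x S) (q - 1) = ereal (dd x powr (q - 1))"
      using dx by (simp add: edist_S epow_def pow0_def)
    show "ereal (pow0 (1 - q) (1 - q) * \<tau>) \<le> ereal const * epow (edist x S) (q - 1) * epow (dsub f x) q"
    proof (cases "dsub f x = \<infinity>")
      case True
      then have "epow (dsub f x) q = \<infinity>" using q by (simp add: epow_def)
      moreover have "0 < const * dd x powr (q - 1)" using const_pos dx by simp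
      ultimately show ?thesis unfolding e1 using const_pos dx by simp
    next
      case False
      then obtain t where t: "dsub f x = ereal t" "0 \<le> t"
        using dsub_nonneg[of x] by (cases "dsub f x") auto
      have xd: "x \<in> dom"
      proof (rule ccontr)
        assume "x \<notin> dom"
        then have "frechet_subdiff f x = {}" by (simp add: frechet_subdiff_def dom_def)
        then show False using False by (simp add: dsub_def top_ereal_def)
      qed
      define p where "p = val x"
      have p: "0 < p" using xS S_iff xd by (simp add: p_def)
      have ti: "\<tau> \<le> q * p powr (q - 1) * t" using U(3)[OF _ xd] x p t by (simp add: p_def)
      then have "t \<noteq> 0" using tau by auto
      then have t0: "0 < t" using t by simp
      have di: "\<tau> * dd x \<le> p powr q" using V(3)[OF _ xd] x p by (simp add: p_def)
      have "(p powr q / \<tau>) powr (q - 1) \<le> dd x powr (q - 1)"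
        using di tau dx q by (intro powr_mono2') (auto simp: pos_le_divide_eq mult.commute)
      moreover have "\<tau> powr q \<le> (q * p powr (q - 1) * t) powr q"
        using ti tau q by (intro powr_mono2) auto
      ultimately have "(p powr q / \<tau>) powr (q - 1) * \<tau> powr q
          \<le> dd x powr (q - 1) * (q * p powr (q - 1) * t) powr q"
        by (intro mult_mono) auto
      \<comment> \<open>The powers of \<tau> combine to \<tau> itself, and the power of
        \<open>p\<close> is the one on the right-hand side, so it cancels.\<close>
      moreover have "(p powr q / \<tau>) powr (q - 1) * \<tau> powr q = p powr (q * (q - 1)) * \<tau>"
      proof -
        have "(p powr q / \<tau>) powr (q - 1) = p powr (q * (q - 1)) / \<tau> powr (q - 1)"
          using p tau by (simp add: powr_divide powr_powr)
        moreover have "\<tau> powr q = \<tau> powr (q - 1) * \<tau>" using tau by (simp add: powr_diff)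
        ultimately show ?thesis using tau by simp
      qed
      moreover have "(q * p powr (q - 1) * t) powr q = q powr q * p powr (q * (q - 1)) * t powr q"
        using q p t0 by (simp add: powr_mult powr_powr mult.commute)
      ultimately have "p powr (q * (q - 1)) * \<tau>
          \<le> p powr (q * (q - 1)) * (q powr q * dd x powr (q - 1) * t powr q)"
        by (simp add: mult_ac)
      then have "\<tau> \<le> q powr q * dd x powr (q - 1) * t powr q" using p by simp
      then have "pow0 (1 - q) (1 - q) * \<tau> \<le> pow0 (1 - q) (1 - q) * (q powr q * dd x powr (q - 1) * t powr q)"
        by (intro mult_left_mono) (auto simp: pow0_def)
      also have "\<dots> = const * dd x powr (q - 1) * t powr q"
        using q by (simp add: const_def pow0_pos)
      moreover have "epow (dsub f x) q = ereal (t powr q)" using t t0 by (simp add: epow_def pow0_pos)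
      ultimately show ?thesis unfolding e1 by simp
    qed
  qed
qed

text \<open>Both sides reduce to \<open>\<tau> \<le> dsub f x\<close>. Where \<open>f\<close> is
  infinite, the subdifferential is empty and this holds automatically, so the restriction of (ii) to
  finite values agrees with (iii).\<close>

theorem ii_iff_iii:
  assumes q1: "q = 1"
  shows "cond_ii f xb \<tau> q \<longleftrightarrow> cond_iii f xb \<tau> q"
proof -
  have "epow (dsub f x) 1 = dsub f x" for x
    using dsub_nonneg[of x] by (cases "dsub f x") (auto simp: epow_def pow0_def)
  then have iii: "ereal (pow0 q q * pow0 (1 - q) (1 - q)) * epow (edist x S) (q - 1) * epow (dsub f x) q = dsub f x" for x
    using q1 by (simp add: edist_S epow_def pow0_def one_ereal_def[symmetric])
  have ii: "ereal (q * pow0 (real_of_ereal (f x)) (q - 1)) * dsub f x = dsub f x" for x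
    using q1 by (simp add: pow0_def one_ereal_def[symmetric])
  have top: "dsub f x = \<infinity>" if "\<not> f x < \<infinity>" for x
    using that by (simp add: dsub_def frechet_subdiff_def top_ereal_def)
  show ?thesis
    unfolding cond_ii_def cond_iii_def ii iii
  proof (intro iff_exI conj_cong refl ball_cong)
    fix x
    show "(0 < f x \<and> f x < \<infinity> \<longrightarrow> ereal \<tau> \<le> dsub f x) = (0 < f x \<longrightarrow> ereal \<tau> \<le> dsub f x)"
      using top[of x] by (cases "f x < \<infinity>") auto
  qed
qed

end

theorem theorem3p22:
  fixes f :: "'a::banach \<Rightarrow> ereal" and xb :: 'a and \<tau> q :: real
  assumes noninf: "\<forall>x. f x \<noteq> -\<infinity>"
    and lsc: "lsc f"
    and xb: "xb \<in> sublevel f"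
    and asp_or_cvx: "asplund TYPE('a) \<or> ereal_convex f"
    and tau: "\<tau> > 0"
    and q: "0 < q" "q \<le> 1"
  shows "(cond_ii f xb \<tau> q \<longrightarrow> cond_i f xb \<tau> q)
       \<and> (cond_iii f xb \<tau> q \<longrightarrow> cond_i f xb \<tau> q)
       \<and> (cond_ii f xb \<tau> q \<longrightarrow> cond_iii f xb (pow0 (1 - q) (1 - q) * \<tau>) q)
       \<and> (q = 1 \<longrightarrow> (cond_ii f xb \<tau> q \<longleftrightarrow> cond_iii f xb \<tau> q))"
proof -
  interpret error_bound f xb \<tau> q
    by unfold_locales (use assms in auto)
  show ?thesis using ii_imp_i iii_imp_i ii_imp_iii ii_iff_iii by blast
qed

end
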